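(* Let $m\in\mathbb{N}$ and let $X=(X_t)_{t\in\mathbb{Z}^m}$ be a (strictly) stationary centered real-valued random field with $E[|X_t|^{2+\delta}]<\infty$ for some $\delta>0$. Assume that its $\theta$-lex-coefficients satisfy $\theta(h)\in\mathcal{O}(h^{-\alpha})$ as $h\to\infty$ with $\alpha>m(1+\frac1\delta)$. Let $(D_n)_{n\in\mathbb{N}}$ be a sequence of finite subsets of $\mathbb{Z}^m$ with $\lim_{n\to\infty}|D_n|=\infty$ and $\lim_{n\to\infty}|\partial D_n|/|D_n|=0$. Define $$\sigma^2=\sum_{k\in\mathbb{Z}^m}E[X_0X_k\mid\mathcal{I}].$$ Then $\sigma^2$ is (almost surely) finite and non-negative, and $$\frac{1}{|D_n|^{1/2}}\sum_{j\in D_n}X_j\xrightarrow[n\to\infty]{d}\varepsilon\,\sigma,$$ where $\varepsilon$ is a standard normally distributed random variable independent of $\sigma^2$.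
   Context: Lexicographic order: for distinct $y,z\in\mathbb{Z}^m$, $y<_{lex}z$ iff $y_1<z_1$, or for some $p\in\{2,\dots,m\}$ one has $y_p<z_p$ and $y_q=z_q$ for $q=1,\dots,p-1$. $V_t=\{s\in\mathbb{Z}^m: s<_{lex}t\}\cup\{t\}$ and $V_t^h=V_t\cap\{s:\|t-s\|_\infty\ge h\}$. $\theta$-lex-coefficients: for a real-valued field $X=(X_t)_{t\in\mathbb{Z}^m}$, let $\mathcal{G}^*_u$ be the bounded Borel functions $\mathbb{R}^u\to\mathbb{R}$ and $\mathcal{G}_1$ the bounded (globally) Lipschitz functions $\mathbb{R}\to\mathbb{R}$, with Lipschitz constant $Lip(G)$. For $\Gamma=(i_1,\dots,i_u)$ write $X_\Gamma=(X_{i_1},\dots,X_{i_u})$. Then $\theta(h)=\sup_{u\in\mathbb{N}}\theta_u(h)$ with $$\theta_u(h)=\sup\Big\{\frac{|Cov(F(X_\Gamma),G(X_j))|}{\|F\|_\infty Lip(G)}: F\in\mathcal{G}_u^*,\,G\in\mathcal{G}_1,\,j\in\mathbb{Z}^m,\,\Gamma\subset V_j^h,\,|\Gamma|=u\Big\},$$ the supremum being over $F,G$ with non-zero denominator. Boundary: $\partial\Gamma=\{i\in\Gamma:\exists j\in\mathbb{Z}^m\setminus\Gamma,\ \|i-j\|_\infty=1\}$; $|\Gamma|$ denotes cardinality. $\mathcal{I}$ is the $\sigma$-algebra of shift-invariant events of $X$: $\mathcal{I}=\{X^{-1}(B): B\in\mathcal{B}(\mathbb{R}^{\mathbb{Z}^m}),\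 \tau_k^{-1}B=B\ \forall k\in\mathbb{Z}^m\}$, where $(\tau_kx)_i=x_{i+k}$. *)

theory Defs
  imports "HOL-Probability.Probability"
begin

text \<open>
  Points of the lattice are vectors over an arbitrary finite, linearly ordered index type \<open>'m\<close>;
  the dimension is \<open>CARD('m)\<close> and the linear order on \<open>'m\<close> is the order of the coordinates
  that the lexicographic order refers to.
\<close>

type_synonym 'm lattice = "int ^ 'm"

definition lex_less :: "('m::{finite,linorder}) lattice \<Rightarrow> 'm lattice \<Rightarrow> bool" where
  "lex_less y z \<longleftrightarrow> (\<exists>p. y $ p < z $ p \<and> (\<forall>q<p. y $ q = z $ q))"

definition sup_norm :: "('m::finite) lattice \<Rightarrow> int" where
  "sup_norm x = Max (range (\<lambda>p. \<bar>x $ p\<bar>))"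

definition lex_past :: "('m::{finite,linorder}) lattice \<Rightarrow> 'm lattice set" where
  "lex_past t = {s. lex_less s t} \<union> {t}"

definition lex_past_dist :: "('m::{finite,linorder}) lattice \<Rightarrow> nat \<Rightarrow> 'm lattice set" where
  "lex_past_dist t h = lex_past t \<inter> {s. int h \<le> sup_norm (t - s)}"

definition lattice_boundary :: "('m::finite) lattice set \<Rightarrow> 'm lattice set" where
  "lattice_boundary \<Gamma> = {i \<in> \<Gamma>. \<exists>j. j \<notin> \<Gamma> \<and> sup_norm (i - j) = 1}"

definition strictly_stationary ::
    "'a measure \<Rightarrow> (('m::finite) lattice \<Rightarrow> 'a \<Rightarrow> real) \<Rightarrow> bool" where
  "strictly_stationary M X \<longleftrightarrow>
     (\<forall>J k. finite J \<longrightarrow>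
        distr M (\<Pi>\<^sub>M i\<in>J. borel) (\<lambda>\<omega>. \<lambda>i\<in>J. X (i + k) \<omega>) =
        distr M (\<Pi>\<^sub>M i\<in>J. borel) (\<lambda>\<omega>. \<lambda>i\<in>J. X i \<omega>))"

definition cov :: "'a measure \<Rightarrow> ('a \<Rightarrow> real) \<Rightarrow> ('a \<Rightarrow> real) \<Rightarrow> real" where
  "cov M f g =
     integral\<^sup>L M (\<lambda>\<omega>. (f \<omega> - integral\<^sup>L M f) * (g \<omega> - integral\<^sup>L M g))"

text \<open>
  Real \<open>u\<close>-tuples are the points of the product space over \<open>{..<u}\<close>, i.e. functions that are
  \<open>undefined\<close> outside \<open>{..<u}\<close>; the supremum norm therefore only looks at that space.
\<close>

abbreviation tuple_space :: "nat \<Rightarrow> (nat \<Rightarrow> real) measure" where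
  "tuple_space u \<equiv> (\<Pi>\<^sub>M i\<in>{..<u}. borel)"

definition bounded_borel :: "nat \<Rightarrow> ((nat \<Rightarrow> real) \<Rightarrow> real) set" where
  "bounded_borel u =
     {F. F \<in> borel_measurable (tuple_space u) \<and> bounded (F ` space (tuple_space u))}"

definition tuple_sup_norm :: "nat \<Rightarrow> ((nat \<Rightarrow> real) \<Rightarrow> real) \<Rightarrow> real" where
  "tuple_sup_norm u F = (SUP x\<in>space (tuple_space u). \<bar>F x\<bar>)"

definition bounded_lipschitz :: "(real \<Rightarrow> real) set" where
  "bounded_lipschitz = {G. bounded (range G) \<and> (\<exists>L. lipschitz_on L UNIV G)}"

definition Lip :: "(real \<Rightarrow> real) \<Rightarrow> real" where
  "Lip G = Inf {L. lipschitz_on L UNIV G}"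

text \<open>
  The points of \<open>\<Gamma>\<close> are enumerated without repetition by \<open>\<gamma>\<close> on \<open>{..<u}\<close>, so that
  \<open>\<Gamma> = \<gamma> ` {..<u}\<close> has \<open>u\<close> elements. The suprema are taken in the extended nonnegative reals,
  so they are meaningful without any boundedness assumption.
\<close>

definition theta_lex_tuple ::
    "'a measure \<Rightarrow> (('m::{finite,linorder}) lattice \<Rightarrow> 'a \<Rightarrow> real) \<Rightarrow> nat \<Rightarrow> nat \<Rightarrow> ennreal" where
  "theta_lex_tuple M X u h =
     Sup {ennreal (\<bar>cov M (\<lambda>\<omega>. F (\<lambda>i\<in>{..<u}. X (\<gamma> i) \<omega>)) (\<lambda>\<omega>. G (X j \<omega>))\<bar> /
                   (tuple_sup_norm u F * Lip G)) | F G j \<gamma>.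
          F \<in> bounded_borel u \<and> G \<in> bounded_lipschitz \<and> tuple_sup_norm u F * Lip G \<noteq> 0 \<and>
          inj_on \<gamma> {..<u} \<and> \<gamma> ` {..<u} \<subseteq> lex_past_dist j h}"

definition theta_lex ::
    "'a measure \<Rightarrow> (('m::{finite,linorder}) lattice \<Rightarrow> 'a \<Rightarrow> real) \<Rightarrow> nat \<Rightarrow> ennreal" where
  "theta_lex M X h = (SUP u\<in>{1..}. theta_lex_tuple M X u h)"

definition field_shift :: "('m::finite) lattice \<Rightarrow> ('m lattice \<Rightarrow> real) \<Rightarrow> ('m lattice \<Rightarrow> real)" where
  "field_shift k x = (\<lambda>i. x (i + k))"

definition invariant_events ::
    "'a measure \<Rightarrow> (('m::finite) lattice \<Rightarrow> 'a \<Rightarrow> real) \<Rightarrow> 'a set set" where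
  "invariant_events M X =
     {{\<omega> \<in> space M. (\<lambda>t. X t \<omega>) \<in> B} | B.
        B \<in> sets (borel :: ('m lattice \<Rightarrow> real) measure) \<and> (\<forall>k. field_shift k -` B = B)}"

text \<open>
  The invariant events already form a \<open>\<sigma>\<close>-algebra on \<open>space M\<close>; \<open>sigma\<close> only packages
  them as the measure-space argument that \<open>real_cond_exp\<close> expects.
\<close>

definition invariant_algebra ::
    "'a measure \<Rightarrow> (('m::finite) lattice \<Rightarrow> 'a \<Rightarrow> real) \<Rightarrow> 'a measure" where
  "invariant_algebra M X = sigma (space M) (invariant_events M X)"

lemma sigma_algebra_invariant_events: "sigma_algebra (space M) (invariant_events M X)"
  unfolding sigma_algebra_iff2
proof (intro conjI ballI allI impI)
  show "invariant_events M X \<subseteq> Pow (space M)"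
    by (auto simp: invariant_events_def)
  show "{} \<in> invariant_events M X"
    unfolding invariant_events_def by (rule CollectI, rule exI[of _ "{}"]) auto
next
  fix A assume "A \<in> invariant_events M X"
  then obtain B where B: "B \<in> sets borel" "\<forall>k. field_shift k -` B = B"
    "A = {\<omega> \<in> space M. (\<lambda>t. X t \<omega>) \<in> B}"
    unfolding invariant_events_def by blast
  have "- B \<in> sets borel"
    using B(1) by (metis borel_comp)
  moreover have "\<forall>k. field_shift k -` (- B) = - B"
    using B(2) by (simp only: vimage_Compl) simp
  ultimately show "space M - A \<in> invariant_events M X"
    unfolding invariant_events_def using B(3)
    by (intro CollectI exI[of _ "- B"]) auto
next
  fix A :: "nat \<Rightarrow> 'a set" assume "range A \<subseteq> invariant_events M X"
  then have "A n \<in> invariant_events M X" for n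
    by (rule range_subsetD)
  then have "\<exists>B. A n = {\<omega> \<in> space M. (\<lambda>t. X t \<omega>) \<in> B} \<and>
      B \<in> sets borel \<and> (\<forall>k. field_shift k -` B = B)" for n
    unfolding invariant_events_def mem_Collect_eq .
  then have "\<exists>B. \<forall>n. A n = {\<omega> \<in> space M. (\<lambda>t. X t \<omega>) \<in> B n} \<and>
      B n \<in> sets borel \<and> (\<forall>k. field_shift k -` B n = B n)"
    by (intro choice allI)
  then obtain B where "\<forall>n. A n = {\<omega> \<in> space M. (\<lambda>t. X t \<omega>) \<in> B n} \<and>
      B n \<in> sets borel \<and> (\<forall>k. field_shift k -` B n = B n)" ..
  then have B: "A n = {\<omega> \<in> space M. (\<lambda>t. X t \<omega>) \<in> B n}"
      "B n \<in> sets borel" "field_shift k -` B n = B n" for n k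
    by iprover+
  have "(\<Union>n. B n) \<in> sets borel"
    using B(2) by (intro sets.countable_UN) blast
  moreover have "\<forall>k. field_shift k -` (\<Union>n. B n) = (\<Union>n. B n)"
    by (simp only: vimage_UN B(3)) simp
  moreover have "(\<Union>n. A n) = {\<omega> \<in> space M. (\<lambda>t. X t \<omega>) \<in> (\<Union>n. B n)}"
    unfolding B(1) by blast
  ultimately show "(\<Union>n. A n) \<in> invariant_events M X"
    unfolding invariant_events_def by blast
qed

lemma sets_invariant_algebra: "sets (invariant_algebra M X) = invariant_events M X"
proof -
  interpret sigma_algebra "space M" "invariant_events M X"
    by (rule sigma_algebra_invariant_events)
  show ?thesis
    by (simp add: invariant_algebra_def sets_measure_of space_closed sigma_sets_eq)
qed

definition invariant_covariance ::
    "'a measure \<Rightarrow> (('m::finite) lattice \<Rightarrow> 'a \<Rightarrow> real) \<Rightarrow> 'm lattice \<Rightarrow> 'a \<Rightarrow> real" where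
  "invariant_covariance M X k =
     real_cond_exp M (invariant_algebra M X) (\<lambda>\<omega>. X 0 \<omega> * X k \<omega>)"

text \<open>
  The series over the lattice is an unordered sum; \<open>infsum\<close> is \<open>0\<close> where it does not converge,
  so finiteness has to be stated separately through \<open>summable_on\<close>.
\<close>

definition asymptotic_variance ::
    "'a measure \<Rightarrow> (('m::finite) lattice \<Rightarrow> 'a \<Rightarrow> real) \<Rightarrow> 'a \<Rightarrow> real" where
  "asymptotic_variance M X \<omega> = (\<Sum>\<^sub>\<infinity>k. invariant_covariance M X k \<omega>)"

end

theory Submission
  imports Defs
begin

text \<open>
  Why the theorem holds. Dependence is controlled only between one point \<open>j\<close> and its lexicographic past,
  so the natural proof adds the points of \<open>D n\<close> one at a time in lexicographic order. On the level of
  characteristic functions, the sum over \<open>D n\<close> is compared with a sum in which every point carries,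
  conditionally on the invariant events, an independent centred Gaussian of variance \<open>\<sigma>\<^sup>2\<close>: the hybrid
  in which the points from \<open>k\<close> on are still Gaussian has as characteristic function the expectation of
  the exponential of the partial sum, times a damping factor that is a function of \<open>\<sigma>\<^sup>2\<close>. No Gaussian
  variables have to be constructed until the very end, where \<open>exp (- u\<^sup>2 \<sigma>\<^sup>2 / 2)\<close> is recognised as the
  conditional characteristic function of \<open>\<epsilon> \<sigma>\<close> (\<open>char_normal_mixture\<close>) and Levy's continuity theorem
  applies.

  Suppose first that the field is bounded. The increment at \<open>k\<close> is expanded to second order
  (\<open>increment_expansion\<close>). In the linear term the past of \<open>k\<close> is removed point by point, nearest points
  first; the part at distance greater than \<open>M\<close> costs only the tail of the coefficients
  (\<open>far_past_le\<close>), and the part up to distance \<open>M\<close> turns \<open>x\<^sub>k\<^sup>2\<close> into the local variance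
  \<open>x\<^sub>k\<^sup>2 + 2 \<Sum>\<^sub>v x\<^sub>k x\<^sub>k\<^sub>+\<^sub>v\<close>, summed over \<open>v\<close> before \<open>0\<close> of norm at most \<open>M\<close> (\<open>comparison_le\<close>). It
  remains to see that the local variance may be replaced by its conditional expectation given the
  invariant events, although it is multiplied by a weight that depends on the past. A hyperplane slice
  of a Folner set is a small part of it (\<open>folner_slice_small\<close>), so the lexicographic pasts of \<open>k\<close> and
  \<open>k + v\<close> differ by few points of \<open>D n\<close>. The weights are thus almost constant under translations, the local
  variance may be averaged over translations (\<open>weighted_average_le\<close>), and the mean ergodic theorem
  (\<open>mean_ergodic\<close>) applies. The result is \<open>bounded_comparison\<close>.

  Three facts make the invariant events and the unbounded field fit into this scheme. An invariant
  variable is the limit of cylinder functions situated arbitrarily far in the past, so it can be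
  inserted into every covariance bound (\<open>cov_invariant_cylinder_le\<close>). Cutting the earlier variable off at
  a suitable level gives covariances, and conditional covariances, that are summable over the lattice
  because \<open>\<alpha> > m (1 + 1 / \<delta>)\<close> (\<open>covariance_le_cov_bound\<close>); hence \<open>\<sigma>\<^sup>2\<close> is almost surely finite,
  and it is nonnegative as a limit of normalised second moments (\<open>V_nonneg\<close>). Finally, these bounds are
  uniform over all centred functions of the field with Lipschitz constant \<open>1\<close>, so truncating the field
  changes neither the normalised sums nor the variance much
  (\<open>characteristic_function_convergence\<close>).

  The boundary condition enters only through the Folner property (\<open>folner_if_boundary_negligible\<close>). All
  arguments take place on the space of configurations with the law of the field, where the shifts act,
  and are transferred back at the end.
\<close>

section \<open>The lattice: supremum norm, lexicographic order, Folner sequences\<close>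

lemma sup_norm_le_iff: "sup_norm x \<le> c \<longleftrightarrow> (\<forall>p. \<bar>x $ p\<bar> \<le> c)"
  unfolding sup_norm_def by (subst Max_le_iff) auto

lemma component_le_sup_norm: "\<bar>x $ p\<bar> \<le> sup_norm x"
  using sup_norm_le_iff[of x "sup_norm x"] by simp

lemma sup_norm_nonneg: "0 \<le> sup_norm x"
  using component_le_sup_norm[of x undefined] by linarith

lemma sup_norm_attained: "\<exists>p. sup_norm x = \<bar>x $ p\<bar>"
proof -
  have "sup_norm x \<in> range (\<lambda>p. \<bar>x $ p\<bar>)"
    unfolding sup_norm_def by (rule Max_in) auto
  then show ?thesis by auto
qed

lemma sup_norm_eq_0_iff: "sup_norm x = 0 \<longleftrightarrow> x = 0"
proof
  assume "sup_norm x = 0"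
  then have "\<bar>x $ p\<bar> \<le> 0" for p using component_le_sup_norm[of x p] by simp
  then show "x = 0" by (simp add: vec_eq_iff)
next
  assume "x = 0"
  then have "sup_norm x \<le> 0" by (simp add: sup_norm_le_iff)
  then show "sup_norm x = 0" using sup_norm_nonneg[of x] by simp
qed

lemma sup_norm_minus: "sup_norm (- x) = sup_norm x"
  by (simp add: sup_norm_def)

lemma sup_norm_minus_commute: "sup_norm (x - y) = sup_norm (y - x)"
  using sup_norm_minus[of "x - y"] by simp

lemma finite_lattice_box: "finite {k :: 'm::finite lattice. \<forall>p. k $ p \<in> A}" if "finite A"
proof -
  have "vec_nth ` {k :: 'm lattice. \<forall>p. k $ p \<in> A} \<subseteq> PiE UNIV (\<lambda>_. A)" by auto
  moreover have "finite (PiE (UNIV :: 'm set) (\<lambda>_. A))" using that by (intro finite_PiE) auto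
  moreover have "inj_on vec_nth {k :: 'm lattice. \<forall>p. k $ p \<in> A}"
    by (auto simp: inj_on_def vec_eq_iff)
  ultimately show ?thesis by (meson finite_imageD finite_subset)
qed

lemma finite_sup_norm_ball: "finite {k. sup_norm k \<le> c}"
proof -
  have "{k. sup_norm k \<le> c} \<subseteq> {k. \<forall>p. k $ p \<in> {-c..c}}"
    by (auto simp: sup_norm_le_iff abs_le_iff) (metis minus_le_iff)
  then show ?thesis using finite_lattice_box[of "{-c..c}"] finite_subset by blast
qed

lemma lex_less_irrefl: "\<not> lex_less x x"
  by (simp add: lex_less_def)

lemma lex_less_trans: "lex_less x y \<Longrightarrow> lex_less y z \<Longrightarrow> lex_less x z"
proof -
  assume "lex_less x y" "lex_less y z"
  then obtain p q where p: "x $ p < y $ p" "\<forall>r<p. x $ r = y $ r"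
    and q: "y $ q < z $ q" "\<forall>r<q. y $ r = z $ r" unfolding lex_less_def by blast
  show ?thesis unfolding lex_less_def
    by (rule exI[of _ "min p q"], cases p q rule: linorder_cases) (use p q in auto)
qed

lemma lex_less_total: "x \<noteq> y \<Longrightarrow> lex_less x y \<or> lex_less y x"
proof -
  assume "x \<noteq> y"
  then have ne: "{p. x $ p \<noteq> y $ p} \<noteq> {}" by (auto simp: vec_eq_iff)
  define p where "p = Min {p. x $ p \<noteq> y $ p}"
  have "p \<in> {p. x $ p \<noteq> y $ p}" unfolding p_def using ne by (intro Min_in) auto
  then have dj: "x $ p < y $ p \<or> y $ p < x $ p" by fastforce
  have *: "x $ q = y $ q" if "q < p" for q
  proof (rule ccontr)
    assume "x $ q \<noteq> y $ q"
    then have "p \<le> q" unfolding p_def by (intro Min_le) auto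
    with that show False by simp
  qed
  moreover have "lex_less x y" if "x $ p < y $ p"
    unfolding lex_less_def using * that by blast
  moreover have "lex_less y x" if "y $ p < x $ p"
    unfolding lex_less_def using * that by (intro exI[of _ p]) simp
  ultimately show ?thesis using dj by blast
qed

lemma lex_less_asym: "lex_less x y \<Longrightarrow> \<not> lex_less y x"
  using lex_less_trans lex_less_irrefl by blast

lemma lex_less_add_iff: "lex_less (x + v) (y + v) \<longleftrightarrow> lex_less x y"
  by (simp add: lex_less_def)

lemma lex_less_0_iff: "lex_less (k + v) k \<longleftrightarrow> lex_less v 0"
  using lex_less_add_iff[of v k 0] by (simp add: add.commute)

lemma lex_less_uminus_iff: "lex_less (- v) 0 \<longleftrightarrow> lex_less 0 v"
  using lex_less_add_iff[of "-v" v 0] by simp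

text \<open>
  The coordinate that the lexicographic order compares first.
\<close>

definition lead :: "('m::{finite,linorder}) lattice \<Rightarrow> int" where
  "lead x = x $ Min UNIV"

lemma lead_add: "lead (x + y) = lead x + lead y"
  by (simp add: lead_def)

lemma abs_lead_le: "\<bar>lead x\<bar> \<le> sup_norm x"
  unfolding lead_def by (rule component_le_sup_norm)

lemma lex_less_if_lead_less: "lead x < lead y \<Longrightarrow> lex_less x y"
  unfolding lead_def lex_less_def
  by (rule exI[of _ "Min UNIV"]) (auto simp: leD)

lemma lead_le_if_lex_less: "lex_less x y \<Longrightarrow> lead x \<le> lead y"
  using lex_less_asym lex_less_if_lead_less not_le by blast

lemma mem_lex_past_distI:
  "lex_less s t \<Longrightarrow> int h \<le> sup_norm (t - s) \<Longrightarrow> s \<in> lex_past_dist t h"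
  by (simp add: lex_past_dist_def lex_past_def)

text \<open>
  Every finite set can be moved into any remote part of the lexicographic past. This is what makes
  the invariant events behave as if they were part of that past.
\<close>

lemma ex_translate_into_lex_past:
  assumes "finite \<Gamma>"
  shows "\<exists>v. (\<lambda>s. s + v) ` \<Gamma> \<subseteq> lex_past_dist t h"
proof -
  define R where "R = (\<Sum>s\<in>\<Gamma>. \<bar>lead s\<bar>) + \<bar>lead t\<bar> + int h + 1"
  define v where "v = (- (\<chi> i. R) :: 'a lattice)"
  have "s + v \<in> lex_past_dist t h" if "s \<in> \<Gamma>" for s
  proof (rule mem_lex_past_distI)
    have "\<bar>lead s\<bar> \<le> (\<Sum>s\<in>\<Gamma>. \<bar>lead s\<bar>)"
      using assms that by (intro member_le_sum) auto
    moreover have lv: "lead v = - R" by (simp add: lead_def v_def)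
    ultimately have *: "lead (s + v) + int h < lead t"
      unfolding lead_add R_def by linarith
    then show "lex_less (s + v) t" by (intro lex_less_if_lead_less) simp
    have "int h \<le> \<bar>lead (t - (s + v))\<bar>" using * by (simp add: lead_def)
    then show "int h \<le> sup_norm (t - (s + v))" using abs_lead_le order_trans by blast
  qed
  then show ?thesis by blast
qed

lemma sum_max1_powr_le:
  assumes "s > 1"
  shows "\<exists>C. \<forall>c. (\<Sum>z\<in>{-int c..int c}. real_of_int (max 1 \<bar>z\<bar>) powr - s) \<le> C"
proof -
  define g where "g z = real_of_int (max 1 \<bar>z\<bar>) powr - s" for z
  have sm: "summable (\<lambda>n. real n powr - s)" using assms by (simp add: summable_real_powr_iff)
  have "(\<Sum>z\<in>{-int c..int c}. g z) \<le> 2 + 2 * (\<Sum>n. real n powr - s)" for c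
  proof -
    have split: "{-int c..int c} = (\<lambda>n. int n) ` {0..c} \<union> (\<lambda>n. - int n) ` {0..c}"
    proof (intro set_eqI iffI)
      fix z assume "z \<in> {-int c..int c}"
      then show "z \<in> (\<lambda>n. int n) ` {0..c} \<union> (\<lambda>n. - int n) ` {0..c}"
        by (cases z rule: int_cases2) auto
    qed auto
    have one: "(\<Sum>n\<in>{0..c}. g (int n)) \<le> 1 + (\<Sum>n. real n powr - s)"
    proof -
      have "(\<Sum>n\<in>{0..c}. g (int n)) = g 0 + (\<Sum>n\<in>{1..c}. g (int n))"
        by (subst sum.atLeast_Suc_atMost) auto
      also have "(\<Sum>n\<in>{1..c}. g (int n)) = (\<Sum>n\<in>{1..c}. real n powr - s)"
        by (intro sum.cong) (auto simp: g_def max_def)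
      also have "\<dots> \<le> (\<Sum>n. real n powr - s)" by (rule sum_le_suminf[OF sm]) auto
      finally show ?thesis by (simp add: g_def)
    qed
    have "(\<Sum>z\<in>{-int c..int c}. g z)
        \<le> (\<Sum>z\<in>(\<lambda>n. int n) ` {0..c}. g z) + (\<Sum>z\<in>(\<lambda>n. - int n) ` {0..c}. g z)"
    proof -
      have un: "(\<Sum>z\<in>A \<union> B. g z) \<le> (\<Sum>z\<in>A. g z) + (\<Sum>z\<in>B. g z)"
        if "finite A" "finite B" for A B
      proof -
        have "0 \<le> (\<Sum>z\<in>A \<inter> B. g z)" by (rule sum_nonneg) (simp add: g_def)
        then show ?thesis using sum.union_inter[OF that, of g] by linarith
      qed
      show ?thesis unfolding split by (rule un) auto
    qed
    also have "\<dots> = (\<Sum>n\<in>{0..c}. g (int n)) + (\<Sum>n\<in>{0..c}. g (int n))"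
      by (subst (1 2) sum.reindex) (auto simp: inj_on_def g_def)
    finally show ?thesis using one by linarith
  qed
  then show ?thesis unfolding g_def by blast
qed

text \<open>
  Since \<open>max 1 \<bar>k\<bar>\<^sub>\<infinity>\<close> dominates the geometric mean of the numbers \<open>max 1 \<bar>k\<^sub>p\<bar>\<close>, the sum over a
  box is at most the product of \<open>CARD('m)\<close> one-dimensional sums with exponent
  \<open>\<beta> / CARD('m) > 1\<close>.
\<close>

lemma summable_on_sup_norm_powr:
  assumes "\<beta> > real CARD('m::finite)"
  shows "(\<lambda>k :: 'm lattice. real_of_int (max 1 (sup_norm k)) powr - \<beta>) summable_on UNIV"
proof -
  define s where "s = \<beta> / real CARD('m)"
  have s: "s > 1" using assms by (simp add: s_def field_simps)
  define g where "g z = real_of_int (max 1 \<bar>z\<bar>) powr - s" for z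
  obtain C where C: "\<And>c. (\<Sum>z\<in>{-int c..int c}. g z) \<le> C"
    using sum_max1_powr_le[OF s] unfolding g_def by blast
  have g0: "0 \<le> g z" for z by (simp add: g_def)
  have le: "real_of_int (max 1 (sup_norm k)) powr - \<beta> \<le> (\<Prod>p\<in>UNIV. g (k $ p))"
    for k :: "'m lattice"
  proof -
    have "real_of_int (max 1 (sup_norm k)) powr - \<beta>
        = (\<Prod>p\<in>(UNIV::'m set). real_of_int (max 1 (sup_norm k)) powr - s)"
      by (simp add: powr_power s_def)
    also have "\<dots> \<le> (\<Prod>p\<in>UNIV. g (k $ p))"
    proof (rule prod_mono, safe)
      fix p
      have "max 1 \<bar>k $ p\<bar> \<le> max 1 (sup_norm k)" using component_le_sup_norm[of k p] by simp
      then show "real_of_int (max 1 (sup_norm k)) powr - s \<le> g (k $ p)"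
        unfolding g_def using s
        by (intro powr_mono2') (auto simp del: of_int_max)
    qed auto
    finally show ?thesis .
  qed
  show ?thesis
  proof (rule nonneg_bdd_above_summable_on)
    show "bdd_above (sum (\<lambda>k :: 'm lattice. real_of_int (max 1 (sup_norm k)) powr - \<beta>) `
      {F. F \<subseteq> UNIV \<and> finite F})"
    proof (rule bdd_aboveI2, safe)
      fix F :: "'m lattice set" assume F: "finite F"
      define c where "c = nat (\<Sum>k\<in>F. sup_norm k)"
      define Q where "Q = {k :: 'm lattice. \<forall>p. k $ p \<in> {-int c..int c}}"
      have fQ: "finite Q" unfolding Q_def by (rule finite_lattice_box) simp
      have FQ: "F \<subseteq> Q"
      proof
        fix k assume "k \<in> F"
        then have "sup_norm k \<le> (\<Sum>k\<in>F. sup_norm k)"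
          using F sup_norm_nonneg by (intro member_le_sum) auto
        then have "sup_norm k \<le> int c" unfolding c_def by linarith
        have "k $ p \<in> {-int c..int c}" for p
          using component_le_sup_norm[of k p] \<open>sup_norm k \<le> int c\<close>
          unfolding atLeastAtMost_iff by linarith
        then show "k \<in> Q" unfolding Q_def by blast
      qed
      have "(\<Sum>k\<in>F. real_of_int (max 1 (sup_norm k)) powr - \<beta>)
          \<le> (\<Sum>k\<in>Q. \<Prod>p\<in>UNIV. g (k $ p))"
        by (rule order_trans[OF sum_mono[OF le] sum_mono2[OF fQ FQ]])
           (auto simp: g0 intro!: prod_nonneg)
      also have "\<dots> = (\<Sum>h\<in>PiE UNIV (\<lambda>_. {-int c..int c}). \<Prod>p\<in>(UNIV::'m set). g (h p))"
        by (rule sum.reindex_bij_witness[of _ vec_lambda vec_nth]) (auto simp: Q_def)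
      also have "\<dots> = (\<Prod>p\<in>(UNIV::'m set). \<Sum>z\<in>{-int c..int c}. g z)"
        by (rule prod_sum_PiE[symmetric]) auto
      also have "\<dots> \<le> (\<Prod>p\<in>(UNIV::'m set). C)"
        by (rule prod_mono) (auto intro!: sum_nonneg C simp: g0)
      finally show "(\<Sum>k\<in>F. real_of_int (max 1 (sup_norm k)) powr - \<beta>)
          \<le> (\<Prod>p\<in>(UNIV::'m set). C)" .
    qed
  qed simp
qed

text \<open>
  A Folner sequence of the group \<open>\<int>\<^sup>m\<close>: every fixed translation moves only a vanishing proportion of
  \<open>D n\<close> out of \<open>D n\<close>.
\<close>

definition folner :: "(nat \<Rightarrow> ('m::finite) lattice set) \<Rightarrow> bool" where
  "folner D \<longleftrightarrow> (\<forall>n. finite (D n)) \<and> (\<forall>\<^sub>F n in sequentially. 0 < card (D n)) \<and>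
     (\<forall>v. (\<lambda>n. real (card {k \<in> D n. k + v \<notin> D n}) / real (card (D n))) \<longlonglongrightarrow> 0)"

text \<open>
  A unit step that leaves \<open>D n\<close> starts in the boundary, and every translation is a composition of
  unit steps.
\<close>

lemma folner_if_boundary_negligible:
  fixes D :: "nat \<Rightarrow> ('m::finite) lattice set"
  assumes fin: "\<And>n. finite (D n)"
    and inf: "filterlim (\<lambda>n. card (D n)) at_top sequentially"
    and bd: "(\<lambda>n. real (card (lattice_boundary (D n))) / real (card (D n))) \<longlonglongrightarrow> 0"
  shows "folner D"
proof -
  define r where "r v n = real (card {k \<in> D n. k + v \<notin> D n}) / real (card (D n))" for v n
  have unit: "r v \<longlonglongrightarrow> 0" if "sup_norm v = 1" for v
  proof (rule tendsto_sandwich[OF _ _ tendsto_const bd])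
    show "\<forall>\<^sub>F n in sequentially. r v n \<le> real (card (lattice_boundary (D n))) / real (card (D n))"
    proof (intro always_eventually allI)
      fix n
      have "card {k \<in> D n. k + v \<notin> D n} \<le> card (lattice_boundary (D n))"
      proof (rule card_mono)
        show "finite (lattice_boundary (D n))" using fin by (simp add: lattice_boundary_def)
        show "{k \<in> D n. k + v \<notin> D n} \<subseteq> lattice_boundary (D n)"
        proof (unfold lattice_boundary_def, safe)
          fix k assume "k + v \<notin> D n"
          then show "\<exists>j. j \<notin> D n \<and> sup_norm (k - j) = 1"
            by (intro exI[of _ "k + v"]) (simp add: sup_norm_minus that)
        qed
      qed
      then show "r v n \<le> real (card (lattice_boundary (D n))) / real (card (D n))"
        unfolding r_def by (intro divide_right_mono) auto
    qed
  qed (simp add: r_def)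
  have add: "r (v + w) \<longlonglongrightarrow> 0" if "r v \<longlonglongrightarrow> 0" "r w \<longlonglongrightarrow> 0" for v w
  proof (rule tendsto_sandwich[OF _ _ tendsto_const])
    show "(\<lambda>n. r v n + r w n) \<longlonglongrightarrow> 0" using tendsto_add[OF that] by simp
    show "\<forall>\<^sub>F n in sequentially. r (v + w) n \<le> r v n + r w n"
    proof (intro always_eventually allI)
      fix n
      have "card {k \<in> D n. k + (v + w) \<notin> D n}
          \<le> card ({k \<in> D n. k + v \<notin> D n} \<union> (\<lambda>k. k - v) ` {k \<in> D n. k + w \<notin> D n})"
      proof (rule card_mono)
        show "{k \<in> D n. k + (v + w) \<notin> D n} \<subseteq>
            {k \<in> D n. k + v \<notin> D n} \<union> (\<lambda>k. k - v) ` {k \<in> D n. k + w \<notin> D n}"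
        proof safe
          fix k assume k: "k \<in> D n" "k + (v + w) \<notin> D n"
            and "k \<notin> (\<lambda>k. k - v) ` {k \<in> D n. k + w \<notin> D n}" "k + v \<in> D n"
          then have "k + v + w \<in> D n"
            by (metis (mono_tags, lifting) add_diff_cancel_right' imageI mem_Collect_eq)
          with k show False by (simp add: add.assoc)
        qed
      qed (use fin in auto)
      also have "\<dots> \<le> card {k \<in> D n. k + v \<notin> D n} + card ((\<lambda>k. k - v) ` {k \<in> D n. k + w \<notin> D n})"
        by (rule card_Un_le)
      also have "\<dots> \<le> card {k \<in> D n. k + v \<notin> D n} + card {k \<in> D n. k + w \<notin> D n}"
        using fin by (intro add_left_mono card_image_le) simp
      finally show "r (v + w) n \<le> r v n + r w n"
        unfolding r_def add_divide_distrib[symmetric]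
        by (intro divide_right_mono) (auto simp flip: of_nat_add)
    qed
  qed (simp add: r_def)
  have all: "r v \<longlonglongrightarrow> 0" if "sup_norm v = int d" for v :: "'m lattice" and d
    using that
  proof (induction d arbitrary: v)
    case 0
    then show ?case by (simp add: sup_norm_eq_0_iff r_def)
  next
    case (Suc d)
    define e where "e = (\<chi> p. sgn (v $ p))"
    have "sup_norm (v - e) \<le> int d" unfolding sup_norm_le_iff
    proof
      fix p
      show "\<bar>(v - e) $ p\<bar> \<le> int d"
        using component_le_sup_norm[of v p] Suc.prems
        by (cases "v $ p" "0::int" rule: linorder_cases) (auto simp: e_def)
    qed
    obtain q where q: "\<bar>v $ q\<bar> = int d + 1"
      using sup_norm_attained[of v] Suc.prems by (metis of_nat_Suc add.commute)
    have "\<bar>(v - e) $ q\<bar> = int d" using q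
      by (cases "v $ q" "0::int" rule: linorder_cases) (auto simp: e_def)
    then have d: "sup_norm (v - e) = int d"
      using \<open>sup_norm (v - e) \<le> int d\<close> component_le_sup_norm[of "v - e" q] by simp
    have "sup_norm e \<le> 1" unfolding sup_norm_le_iff by (simp add: e_def sgn_if)
    moreover have "\<bar>e $ q\<bar> = 1" using q by (auto simp: e_def sgn_if)
    ultimately have "sup_norm e = 1" using component_le_sup_norm[of e q] by simp
    from add[OF Suc.IH[OF d] unit[OF this]] show ?case by simp
  qed
  have "r v \<longlonglongrightarrow> 0" for v :: "'m lattice"
    using all[of v "nat (sup_norm v)"] sup_norm_nonneg[of v] by simp
  moreover have "\<forall>\<^sub>F n in sequentially. 0 < card (D n)"
    using inf[unfolded filterlim_at_top, rule_format, of 1] by eventually_elim simp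
  ultimately show ?thesis unfolding folner_def r_def using fin by blast
qed

lemma folner_finite: "folner D \<Longrightarrow> finite (D n)"
  by (simp add: folner_def)

lemma folner_eventually_pos: "folner D \<Longrightarrow> \<forall>\<^sub>F n in sequentially. 0 < card (D n)"
  by (simp add: folner_def)

lemma folner_exit_tendsto:
  "folner D \<Longrightarrow> (\<lambda>n. real (card {k \<in> D n. k + v \<notin> D n}) / real (card (D n))) \<longlonglongrightarrow> 0"
  by (simp add: folner_def)

lemma folner_eventually_exit_le:
  assumes "folner D" "\<epsilon> > 0"
  shows "\<forall>\<^sub>F n in sequentially. real (card {k \<in> D n. k + v \<notin> D n}) \<le> \<epsilon> * real (card (D n))"
  using order_tendstoD(2)[OF folner_exit_tendsto[OF assms(1), of v] assms(2)]
    folner_eventually_pos[OF assms(1)]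
  by eventually_elim (simp add: field_simps)

text \<open>
  A hyperplane slice of \<open>D n\<close> has many nearly disjoint translates inside \<open>D n\<close>, so it
  is a small part of \<open>D n\<close>.
\<close>

lemma folner_slice_small:
  fixes D :: "nat \<Rightarrow> ('m::{finite,linorder}) lattice set"
  assumes fol: "folner D" and "\<epsilon> > 0"
  shows "\<forall>\<^sub>F n in sequentially. \<forall>i. real (card {k \<in> D n. lead k = i}) \<le> \<epsilon> * real (card (D n))"
proof -
  obtain p :: nat where p: "2 / \<epsilon> < real p" using reals_Archimedean2 by blast
  then have p0: "p > 0" using \<open>\<epsilon> > 0\<close> by (cases p) (auto simp: field_simps)
  define e where "e r = (\<chi> _. int r :: 'm lattice)" for r :: nat
  have "\<forall>\<^sub>F n in sequentially. \<forall>r\<in>{..<p}.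
      real (card {k \<in> D n. k + e r \<notin> D n}) \<le> (1 / real p) * real (card (D n))"
    using p0 by (intro eventually_ball_finite ballI folner_eventually_exit_le[OF fol]) auto
  then show ?thesis
  proof eventually_elim
    case (elim n)
    have fin: "finite (D n)" by (rule folner_finite[OF fol])
    show ?case
    proof
      fix i
      define L where "L = {k \<in> D n. lead k = i}"
      define T where "T r = (\<lambda>k. k + e r) ` {k \<in> L. k + e r \<in> D n}" for r
      have lT: "lead k = i + int r" if "k \<in> T r" for k r
        using that by (auto simp: T_def L_def lead_add) (simp add: e_def lead_def)
      have "(\<Sum>r<p. card (T r)) = card (\<Union>r<p. T r)"
      proof (rule card_UN_disjoint[symmetric])
        show "\<forall>r\<in>{..<p}. finite (T r)" using fin by (simp add: T_def L_def)
        show "\<forall>r\<in>{..<p}. \<forall>q\<in>{..<p}. r \<noteq> q \<longrightarrow> T r \<inter> T q = {}"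
        proof (intro ballI impI)
          fix r q :: nat assume "r \<noteq> q"
          show "T r \<inter> T q = {}"
          proof (rule ccontr)
            assume "T r \<inter> T q \<noteq> {}"
            then obtain k where "k \<in> T r" "k \<in> T q" by blast
            then have "int r = int q" using lT[of k r] lT[of k q] by linarith
            with \<open>r \<noteq> q\<close> show False by simp
          qed
        qed
      qed simp
      also have "\<dots> \<le> card (D n)" using fin by (intro card_mono) (auto simp: T_def)
      finally have 1: "(\<Sum>r<p. real (card (T r))) \<le> real (card (D n))"
        by (simp flip: of_nat_sum)
      have 2: "real (card L) \<le> real (card (T r)) + (1 / real p) * real (card (D n))" if "r < p" for r
      proof -
        have "card L \<le> card ({k \<in> L. k + e r \<in> D n} \<union> {k \<in> D n. k + e r \<notin> D n})"
          using fin by (intro card_mono) (auto simp: L_def)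
        also have "\<dots> \<le> card {k \<in> L. k + e r \<in> D n} + card {k \<in> D n. k + e r \<notin> D n}"
          by (rule card_Un_le)
        also have "card {k \<in> L. k + e r \<in> D n} = card (T r)"
          unfolding T_def by (rule card_image[symmetric]) (simp add: inj_on_def)
        finally have "real (card L) \<le> real (card (T r)) + real (card {k \<in> D n. k + e r \<notin> D n})"
          by (simp flip: of_nat_add)
        then show ?thesis using elim that by force
      qed
      have "real p * real (card L) = (\<Sum>r<p. real (card L))" by simp
      also have "\<dots> \<le> (\<Sum>r<p. real (card (T r)) + (1 / real p) * real (card (D n)))"
        by (rule sum_mono) (use 2 in auto)
      also have "\<dots> \<le> 2 * real (card (D n))"
        using 1 p0 by (simp add: sum.distrib)
      finally have "real (card L) \<le> (2 / real p) * real (card (D n))"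
        using p0 by (simp add: field_simps)
      also have "\<dots> \<le> \<epsilon> * real (card (D n))"
        using p p0 \<open>\<epsilon> > 0\<close> by (intro mult_right_mono) (auto simp: field_simps)
      finally show "real (card {k \<in> D n. lead k = i}) \<le> \<epsilon> * real (card (D n))"
        unfolding L_def .
    qed
  qed
qed

text \<open>
  The point of the slices: although the lexicographic order is far from the geometry of the lattice,
  the lexicographic pasts of \<open>k\<close> and of \<open>k + v\<close> differ, inside \<open>D n\<close>, only by points of a bounded
  number of slices.
\<close>

lemma folner_lex_past_stable:
  fixes D :: "nat \<Rightarrow> ('m::{finite,linorder}) lattice set"
  assumes fol: "folner D" and "\<epsilon> > 0"
  shows "\<forall>\<^sub>F n in sequentially. \<forall>k.
    real (card {j \<in> D n. lex_less j (k + v) \<noteq> lex_less j k}) \<le> \<epsilon> * real (card (D n))"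
proof -
  define c where "c = \<bar>lead v\<bar>"
  have c: "c \<ge> 0" by (simp add: c_def)
  have "\<epsilon> / real_of_int (2 * c + 1) > 0" using \<open>\<epsilon> > 0\<close> c by simp
  from folner_slice_small[OF fol this] show ?thesis
  proof eventually_elim
    case (elim n)
    have fin: "finite (D n)" by (rule folner_finite[OF fol])
    show ?case
    proof
      fix k
      have "{j \<in> D n. lex_less j (k + v) \<noteq> lex_less j k}
          \<subseteq> (\<Union>i\<in>{lead k - c..lead k + c}. {j \<in> D n. lead j = i})"
      proof
        fix j assume "j \<in> {j \<in> D n. lex_less j (k + v) \<noteq> lex_less j k}"
        then have j: "lex_less j (k + v) \<noteq> lex_less j k" "j \<in> D n" by auto
        have "lead j \<le> lead k + c"
          using j(1) lead_le_if_lex_less[of j "k + v"] lead_le_if_lex_less[of j k]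
          unfolding lead_add c_def by linarith
        moreover have "lead k - c \<le> lead j"
          using j(1) lex_less_if_lead_less[of j "k + v"] lex_less_if_lead_less[of j k]
          unfolding lead_add c_def by linarith
        ultimately show "j \<in> (\<Union>i\<in>{lead k - c..lead k + c}. {j \<in> D n. lead j = i})"
          using j by auto
      qed
      then have "card {j \<in> D n. lex_less j (k + v) \<noteq> lex_less j k}
          \<le> card (\<Union>i\<in>{lead k - c..lead k + c}. {j \<in> D n. lead j = i})"
        using fin by (intro card_mono) auto
      also have "\<dots> \<le> (\<Sum>i\<in>{lead k - c..lead k + c}. card {j \<in> D n. lead j = i})"
        by (rule card_UN_le) simp
      finally have "real (card {j \<in> D n. lex_less j (k + v) \<noteq> lex_less j k})
          \<le> (\<Sum>i\<in>{lead k - c..lead k + c}. real (card {j \<in> D n. lead j = i}))"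
        by (simp flip: of_nat_sum)
      also have "\<dots> \<le> (\<Sum>i\<in>{lead k - c..lead k + c}.
          \<epsilon> / real_of_int (2 * c + 1) * real (card (D n)))"
        by (rule sum_mono) (use elim in auto)
      also have "\<dots> = \<epsilon> * real (card (D n))"
        using c by (simp add: field_simps)
      finally show "real (card {j \<in> D n. lex_less j (k + v) \<noteq> lex_less j k})
          \<le> \<epsilon> * real (card (D n))" .
    qed
  qed
qed

text \<open>Adding the points of a finite set one by one, in increasing lexicographic order.\<close>

lemma lex_telescope:
  fixes g :: "('m::{finite,linorder}) lattice set \<Rightarrow> 'b::ab_group_add"
  assumes "finite A"
  shows "(\<Sum>k\<in>A. g (insert k {j \<in> A. lex_less j k}) - g {j \<in> A. lex_less j k}) = g A - g {}"
  using assms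
proof (induction "card A" arbitrary: A)
  case 0
  then show ?case by simp
next
  case (Suc c)
  then have "A \<noteq> {}" by auto
  have "\<exists>l\<in>A. \<forall>x\<in>A. x \<noteq> l \<longrightarrow> lex_less x l"
  proof (rule Finite_Set.bex_greatest_element[OF \<open>finite A\<close> \<open>A \<noteq> {}\<close>])
    show "transp_on A lex_less" by (rule transp_onI) (rule lex_less_trans)
    show "totalp_on A lex_less" by (rule totalp_onI) (rule lex_less_total)
  qed
  then obtain l where l: "l \<in> A" "\<And>x. x \<in> A \<Longrightarrow> x \<noteq> l \<Longrightarrow> lex_less x l" by blast
  define B where "B = A - {l}"
  have A: "A = insert l B" "l \<notin> B" "finite B" "card B = c"
    using l(1) Suc.hyps(2) Suc.prems by (auto simp: B_def card_Diff_singleton)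
  have 1: "{j \<in> A. lex_less j k} = {j \<in> B. lex_less j k}" if "k \<in> B" for k
    using that l(2)[of k] A lex_less_asym[of k l] by auto
  have 2: "{j \<in> A. lex_less j l} = B" using l(2) A lex_less_irrefl[of l] by auto
  have "(\<Sum>k\<in>A. g (insert k {j \<in> A. lex_less j k}) - g {j \<in> A. lex_less j k})
     = g A - g B + (\<Sum>k\<in>B. g (insert k {j \<in> B. lex_less j k}) - g {j \<in> B. lex_less j k})"
  proof -
    have "(\<Sum>k\<in>A. g (insert k {j \<in> A. lex_less j k}) - g {j \<in> A. lex_less j k})
      = (g (insert l {j \<in> A. lex_less j l}) - g {j \<in> A. lex_less j l})
        + (\<Sum>k\<in>B. g (insert k {j \<in> A. lex_less j k}) - g {j \<in> A. lex_less j k})"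
      by (subst (1) A(1)) (rule sum.insert[OF A(3,2)])
    then show ?thesis using 1 2 by (simp add: A(1)[symmetric])
  qed
  also have "\<dots> = g A - g {}" using Suc.hyps(1)[of B] A by simp
  finally show ?case .
qed

section \<open>Stationary laws and cylinder functions\<close>

lemma measurable_coordinate_real [measurable]:
  "(\<lambda>x :: 'i::countable \<Rightarrow> real. x t) \<in> borel_measurable borel"
  by (rule measurable_product_then_coordinatewise) simp

lemma field_shift_measurable [measurable]:
  "field_shift k \<in> borel \<rightarrow>\<^sub>M (borel :: ('m::finite lattice \<Rightarrow> real) measure)"
  unfolding field_shift_def by (rule measurable_coordinatewise_then_product) measurable

lemma field_shift_field_shift: "field_shift k (field_shift l x) = field_shift (k + l) x"
  by (simp add: field_shift_def add.assoc)

definition cylinder ::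
    "('m::finite) lattice set \<Rightarrow> (('m lattice \<Rightarrow> real) \<Rightarrow> 'b::topological_space) \<Rightarrow> bool" where
  "cylinder \<Gamma> W \<longleftrightarrow> W \<in> borel_measurable borel \<and> (\<forall>x y. (\<forall>i\<in>\<Gamma>. x i = y i) \<longrightarrow> W x = W y)"

lemma cylinder_measurable: "cylinder \<Gamma> W \<Longrightarrow> W \<in> borel_measurable borel"
  by (simp add: cylinder_def)

lemma cylinder_mono: "cylinder \<Gamma> W \<Longrightarrow> \<Gamma> \<subseteq> \<Gamma>' \<Longrightarrow> cylinder \<Gamma>' W"
  unfolding cylinder_def by blast

lemma cylinder_comp:
  "cylinder \<Gamma> W \<Longrightarrow> g \<in> borel_measurable borel \<Longrightarrow> cylinder \<Gamma> (\<lambda>x. g (W x))"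
  unfolding cylinder_def by (auto intro: measurable_compose) metis

lemma cylinder_shift:
  assumes "cylinder \<Gamma> W"
  shows "cylinder ((\<lambda>i. i + v) ` \<Gamma>) (\<lambda>x. W (field_shift v x))"
  unfolding cylinder_def
proof safe
  have [measurable]: "W \<in> borel_measurable borel" using assms by (rule cylinder_measurable)
  show "(\<lambda>x. W (field_shift v x)) \<in> borel_measurable borel" by measurable
  fix x y :: "'a lattice \<Rightarrow> real" assume "\<forall>i\<in>(\<lambda>i. i + v) ` \<Gamma>. x i = y i"
  then have "\<forall>i\<in>\<Gamma>. field_shift v x i = field_shift v y i" by (simp add: field_shift_def)
  then show "W (field_shift v x) = W (field_shift v y)" using assms unfolding cylinder_def by blast
qed

text \<open>
  The two sums share the terms with index in \<open>A\<close> and in its translate; the unshared terms are equally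
  many on both sides.
\<close>

lemma sum_translate_diff_le:
  fixes g :: "'a::ab_group_add \<Rightarrow> 'b::real_normed_vector"
  assumes fin: "finite A" and bd: "\<And>k. norm (g k) \<le> c"
  shows "norm ((\<Sum>k\<in>A. g (k + v)) - (\<Sum>k\<in>A. g k)) \<le> 2 * c * real (card {k \<in> A. k + v \<notin> A})"
proof -
  define U where "U = {k \<in> A. k + v \<in> A}"
  define S where "S = {k \<in> A. k + v \<notin> A}"
  have A: "A = U \<union> S" "U \<inter> S = {}" "finite U" "finite S" using fin by (auto simp: U_def S_def)
  have inj: "inj_on (\<lambda>k. k + v) U" by (simp add: inj_on_def)
  have sub: "(\<lambda>k. k + v) ` U \<subseteq> A" by (auto simp: U_def)
  have "card (A - (\<lambda>k. k + v) ` U) = card A - card U"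
    using sub fin inj by (simp add: card_Diff_subset card_image finite_subset)
  also have "\<dots> = card S" using A card_Un_disjoint[of U S] by simp
  finally have cd: "card (A - (\<lambda>k. k + v) ` U) = card S" .
  have "(\<Sum>k\<in>A. g (k + v)) = (\<Sum>k\<in>U. g (k + v)) + (\<Sum>k\<in>S. g (k + v))"
    using A by (simp add: sum.union_disjoint)
  moreover have "(\<Sum>k\<in>A. g k) = (\<Sum>k\<in>U. g (k + v)) + (\<Sum>k\<in>A - (\<lambda>k. k + v) ` U. g k)"
    using sum.subset_diff[OF sub fin, of g] inj by (simp add: sum.reindex add.commute)
  ultimately have "norm ((\<Sum>k\<in>A. g (k + v)) - (\<Sum>k\<in>A. g k))
      \<le> norm (\<Sum>k\<in>S. g (k + v)) + norm (\<Sum>k\<in>A - (\<lambda>k. k + v) ` U. g k)"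
    by (simp add: norm_triangle_ineq4)
  also have "\<dots> \<le> (\<Sum>k\<in>S. c) + (\<Sum>k\<in>A - (\<lambda>k. k + v) ` U. c)"
    by (intro add_mono sum_norm_le bd)
  also have "\<dots> = 2 * c * real (card S)" using cd by simp
  finally show ?thesis unfolding S_def .
qed

definition shift_average ::
    "('m::finite) lattice set \<Rightarrow> (('m lattice \<Rightarrow> real) \<Rightarrow> real) \<Rightarrow> ('m lattice \<Rightarrow> real) \<Rightarrow> real" where
  "shift_average A f x = (\<Sum>v\<in>A. f (field_shift v x)) / real (card A)"

text \<open>
  The law of a stationary field on the space of all configurations. The field itself is the coordinate
  process, and the shifts act on this space and preserve \<open>P\<close>.
\<close>

locale stationary_law = prob_space P
  for P :: "(('m::{finite,linorder}) lattice \<Rightarrow> real) measure" +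
  assumes sets_P [measurable_cong]: "sets P = sets borel"
    and shift_invariant: "distr P P (field_shift k) = P"
begin

abbreviation \<I> :: "('m lattice \<Rightarrow> real) measure" where
  "\<I> \<equiv> invariant_algebra P (\<lambda>t x. x t)"

lemma space_P [simp]: "space P = UNIV"
  using sets_eq_imp_space_eq[OF sets_P] by simp

lemma measurable_P: "borel_measurable P = borel_measurable borel"
  by (rule measurable_cong_sets[OF sets_P refl])

lemma integral_shift:
  fixes f :: "_ \<Rightarrow> 'b::{banach, second_countable_topology}"
  assumes "f \<in> borel_measurable borel"
  shows "(\<integral>x. f (field_shift k x) \<partial>P) = (\<integral>x. f x \<partial>P)"
proof -
  have "(\<integral>x. f x \<partial>P) = (\<integral>x. f x \<partial>distr P P (field_shift k))" by (simp only: shift_invariant)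
  also have "\<dots> = (\<integral>x. f (field_shift k x) \<partial>P)"
    using assms by (intro integral_distr) measurable
  finally show ?thesis ..
qed

lemma integrable_shift:
  fixes f :: "_ \<Rightarrow> 'b::{banach, second_countable_topology}"
  assumes "integrable P f"
  shows "integrable P (\<lambda>x. f (field_shift k x))"
proof -
  have "integrable (distr P P (field_shift k)) f" using assms by (simp only: shift_invariant)
  then show ?thesis by (rule integrable_distr[rotated]) measurable
qed

lemma integrable_bounded:
  fixes f :: "_ \<Rightarrow> 'b::{banach, second_countable_topology}"
  assumes "f \<in> borel_measurable borel" "\<And>x. norm (f x) \<le> c"
  shows "integrable P f"
  using assms by (intro integrable_const_bound[of _ c]) (auto simp: measurable_P)

lemma sets_\<I>: "sets \<I> = {B \<in> sets borel. \<forall>k. field_shift k -` B = B}"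
  unfolding sets_invariant_algebra invariant_events_def by auto

lemma space_\<I> [simp]: "space \<I> = UNIV"
  by (simp add: invariant_algebra_def space_measure_of_conv)

lemma subalgebra_\<I>: "subalgebra P \<I>"
  by (auto simp: subalgebra_def sets_\<I> sets_P)

sublocale finite_measure_subalgebra P \<I>
  by unfold_locales (rule subalgebra_\<I>)

lemma measurable_\<I>_borel: "f \<in> borel_measurable \<I> \<Longrightarrow> f \<in> borel_measurable borel"
  using measurable_from_subalg[OF subalgebra_\<I>] measurable_P by blast

text \<open>
  The level set of \<open>f\<close> through \<open>x\<close> is an invariant event, so it contains every shift of \<open>x\<close>.
\<close>

lemma \<I>_measurable_shift:
  fixes f :: "_ \<Rightarrow> 'b::t1_space"
  assumes "f \<in> borel_measurable \<I>"
  shows "f (field_shift k x) = f x"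
proof -
  have "f -` {f x} \<in> sets \<I>"
    using measurable_sets[OF assms, of "{f x}"] by simp
  then have "field_shift k -` (f -` {f x}) = f -` {f x}" by (simp add: sets_\<I>)
  then show ?thesis by auto
qed

lemma \<I>_measurableI:
  assumes [measurable]: "f \<in> borel_measurable borel" and "\<And>k x. f (field_shift k x) = f x"
  shows "f \<in> borel_measurable \<I>"
proof (rule measurableI)
  fix A assume "A \<in> sets (borel :: 'a measure)"
  then have "f -` A \<inter> space borel \<in> sets borel" by (intro measurable_sets[OF assms(1)])
  then have "f -` A \<in> sets borel" by simp
  moreover have "field_shift k -` (f -` A) = f -` A" for k using assms(2) by auto
  ultimately show "f -` A \<inter> space \<I> \<in> sets \<I>" by (simp add: sets_\<I>)
qed simp

text \<open>
  The sets that can be approximated form a \<open>\<sigma>\<close>-algebra, and it contains the events that depend on a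
  single coordinate.
\<close>

lemma cylinder_set_approx:
  assumes "A \<in> sets borel" "\<epsilon> > 0"
  shows "\<exists>\<Gamma> C. finite \<Gamma> \<and> C \<in> sets borel \<and> cylinder \<Gamma> (\<lambda>x. indicator C x :: real) \<and>
    measure P (sym_diff A C) < \<epsilon>"
proof -
  define G where "G = {{f \<in> UNIV \<rightarrow>\<^sub>E UNIV. f i \<in> B} | (i :: 'm lattice) B. B \<in> sets (borel :: real measure)}"
  have "sets borel = sigma_sets UNIV G"
    unfolding sets_PiM_equal_borel[symmetric] sets_PiM_single G_def by simp
  then have "A \<in> sigma_sets UNIV G" using assms by simp
  then have "A \<in> sets borel \<and> (\<forall>\<epsilon>>0. \<exists>\<Gamma> C. finite \<Gamma> \<and> C \<in> sets borel \<and>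
     cylinder \<Gamma> (\<lambda>x. indicator C x :: real) \<and> measure P (sym_diff A C) < \<epsilon>)"
  proof (induction rule: sigma_sets.induct)
    case (Basic A)
    then obtain i B where B: "B \<in> sets borel" "A = {f. f i \<in> B}" unfolding G_def by auto
    have "A = (\<lambda>f. f i) -` B \<inter> space borel" using B by auto
    then have A: "A \<in> sets borel" using B measurable_sets[OF measurable_coordinate_real] by metis
    have "cylinder {i} (\<lambda>x. indicator A x :: real)"
      unfolding cylinder_def using A by (auto simp: B indicator_def)
    then show ?case using A by (auto intro!: exI[of _ "{i}"] exI[of _ A])
  next
    case Empty
    show ?case by (auto intro!: exI[of _ "{}"] simp: cylinder_def)
  next
    case (Compl A)
    show ?case
    proof (intro conjI allI impI)
      show "UNIV - A \<in> sets borel" using Compl by auto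
      fix \<epsilon> :: real assume "\<epsilon> > 0"
      then obtain \<Gamma> C where C: "finite \<Gamma>" "C \<in> sets borel" "cylinder \<Gamma> (\<lambda>x. indicator C x :: real)"
        "measure P (sym_diff A C) < \<epsilon>" using Compl by blast
      have "sym_diff (UNIV - A) (UNIV - C) = sym_diff A C" by auto
      moreover have "cylinder \<Gamma> (\<lambda>x. indicator (UNIV - C) x :: real)"
        unfolding cylinder_def
      proof (intro conjI allI impI)
        show "(\<lambda>x. indicator (UNIV - C) x :: real) \<in> borel_measurable borel"
          using C by (intro borel_measurable_indicator) auto
        fix x y :: "'m lattice \<Rightarrow> real" assume "\<forall>i\<in>\<Gamma>. x i = y i"
        then have "(indicator C x :: real) = indicator C y" using C unfolding cylinder_def by blast
        then show "(indicator (UNIV - C) x :: real) = indicator (UNIV - C) y"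
          by (auto simp: indicator_def split: if_splits)
      qed
      ultimately show "\<exists>\<Gamma> C. finite \<Gamma> \<and> C \<in> sets borel \<and>
        cylinder \<Gamma> (\<lambda>x. indicator C x :: real) \<and> measure P (sym_diff (UNIV - A) C) < \<epsilon>"
        using C by (intro exI[of _ \<Gamma>] exI[of _ "UNIV - C"]) auto
    qed
  next
    case (Union A)
    show ?case
    proof (intro conjI allI impI)
      show U: "(\<Union>i. A i) \<in> sets borel" using Union by auto
      fix \<epsilon> :: real assume e: "\<epsilon> > 0"
      have "(\<lambda>n. measure P (\<Union>i<n. A i)) \<longlonglongrightarrow> measure P (\<Union>n. \<Union>i<n. A i)"
        using Union sets_P by (intro finite_Lim_measure_incseq) (auto simp: incseq_def, fastforce)
      moreover have "(\<Union>n. \<Union>i<n. A i) = (\<Union>i. A i)" by auto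
      ultimately have "(\<lambda>n. measure P (\<Union>i<n. A i)) \<longlonglongrightarrow> measure P (\<Union>i. A i)" by simp
      then have "\<forall>\<^sub>F n in sequentially. measure P (\<Union>i. A i) - \<epsilon> / 2 < measure P (\<Union>i<n. A i)"
        using e by (intro order_tendstoD) auto
      then obtain N where N: "measure P (\<Union>i. A i) - \<epsilon> / 2 < measure P (\<Union>i<N. A i)"
        by (auto simp: eventually_sequentially)
      have "\<epsilon> / (2 * real (Suc N)) > 0" using e by simp
      then have "\<forall>i. \<exists>\<Gamma> C. finite \<Gamma> \<and> C \<in> sets borel \<and> cylinder \<Gamma> (\<lambda>x. indicator C x :: real) \<and>
          measure P (sym_diff (A i) C) < \<epsilon> / (2 * real (Suc N))" using Union by blast
      then obtain \<Gamma> C where C: "\<And>i. finite (\<Gamma> i)" "\<And>i. C i \<in> sets borel"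
          "\<And>i. cylinder (\<Gamma> i) (\<lambda>x. indicator (C i) x :: real)"
          "\<And>i. measure P (sym_diff (A i) (C i)) < \<epsilon> / (2 * real (Suc N))" by metis
      define C' where "C' = (\<Union>i<N. C i)"
      have C'b: "C' \<in> sets borel" using C unfolding C'_def by auto
      have Ab: "A i \<in> sets borel" for i using Union by blast
      have "cylinder (\<Union>i<N. \<Gamma> i) (\<lambda>x. indicator C' x :: real)"
        unfolding cylinder_def
      proof (intro conjI allI impI)
        show "(\<lambda>x. indicator C' x :: real) \<in> borel_measurable borel"
          using C'b by (intro borel_measurable_indicator) auto
        fix x y :: "'m lattice \<Rightarrow> real" assume xy: "\<forall>i\<in>(\<Union>i<N. \<Gamma> i). x i = y i"
        have "(x \<in> C i) = (y \<in> C i)" if "i < N" for i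
        proof -
          have "(indicator (C i) x :: real) = indicator (C i) y"
            using C(3)[of i] xy that unfolding cylinder_def by blast
          then show ?thesis by (auto simp: indicator_def split: if_splits)
        qed
        then show "(indicator C' x :: real) = indicator C' y"
          by (auto simp: indicator_def C'_def)
      qed
      moreover have "measure P (sym_diff (\<Union>i. A i) C') < \<epsilon>"
      proof -
        have "measure P (sym_diff (\<Union>i. A i) C')
            \<le> measure P (((\<Union>i. A i) - (\<Union>i<N. A i)) \<union> (\<Union>i<N. sym_diff (A i) (C i)))"
          using Ab C C'b sets_P by (intro finite_measure_mono) (auto simp: C'_def)
        also have "\<dots> \<le> measure P ((\<Union>i. A i) - (\<Union>i<N. A i)) + measure P (\<Union>i<N. sym_diff (A i) (C i))"
          using Ab C sets_P by (intro measure_Un_le) auto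
        also have "measure P ((\<Union>i. A i) - (\<Union>i<N. A i)) = measure P (\<Union>i. A i) - measure P (\<Union>i<N. A i)"
          using Ab sets_P by (intro finite_measure_Diff) auto
        also have "measure P (\<Union>i<N. sym_diff (A i) (C i)) \<le> (\<Sum>i<N. measure P (sym_diff (A i) (C i)))"
          using Ab C sets_P by (intro finite_measure_subadditive_finite) auto
        also have "\<dots> \<le> (\<Sum>i<N. \<epsilon> / (2 * real (Suc N)))"
          using C(4) by (intro sum_mono less_imp_le)
        also have "\<dots> \<le> \<epsilon> / 2" using e by (simp add: field_simps)
        finally show ?thesis using N by linarith
      qed
      ultimately show "\<exists>\<Gamma> C. finite \<Gamma> \<and> C \<in> sets borel \<and>
        cylinder \<Gamma> (\<lambda>x. indicator C x :: real) \<and> measure P (sym_diff (\<Union>i. A i) C) < \<epsilon>"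
        using C C'b by (intro exI[of _ "\<Union>i<N. \<Gamma> i"] exI[of _ C']) auto
    qed
  qed
  then show ?thesis using assms(2) by blast
qed

lemma cylinder_L1_dense:
  fixes f :: "_ \<Rightarrow> real"
  assumes "integrable P f" "\<epsilon> > 0"
  shows "\<exists>\<Gamma> F. finite \<Gamma> \<and> cylinder \<Gamma> F \<and> integrable P F \<and> (\<integral>x. \<bar>f x - F x\<bar> \<partial>P) < \<epsilon>"
  using assms
proof (induction arbitrary: \<epsilon> rule: integrable_induct)
  case (base A c)
  have "\<epsilon> / (\<bar>c\<bar> + 1) > 0" using base by simp
  from cylinder_set_approx[OF _ this, of A] base(1)
  obtain \<Gamma> C where C: "finite \<Gamma>" "C \<in> sets borel" "cylinder \<Gamma> (\<lambda>x. indicator C x :: real)"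
     "measure P (sym_diff A C) < \<epsilon> / (\<bar>c\<bar> + 1)" by (auto simp: sets_P)
  have "(\<integral>x. \<bar>indicator A x *\<^sub>R c - indicator C x *\<^sub>R c\<bar> \<partial>P)
      = (\<integral>x. \<bar>c\<bar> * indicator (sym_diff A C) x \<partial>P)"
    by (intro Bochner_Integration.integral_cong) (auto simp: indicator_def)
  also have "\<dots> = \<bar>c\<bar> * measure P (sym_diff A C)"
    by simp
  also have "\<dots> \<le> \<bar>c\<bar> * (\<epsilon> / (\<bar>c\<bar> + 1))" using C(4) by (intro mult_left_mono) auto
  also have "\<dots> < \<epsilon>" using base by (simp add: field_simps)
  finally have "(\<integral>x. \<bar>indicator A x *\<^sub>R c - indicator C x *\<^sub>R c\<bar> \<partial>P) < \<epsilon>" .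
  moreover have "cylinder \<Gamma> (\<lambda>x. indicator C x *\<^sub>R c :: real)"
    unfolding real_scaleR_def by (rule cylinder_comp[OF C(3), of "\<lambda>r. r * c"]) simp
  moreover have "integrable P (\<lambda>x. indicator C x *\<^sub>R c :: real)"
    using C(2) by (intro integrable_bounded[of _ "\<bar>c\<bar>"]) (auto simp: indicator_def)
  ultimately show ?case using C(1) by blast
next
  case (add f g)
  have "\<epsilon> / 2 > 0" using add by simp
  then obtain \<Gamma> F \<Gamma>' G where F: "finite \<Gamma>" "cylinder \<Gamma> F" "integrable P F" "(\<integral>x. \<bar>f x - F x\<bar> \<partial>P) < \<epsilon> / 2"
    and G: "finite \<Gamma>'" "cylinder \<Gamma>' G" "integrable P G" "(\<integral>x. \<bar>g x - G x\<bar> \<partial>P) < \<epsilon> / 2"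
    using add.IH by meson
  have "(\<integral>x. \<bar>f x + g x - (F x + G x)\<bar> \<partial>P) \<le> (\<integral>x. \<bar>f x - F x\<bar> + \<bar>g x - G x\<bar> \<partial>P)"
    using add F G by (intro integral_mono) auto
  also have "\<dots> = (\<integral>x. \<bar>f x - F x\<bar> \<partial>P) + (\<integral>x. \<bar>g x - G x\<bar> \<partial>P)"
    using add F G by (intro Bochner_Integration.integral_add) auto
  finally have "(\<integral>x. \<bar>f x + g x - (F x + G x)\<bar> \<partial>P) < \<epsilon>" using F G by simp
  moreover have "cylinder (\<Gamma> \<union> \<Gamma>') (\<lambda>x. F x + G x)"
    using cylinder_mono[OF F(2), of "\<Gamma> \<union> \<Gamma>'"] cylinder_mono[OF G(2), of "\<Gamma> \<union> \<Gamma>'"]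
    unfolding cylinder_def by (auto, metis)
  ultimately show ?case using F G
    by (intro exI[of _ "\<Gamma> \<union> \<Gamma>'"] exI[of _ "\<lambda>x. F x + G x"]) auto
next
  case (lim f s)
  have "(\<lambda>i. \<integral>x. norm (s i x - f x) \<partial>P) \<longlonglongrightarrow> (\<integral>x. 0 \<partial>P)"
  proof (rule integral_dominated_convergence)
    show "integrable P (\<lambda>x. 3 * norm (f x))" using lim by auto
    show "AE x in P. (\<lambda>i. norm (s i x - f x)) \<longlonglongrightarrow> 0"
      using lim.hyps(2) by (intro AE_I2 tendsto_norm_zero LIM_zero)
    show "AE x in P. norm (norm (s i x - f x)) \<le> 3 * norm (f x)" for i
    proof (intro AE_I2)
      fix x assume "x \<in> space P"
      from lim.hyps(3)[OF this, of i] show "norm (norm (s i x - f x)) \<le> 3 * norm (f x)"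
        using norm_triangle_ineq4[of "s i x" "f x"] by simp
    qed
  qed (use lim in auto)
  then have "\<forall>\<^sub>F i in sequentially. (\<integral>x. norm (s i x - f x) \<partial>P) < \<epsilon> / 2"
    using lim.prems by (intro order_tendstoD) auto
  then obtain i where i: "(\<integral>x. norm (s i x - f x) \<partial>P) < \<epsilon> / 2"
    by (auto simp: eventually_sequentially)
  obtain \<Gamma> F where F: "finite \<Gamma>" "cylinder \<Gamma> F" "integrable P F" "(\<integral>x. \<bar>s i x - F x\<bar> \<partial>P) < \<epsilon> / 2"
    using lim.IH[of "\<epsilon> / 2" i] lim.prems by auto
  have "(\<integral>x. \<bar>f x - F x\<bar> \<partial>P) \<le> (\<integral>x. norm (s i x - f x) + \<bar>s i x - F x\<bar> \<partial>P)"
    using lim F by (intro integral_mono) auto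
  also have "\<dots> = (\<integral>x. norm (s i x - f x) \<partial>P) + (\<integral>x. \<bar>s i x - F x\<bar> \<partial>P)"
    using lim F by (intro Bochner_Integration.integral_add) auto
  finally have "(\<integral>x. \<bar>f x - F x\<bar> \<partial>P) < \<epsilon>" using i F by simp
  then show ?case using F by blast
qed

text \<open>
  Cutting the approximating function off at \<open>\<plusminus>c\<close> brings it closer to \<open>f\<close>.
\<close>

lemma cylinder_bounded_approx:
  fixes f :: "_ \<Rightarrow> real"
  assumes [measurable]: "f \<in> borel_measurable borel" and bd: "\<And>x. \<bar>f x\<bar> \<le> c" and "\<epsilon> > 0"
  shows "\<exists>\<Gamma> F. finite \<Gamma> \<and> cylinder \<Gamma> F \<and> (\<forall>x. \<bar>F x\<bar> \<le> c) \<and> (\<integral>x. \<bar>f x - F x\<bar> \<partial>P) < \<epsilon>"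
proof -
  have c: "0 \<le> c" using bd[of undefined] by simp
  have f: "integrable P f" using bd by (intro integrable_bounded[of _ c]) auto
  from cylinder_L1_dense[OF this \<open>\<epsilon> > 0\<close>] obtain \<Gamma> F where F: "finite \<Gamma>" "cylinder \<Gamma> F"
    "integrable P F" "(\<integral>x. \<bar>f x - F x\<bar> \<partial>P) < \<epsilon>" by blast
  have [measurable]: "F \<in> borel_measurable borel" using F(2) by (rule cylinder_measurable)
  define F' where "F' x = max (-c) (min c (F x))" for x
  have [measurable]: "F' \<in> borel_measurable borel" unfolding F'_def by measurable
  have le: "\<bar>F' x\<bar> \<le> c" for x using c by (auto simp: F'_def)
  have "(\<integral>x. \<bar>f x - F' x\<bar> \<partial>P) \<le> (\<integral>x. \<bar>f x - F x\<bar> \<partial>P)"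
  proof (rule integral_mono)
    show "integrable P (\<lambda>x. \<bar>f x - F' x\<bar>)"
      using f le by (intro integrable_abs Bochner_Integration.integrable_diff integrable_bounded[of F' c]) auto
    show "\<bar>f x - F' x\<bar> \<le> \<bar>f x - F x\<bar>" for x using bd[of x] by (auto simp: F'_def)
  qed (use f F in auto)
  moreover have "cylinder \<Gamma> F'"
    unfolding F'_def by (rule cylinder_comp[OF F(2), of "\<lambda>r. max (-c) (min c r)"]) simp
  ultimately show ?thesis using F le by (intro exI[of _ \<Gamma>] exI[of _ F']) auto
qed

end

section \<open>The mean ergodic theorem along Folner sequences\<close>

text \<open>
  Integrate the pointwise bound \<open>\<bar>f\<bar> \<le> (e + f\<^sup>2 / e) / 2\<close>.
\<close>

lemma (in prob_space) expectation_abs_le_if_square_le: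
  fixes f :: "'a \<Rightarrow> real"
  assumes "integrable M (\<lambda>x. (f x)\<^sup>2)" "integrable M f" "(\<integral>x. (f x)\<^sup>2 \<partial>M) \<le> e\<^sup>2" "e > 0"
  shows "(\<integral>x. \<bar>f x\<bar> \<partial>M) \<le> e"
proof -
  have "(\<integral>x. \<bar>f x\<bar> \<partial>M) \<le> (\<integral>x. (e + (f x)\<^sup>2 / e) / 2 \<partial>M)"
  proof (rule integral_mono)
    fix x
    have "0 \<le> (\<bar>f x\<bar> - e)\<^sup>2" by simp
    then have "2 * \<bar>f x\<bar> * e \<le> e\<^sup>2 + (f x)\<^sup>2" by (simp add: power2_diff)
    then show "\<bar>f x\<bar> \<le> (e + (f x)\<^sup>2 / e) / 2"
      using \<open>e > 0\<close> by (simp add: field_simps power2_eq_square)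
  qed (use assms in auto)
  also have "\<dots> = (e + (\<integral>x. (f x)\<^sup>2 \<partial>M) / e) / 2"
    using assms by (simp add: prob_space)
  also have "\<dots> \<le> (e + e\<^sup>2 / e) / 2" using assms by (intro divide_right_mono add_left_mono) auto
  also have "\<dots> = e" using assms by (simp add: power2_eq_square)
  finally show ?thesis .
qed

context stationary_law
begin

lemma prob_UNIV [simp]: "measure P UNIV = 1"
  using prob_space by simp

lemma shift_average_measurable [measurable]:
  assumes [measurable]: "f \<in> borel_measurable borel"
  shows "shift_average A f \<in> borel_measurable borel"
  unfolding shift_average_def[abs_def]
  by (intro borel_measurable_divide borel_measurable_sum borel_measurable_const) measurable

lemma shift_average_bounded:
  assumes "\<And>x. \<bar>f x\<bar> \<le> c"
  shows "\<bar>shift_average A f x\<bar> \<le> c"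
proof (cases "card A = 0")
  case True
  then show ?thesis using assms[of x] by (simp add: shift_average_def)
next
  case False
  have "\<bar>\<Sum>v\<in>A. f (field_shift v x)\<bar> \<le> (\<Sum>v\<in>A. c)"
    by (rule order_trans[OF sum_abs sum_mono]) (rule assms)
  then show ?thesis using False by (simp add: shift_average_def field_simps)
qed

lemma shift_average_shift:
  assumes "finite A" and "\<And>x. \<bar>f x\<bar> \<le> c"
  shows "\<bar>shift_average A f (field_shift v x) - shift_average A f x\<bar>
     \<le> 2 * c * (real (card {k \<in> A. k + v \<notin> A}) / real (card A))"
proof -
  have "\<bar>(\<Sum>k\<in>A. f (field_shift (k + v) x)) - (\<Sum>k\<in>A. f (field_shift k x))\<bar>
      \<le> 2 * c * real (card {k \<in> A. k + v \<notin> A})"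
    using sum_translate_diff_le[OF assms(1), of "\<lambda>k. f (field_shift k x)" c v] assms(2) by simp
  then show ?thesis
    by (auto simp: shift_average_def field_shift_field_shift diff_divide_distrib[symmetric]
        intro!: divide_right_mono)
qed

lemma integral_shift_average_mult_invariant:
  assumes [measurable]: "f \<in> borel_measurable borel" and bd: "\<And>x. \<bar>f x\<bar> \<le> c"
    and H: "H \<in> borel_measurable \<I>" "\<And>x. \<bar>H x\<bar> \<le> b" and A: "card A > 0"
  shows "(\<integral>x. H x * shift_average A f x \<partial>P) = (\<integral>x. H x * f x \<partial>P)"
proof -
  have [measurable]: "H \<in> borel_measurable borel" using H by (intro measurable_\<I>_borel)
  have b0: "0 \<le> b" using H(2)[of undefined] by linarith
  have bd': "norm (H x * f y) \<le> b * c" for x y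
    unfolding real_norm_def abs_mult using bd[of y] H(2)[of x] b0 by (intro mult_mono) auto
  have "(\<integral>x. H x * shift_average A f x \<partial>P)
      = (\<integral>x. (\<Sum>v\<in>A. H (field_shift v x) * f (field_shift v x)) / real (card A) \<partial>P)"
    using \<I>_measurable_shift[OF H(1)]
    by (simp add: shift_average_def sum_distrib_left)
  also have "\<dots> = (\<Sum>v\<in>A. (\<integral>x. H (field_shift v x) * f (field_shift v x) \<partial>P)) / real (card A)"
  proof -
    have "integrable P (\<lambda>x. H (field_shift v x) * f (field_shift v x))" for v
      by (rule integrable_bounded[OF _ bd']) measurable
    then show ?thesis by simp
  qed
  also have "\<dots> = (\<integral>x. H x * f x \<partial>P)"
    using A by (simp add: integral_shift[of "\<lambda>x. H x * f x"])
  finally show ?thesis .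
qed

lemma integral_shift_average_square_le:
  assumes [measurable]: "f \<in> borel_measurable borel" and bd: "\<And>x. \<bar>f x\<bar> \<le> c" and A: "card A > 0"
  shows "(\<integral>x. (shift_average A f x)\<^sup>2 \<partial>P) \<le> (\<integral>x. (f x)\<^sup>2 \<partial>P)"
proof -
  have bd2: "norm ((f x)\<^sup>2) \<le> c\<^sup>2" for x using bd[of x] by (simp add: abs_le_square_iff[symmetric])
  have bda: "norm ((shift_average A f x)\<^sup>2) \<le> c\<^sup>2" for x
    using shift_average_bounded[of f c A x, OF bd] by (simp add: abs_le_square_iff[symmetric])
  have "(\<integral>x. (shift_average A f x)\<^sup>2 \<partial>P)
      \<le> (\<integral>x. shift_average A (\<lambda>x. (f x)\<^sup>2) x \<partial>P)"
  proof (rule integral_mono)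
    show "integrable P (\<lambda>x. (shift_average A f x)\<^sup>2)"
      by (rule integrable_bounded[OF _ bda]) measurable
    show "integrable P (shift_average A (\<lambda>x. (f x)\<^sup>2))"
      by (rule integrable_bounded[of _ "c\<^sup>2"])
        (use bd2 shift_average_bounded[of "\<lambda>x. (f x)\<^sup>2" "c\<^sup>2"] in auto)
    fix x
    have "(\<Sum>v\<in>A. f (field_shift v x))\<^sup>2 \<le> (\<Sum>v\<in>A. (f (field_shift v x))\<^sup>2) * real (card A)"
      using sum_squared_le_sum_of_squares[of "\<lambda>v. f (field_shift v x)" A] A
      by (cases "finite A") auto
    then show "(shift_average A f x)\<^sup>2 \<le> shift_average A (\<lambda>x. (f x)\<^sup>2) x"
      using A by (simp add: shift_average_def power_divide field_simps power2_eq_square)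
  qed
  also have "\<dots> = (\<integral>x. (f x)\<^sup>2 \<partial>P)"
    using integral_shift_average_mult_invariant[of "\<lambda>x. (f x)\<^sup>2" "c\<^sup>2" "\<lambda>_. 1" 1 A] bd2 A by simp
  finally show ?thesis .
qed

text \<open>
  A function \<open>g\<close> is averaged like \<open>f\<close> if their averages become uniformly close. This class contains
  the averages of \<open>f\<close> and is closed under midpoints, so the parallelogram law makes the averages of
  \<open>f\<close> a minimising, and hence a Cauchy, sequence for the \<open>L\<^sup>2\<close>-norm on it.
\<close>

definition averaged_like ::
    "(nat \<Rightarrow> 'm lattice set) \<Rightarrow> real \<Rightarrow> (('m lattice \<Rightarrow> real) \<Rightarrow> real) \<Rightarrow> (('m lattice \<Rightarrow> real) \<Rightarrow> real) \<Rightarrow> bool"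
  where "averaged_like D c f g \<longleftrightarrow> g \<in> borel_measurable borel \<and> (\<forall>x. \<bar>g x\<bar> \<le> c) \<and>
    (\<forall>\<epsilon>>0. \<forall>\<^sub>F n in sequentially. \<forall>x. \<bar>shift_average (D n) g x - shift_average (D n) f x\<bar> \<le> \<epsilon>)"

lemma averaged_like_average:
  assumes fol: "folner D" and [measurable]: "f \<in> borel_measurable borel" and bd: "\<And>x. \<bar>f x\<bar> \<le> c"
    and A: "finite A" "card A > 0"
  shows "averaged_like D c f (shift_average A f)"
  unfolding averaged_like_def
proof (intro conjI allI impI)
  show "\<bar>shift_average A f x\<bar> \<le> c" for x by (rule shift_average_bounded[OF bd])
  fix \<epsilon> :: real assume "\<epsilon> > 0"
  have c: "0 \<le> c" using bd[of undefined] by simp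
  have "\<epsilon> / (2 * c + 1) > 0" using c \<open>\<epsilon> > 0\<close> by simp
  then have "\<forall>\<^sub>F n in sequentially. \<forall>v\<in>A.
      real (card {k \<in> D n. k + v \<notin> D n}) / real (card (D n)) < \<epsilon> / (2 * c + 1)"
    using A by (intro eventually_ball_finite ballI order_tendstoD[OF folner_exit_tendsto[OF fol]]) auto
  then show "\<forall>\<^sub>F n in sequentially. \<forall>x.
      \<bar>shift_average (D n) (shift_average A f) x - shift_average (D n) f x\<bar> \<le> \<epsilon>"
  proof eventually_elim
    case (elim n)
    show ?case
    proof
      fix x
      have "shift_average (D n) (shift_average A f) x
          = (\<Sum>v\<in>A. shift_average (D n) f (field_shift v x)) / real (card A)"
        unfolding shift_average_def field_shift_field_shift
        by (simp add: sum_divide_distrib[symmetric] sum.swap[of _ A] add.commute)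
      also have "\<dots> - shift_average (D n) f x
          = (\<Sum>v\<in>A. shift_average (D n) f (field_shift v x) - shift_average (D n) f x) / real (card A)"
        using A by (auto simp: sum_subtractf diff_divide_distrib)
      finally have "\<bar>shift_average (D n) (shift_average A f) x - shift_average (D n) f x\<bar>
          \<le> (\<Sum>v\<in>A. \<bar>shift_average (D n) f (field_shift v x) - shift_average (D n) f x\<bar>) / real (card A)"
        by (simp add: sum_abs divide_right_mono)
      also have "\<dots> \<le> (\<Sum>v\<in>A. \<epsilon>) / real (card A)"
      proof (intro divide_right_mono sum_mono)
        fix v assume v: "v \<in> A"
        have "\<bar>shift_average (D n) f (field_shift v x) - shift_average (D n) f x\<bar>
            \<le> 2 * c * (real (card {k \<in> D n. k + v \<notin> D n}) / real (card (D n)))"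
          by (rule shift_average_shift[OF folner_finite[OF fol] bd])
        also have "\<dots> \<le> 2 * c * (\<epsilon> / (2 * c + 1))"
          using elim v c by (intro mult_left_mono) (auto simp: less_imp_le)
        also have "\<dots> \<le> \<epsilon>" using c \<open>\<epsilon> > 0\<close> by (simp add: field_simps)
        finally show "\<bar>shift_average (D n) f (field_shift v x) - shift_average (D n) f x\<bar> \<le> \<epsilon>" .
      qed simp
      also have "\<dots> = \<epsilon>" using A by (auto simp: card_gt_0_iff)
      finally show "\<bar>shift_average (D n) (shift_average A f) x - shift_average (D n) f x\<bar> \<le> \<epsilon>" .
    qed
  qed
qed measurable

lemma averaged_like_midpoint:
  assumes "averaged_like D c f g" "averaged_like D c f h"
  shows "averaged_like D c f (\<lambda>x. (g x + h x) / 2)"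
  unfolding averaged_like_def
proof (intro conjI allI impI)
  have [measurable]: "g \<in> borel_measurable borel" "h \<in> borel_measurable borel"
    and bd: "\<bar>g x\<bar> \<le> c" "\<bar>h x\<bar> \<le> c" for x
    using assms by (auto simp: averaged_like_def)
  show "(\<lambda>x. (g x + h x) / 2) \<in> borel_measurable borel" by measurable
  show "\<bar>(g x + h x) / 2\<bar> \<le> c" for x using bd[of x] by (auto simp: abs_le_iff)
  fix \<epsilon> :: real assume "\<epsilon> > 0"
  then have "\<forall>\<^sub>F n in sequentially. \<forall>x. \<bar>shift_average (D n) g x - shift_average (D n) f x\<bar> \<le> \<epsilon>"
    "\<forall>\<^sub>F n in sequentially. \<forall>x. \<bar>shift_average (D n) h x - shift_average (D n) f x\<bar> \<le> \<epsilon>"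
    using assms by (auto simp: averaged_like_def)
  then show "\<forall>\<^sub>F n in sequentially. \<forall>x.
      \<bar>shift_average (D n) (\<lambda>x. (g x + h x) / 2) x - shift_average (D n) f x\<bar> \<le> \<epsilon>"
  proof eventually_elim
    case (elim n)
    show ?case
    proof
      fix x
      have "shift_average (D n) (\<lambda>x. (g x + h x) / 2) x
        = (shift_average (D n) g x + shift_average (D n) h x) / 2"
        by (simp add: shift_average_def sum.distrib sum_divide_distrib[symmetric] add_divide_distrib)
      then show "\<bar>shift_average (D n) (\<lambda>x. (g x + h x) / 2) x - shift_average (D n) f x\<bar> \<le> \<epsilon>"
        using elim(1)[rule_format, of x] elim(2)[rule_format, of x] by (auto simp: abs_le_iff)
    qed
  qed
qed

text \<open>
  Let \<open>d\<close> be the infimum of \<open>\<integral>g\<^sup>2\<close> over the class. An almost minimising \<open>g\<close> shows that the averages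
  of \<open>f\<close> almost attain \<open>d\<close>, because averaging contracts the \<open>L\<^sup>2\<close>-norm. The midpoint of two averages
  lies in the class, so its square has integral at least \<open>d\<close>, and the parallelogram law bounds their distance.
\<close>

lemma averages_Cauchy_L1:
  assumes fol: "folner D" and [measurable]: "f \<in> borel_measurable borel" and bd: "\<And>x. \<bar>f x\<bar> \<le> c"
    and e: "e > 0"
  shows "\<exists>N. \<forall>n\<ge>N. \<forall>k\<ge>N. 0 < card (D n) \<and>
    (\<integral>x. \<bar>shift_average (D n) f x - shift_average (D k) f x\<bar> \<partial>P) \<le> e"
proof -
  define sq where "sq g = (\<integral>x. (g x)\<^sup>2 \<partial>P)" for g :: "_ \<Rightarrow> real"
  define d where "d = Inf (sq ` {g. averaged_like D c f g})"
  have c: "0 \<le> c" using bd[of undefined] by simp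
  have bel: "bdd_below (sq ` {g. averaged_like D c f g})"
    by (rule bdd_belowI2[of _ 0]) (simp add: sq_def)
  have ne: "{g. averaged_like D c f g} \<noteq> {}"
  proof -
    have "averaged_like D c f f" using bd by (simp add: averaged_like_def)
    then show ?thesis by blast
  qed
  have lower: "d \<le> sq g" if "averaged_like D c f g" for g
    unfolding d_def using that by (intro cInf_lower bel) auto
  define \<epsilon> where "\<epsilon> = e\<^sup>2 / 4"
  have \<epsilon>: "\<epsilon> > 0" using e by (simp add: \<epsilon>_def)
  have "\<exists>y\<in>sq ` {g. averaged_like D c f g}. y < d + \<epsilon> / 2"
    unfolding d_def using \<epsilon> ne by (subst cInf_less_iff[symmetric]) (auto simp: bel)
  then obtain g where g: "averaged_like D c f g" "sq g < d + \<epsilon> / 2" by blast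
  have [measurable]: "g \<in> borel_measurable borel" and gb: "\<And>x. \<bar>g x\<bar> \<le> c"
    using g(1) by (auto simp: averaged_like_def)
  have "\<epsilon> / (4 * (c + 1)) > 0" using \<epsilon> c by simp
  then have "\<forall>\<^sub>F n in sequentially. \<forall>x.
      \<bar>shift_average (D n) g x - shift_average (D n) f x\<bar> \<le> \<epsilon> / (4 * (c + 1))"
    using g(1) unfolding averaged_like_def by blast
  then have "\<forall>\<^sub>F n in sequentially. 0 < card (D n) \<and> sq (shift_average (D n) f) \<le> d + \<epsilon>"
    using folner_eventually_pos[OF fol]
  proof eventually_elim
    case (elim n)
    define G where "G = shift_average (D n) g"
    define F where "F = shift_average (D n) f"
    have [measurable]: "G \<in> borel_measurable borel" "F \<in> borel_measurable borel"
      unfolding G_def F_def by measurable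
    have GF: "\<bar>G x\<bar> \<le> c" "\<bar>F x\<bar> \<le> c" for x
      unfolding G_def F_def by (rule shift_average_bounded, fact)+
    have sqb: "(G x)\<^sup>2 \<le> c\<^sup>2" "(F x)\<^sup>2 \<le> c\<^sup>2" for x
      using GF[of x] by (simp_all add: abs_le_square_iff[symmetric])
    have iFG: "integrable P (\<lambda>x. (F x)\<^sup>2)" "integrable P (\<lambda>x. (G x)\<^sup>2)"
      using sqb by (auto intro!: integrable_bounded[of _ "c\<^sup>2"])
    have "sq F \<le> (\<integral>x. (G x)\<^sup>2 + \<epsilon> / 2 \<partial>P)"
      unfolding sq_def
    proof (rule integral_mono)
      show "integrable P (\<lambda>x. (F x)\<^sup>2)" "integrable P (\<lambda>x. (G x)\<^sup>2 + \<epsilon> / 2)"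
        using iFG by auto
      fix x
      have "(F x)\<^sup>2 - (G x)\<^sup>2 = (F x - G x) * (F x + G x)" by (simp add: power2_eq_square algebra_simps)
      also have "\<dots> \<le> \<bar>F x - G x\<bar> * \<bar>F x + G x\<bar>" by (metis abs_ge_self abs_mult)
      also have "\<dots> \<le> \<epsilon> / (4 * (c + 1)) * (2 * (c + 1))"
      proof (rule mult_mono)
        show "\<bar>F x - G x\<bar> \<le> \<epsilon> / (4 * (c + 1))"
          using elim(1)[rule_format, of x] by (simp add: F_def G_def abs_minus_commute)
        show "\<bar>F x + G x\<bar> \<le> 2 * (c + 1)" using GF[of x] by (auto simp: abs_le_iff)
      qed (use \<epsilon> c in auto)
      also have "\<dots> = \<epsilon> / 2" using c by (simp add: field_simps)
      finally show "(F x)\<^sup>2 \<le> (G x)\<^sup>2 + \<epsilon> / 2" by linarith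
    qed
    also have "\<dots> = sq G + \<epsilon> / 2"
      unfolding sq_def using iFG
      by (subst Bochner_Integration.integral_add) (auto simp: prob_space)
    also have "sq G \<le> sq g"
      unfolding sq_def G_def by (rule integral_shift_average_square_le[OF _ gb elim(2)]) measurable
    finally have "sq F \<le> d + \<epsilon>" using g(2) by linarith
    then show ?case using elim(2) by (simp add: F_def)
  qed
  then obtain N where N: "\<And>n. n \<ge> N \<Longrightarrow> 0 < card (D n) \<and> sq (shift_average (D n) f) \<le> d + \<epsilon>"
    by (auto simp: eventually_sequentially)
  show ?thesis
  proof (intro exI allI impI conjI)
    fix n k assume nk: "n \<ge> N" "k \<ge> N"
    show "0 < card (D n)" using N nk by blast
    define F where "F = shift_average (D n) f"
    define G where "G = shift_average (D k) f"
    have [measurable]: "G \<in> borel_measurable borel" "F \<in> borel_measurable borel"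
      unfolding G_def F_def by measurable
    have GF: "\<bar>G x\<bar> \<le> c" "\<bar>F x\<bar> \<le> c" for x
      unfolding G_def F_def by (rule shift_average_bounded, fact)+
    have like: "averaged_like D c f F" "averaged_like D c f G"
      unfolding F_def G_def using N nk
      by (auto intro!: averaged_like_average[OF fol _ bd] folner_finite[OF fol])
    have i1: "integrable P (\<lambda>x. (F x)\<^sup>2)" "integrable P (\<lambda>x. (G x)\<^sup>2)"
      using GF c by (auto intro!: integrable_bounded[of _ "c\<^sup>2"] simp: abs_le_square_iff[symmetric])
    have i2: "integrable P (\<lambda>x. ((F x + G x) / 2)\<^sup>2)"
    proof (rule integrable_bounded)
      fix x
      have "\<bar>(F x + G x) / 2\<bar> \<le> \<bar>c\<bar>"
        unfolding abs_of_nonneg[OF c] using GF[of x] by (auto simp: abs_le_iff)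
      then show "norm (((F x + G x) / 2)\<^sup>2) \<le> c\<^sup>2" unfolding abs_le_square_iff by simp
    qed measurable
    have eq: "(F x - G x)\<^sup>2 = 2 * (F x)\<^sup>2 + 2 * (G x)\<^sup>2 - 4 * ((F x + G x) / 2)\<^sup>2" for x
      by (simp add: power2_eq_square field_simps)
    have i3: "integrable P (\<lambda>x. (F x - G x)\<^sup>2)" unfolding eq using i1 i2 by auto
    have "(\<integral>x. (F x - G x)\<^sup>2 \<partial>P) = 2 * sq F + 2 * sq G - 4 * sq (\<lambda>x. (F x + G x) / 2)"
      unfolding eq sq_def using i1 i2
      by (simp add: Bochner_Integration.integral_add Bochner_Integration.integral_diff)
    also have "\<dots> \<le> 2 * (d + \<epsilon>) + 2 * (d + \<epsilon>) - 4 * d"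
      using N[OF nk(1)] N[OF nk(2)] lower[OF averaged_like_midpoint[OF like]]
      by (simp add: F_def G_def)
    also have "\<dots> = e\<^sup>2" by (simp add: \<epsilon>_def)
    finally have "(\<integral>x. (F x - G x)\<^sup>2 \<partial>P) \<le> e\<^sup>2" .
    then show "(\<integral>x. \<bar>shift_average (D n) f x - shift_average (D k) f x\<bar> \<partial>P) \<le> e"
      unfolding F_def[symmetric] G_def[symmetric]
    proof (rule expectation_abs_le_if_square_le[OF i3 _ _ e, rotated])
      show "integrable P (\<lambda>x. F x - G x)"
        using GF by (intro Bochner_Integration.integrable_diff integrable_bounded[of _ c]) auto
    qed
  qed
qed

text \<open>
  The limit is taken along a rapidly converging subsequence. Its domain of convergence and its values
  are invariant under every shift, not just almost surely, because the averages at \<open>x\<close> and at a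
  shift of \<open>x\<close> have the same limit behaviour.
\<close>

theorem mean_ergodic:
  assumes fol: "folner D" and f [measurable]: "f \<in> borel_measurable borel" and bd: "\<And>x. \<bar>f x\<bar> \<le> c"
  shows "(\<lambda>n. \<integral>x. \<bar>shift_average (D n) f x - real_cond_exp P \<I> f x\<bar> \<partial>P) \<longlonglongrightarrow> 0"
proof -
  have c: "0 \<le> c" using bd[of undefined] by simp
  have "\<forall>k. \<exists>N. \<forall>n\<ge>N. \<forall>m\<ge>N. 0 < card (D n) \<and>
      (\<integral>x. \<bar>shift_average (D n) f x - shift_average (D m) f x\<bar> \<partial>P) \<le> (1/2) ^ k"
    by (intro allI averages_Cauchy_L1[OF fol f bd]) auto
  then obtain R where R: "\<And>k n m. n \<ge> R k \<Longrightarrow> m \<ge> R k \<Longrightarrow> 0 < card (D n) \<and>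
      (\<integral>x. \<bar>shift_average (D n) f x - shift_average (D m) f x\<bar> \<partial>P) \<le> (1/2) ^ k" by metis
  \<comment> \<open>indices that grow and stay beyond every \<open>R k\<close>, so that consecutive differences are summable\<close>
  define r where "r k = (\<Sum>i\<le>k. Suc (R i))" for k
  have rR: "R k \<le> r k" for k
    unfolding r_def using member_le_sum[of k "{..k}" "\<lambda>i. Suc (R i)"] by simp
  have rS: "r k \<le> r (Suc k)" for k by (simp add: r_def)
  have r_id: "k \<le> r k" for k
  proof -
    have "(\<Sum>i\<le>k. 1) \<le> (\<Sum>i\<le>k. Suc (R i))" by (intro sum_mono) auto
    then show ?thesis by (simp add: r_def)
  qed
  have rlim: "filterlim r at_top sequentially"
    by (rule filterlim_at_top_mono[OF filterlim_ident]) (auto simp: r_id)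
  define B where "B k = shift_average (D (r k)) f" for k
  have [measurable]: "B k \<in> borel_measurable borel" for k unfolding B_def by measurable
  have Bb: "\<bar>B k x\<bar> \<le> c" for k x unfolding B_def by (rule shift_average_bounded[OF bd])
  have Bi: "integrable P (B k)" for k by (rule integrable_bounded[of _ c]) (use Bb in auto)
  have dB: "(\<integral>x. \<bar>B (Suc k) x - B k x\<bar> \<partial>P) \<le> (1/2) ^ k" for k
    unfolding B_def using R[of k "r (Suc k)" "r k"] rR[of k] rS[of k] by (meson order_trans)
  have "AE x in P. (\<Sum>k. ennreal \<bar>B (Suc k) x - B k x\<bar>) \<noteq> \<infinity>"
  proof (rule nn_integral_PInf_AE)
    show "(\<lambda>x. \<Sum>k. ennreal \<bar>B (Suc k) x - B k x\<bar>) \<in> borel_measurable P" by measurable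
    have "(\<integral>\<^sup>+x. (\<Sum>k. ennreal \<bar>B (Suc k) x - B k x\<bar>) \<partial>P)
        = (\<Sum>k. \<integral>\<^sup>+x. ennreal \<bar>B (Suc k) x - B k x\<bar> \<partial>P)"
      by (rule nn_integral_suminf) measurable
    also have "\<dots> = (\<Sum>k. ennreal (\<integral>x. \<bar>B (Suc k) x - B k x\<bar> \<partial>P))"
      using Bi by (subst nn_integral_eq_integral) auto
    also have "\<dots> \<le> (\<Sum>k. ennreal ((1/2) ^ k))"
      by (intro suminf_le ennreal_leI dB) auto
    also have "\<dots> = ennreal (\<Sum>k. (1/2) ^ k)"
      by (rule suminf_ennreal2) (auto intro: summable_geometric)
    also have "\<dots> < \<infinity>" by simp
    finally show "(\<integral>\<^sup>+x. (\<Sum>k. ennreal \<bar>B (Suc k) x - B k x\<bar>) \<partial>P) \<noteq> \<infinity>" by simp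
  qed
  then have conv: "AE x in P. convergent (\<lambda>k. B k x)"
  proof eventually_elim
    case (elim x)
    then have "summable (\<lambda>k. \<bar>B (Suc k) x - B k x\<bar>)"
      by (intro summable_suminf_not_top) auto
    then have "summable (\<lambda>k. B (Suc k) x - B k x)" by (rule summable_rabs_cancel)
    then have "convergent (\<lambda>n. \<Sum>k<n. B (Suc k) x - B k x)" by (simp add: summable_iff_convergent)
    then have "convergent (\<lambda>n. B n x - B 0 x)"
      by (simp only: sum_lessThan_telescope[of "\<lambda>k. B k x"])
    then show ?case by (simp only: convergent_diff_const_right_iff)
  qed
  define g where "g x = (if convergent (\<lambda>k. B k x) then lim (\<lambda>k. B k x) else 0)" for x
  have g_lim: "(\<lambda>k. B k x) \<longlonglongrightarrow> g x" if "convergent (\<lambda>k. B k x)" for x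
    using that by (simp add: g_def convergent_LIMSEQ_iff)
  have gm [measurable]: "g \<in> borel_measurable borel"
    unfolding g_def Cauchy_convergent_iff[symmetric] by measurable
  have gb: "\<bar>g x\<bar> \<le> c" for x
  proof (cases "convergent (\<lambda>k. B k x)")
    case True
    have "(\<lambda>k. \<bar>B k x\<bar>) \<longlonglongrightarrow> \<bar>g x\<bar>" by (intro tendsto_rabs g_lim True)
    then show ?thesis by (rule LIMSEQ_le_const2) (use Bb in auto)
  qed (simp add: g_def c)
  have ginv: "g (field_shift v x) = g x" for v x
  proof -
    have d: "(\<lambda>k. B k (field_shift v x) - B k x) \<longlonglongrightarrow> 0"
    proof (rule Lim_null_comparison)
      show "\<forall>\<^sub>F k in sequentially. norm (B k (field_shift v x) - B k x)
          \<le> 2 * c * (real (card {i \<in> D (r k). i + v \<notin> D (r k)}) / real (card (D (r k))))"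
        unfolding B_def real_norm_def
        by (intro always_eventually allI shift_average_shift[OF folner_finite[OF fol] bd])
      show "(\<lambda>k. 2 * c * (real (card {i \<in> D (r k). i + v \<notin> D (r k)}) / real (card (D (r k))))) \<longlonglongrightarrow> 0"
        using tendsto_mult[OF tendsto_const filterlim_compose[OF folner_exit_tendsto[OF fol] rlim],
          of "2 * c"] by simp
    qed
    have to: "(\<lambda>k. B k (field_shift v x)) \<longlonglongrightarrow> L \<longleftrightarrow> (\<lambda>k. B k x) \<longlonglongrightarrow> L" for L
      using tendsto_add[OF d, of "\<lambda>k. B k x" L] tendsto_diff[OF _ d, of "\<lambda>k. B k (field_shift v x)" L]
      by auto
    then show ?thesis unfolding g_def convergent_def lim_def by simp
  qed
  have gI [measurable]: "g \<in> borel_measurable \<I>" by (rule \<I>_measurableI[OF gm ginv])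
  have gi: "integrable P g" by (rule integrable_bounded[of _ c]) (use gb in auto)
  have Bg: "(\<lambda>k. \<integral>x. \<bar>B k x - g x\<bar> \<partial>P) \<longlonglongrightarrow> (\<integral>x. 0 \<partial>P)"
  proof (rule integral_dominated_convergence[where w = "\<lambda>_. 2 * c"])
    show "AE x in P. (\<lambda>k. \<bar>B k x - g x\<bar>) \<longlonglongrightarrow> 0"
      using conv by eventually_elim (intro tendsto_rabs_zero LIM_zero g_lim)
    show "AE x in P. norm \<bar>B k x - g x\<bar> \<le> 2 * c" for k
    proof (rule AE_I2)
      fix x show "norm \<bar>B k x - g x\<bar> \<le> 2 * c" using Bb[of k x] gb[of x] by simp
    qed
  qed auto
  have An: "integrable P (shift_average (D n) f)" for n
    by (rule integrable_bounded[of _ c]) (auto simp: shift_average_bounded[OF bd])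
  have fi: "integrable P f" by (rule integrable_bounded[of _ c]) (use bd in auto)
  have Ag: "(\<lambda>n. \<integral>x. \<bar>shift_average (D n) f x - g x\<bar> \<partial>P) \<longlonglongrightarrow> 0"
  proof (rule LIMSEQ_I)
    fix e :: real assume e: "e > 0"
    obtain k1 where k1: "\<And>k. k \<ge> k1 \<Longrightarrow> (\<integral>x. \<bar>B k x - g x\<bar> \<partial>P) < e / 2"
      using order_tendstoD(2)[OF Bg, of "e / 2"] e by (auto simp: eventually_sequentially)
    obtain k2 where k2: "(1/2) ^ k2 < e / 2" using e real_arch_pow_inv[of "e/2" "1/2"] by auto
    define k where "k = max k1 k2"
    have "(1/2) ^ k \<le> ((1/2) ^ k2 :: real)" unfolding k_def by (intro power_decreasing) auto
    show "\<exists>N. \<forall>n\<ge>N. norm ((\<integral>x. \<bar>shift_average (D n) f x - g x\<bar> \<partial>P) - 0) < e"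
    proof (intro exI allI impI)
      fix n assume "n \<ge> R k"
      then have 1: "(\<integral>x. \<bar>shift_average (D n) f x - B k x\<bar> \<partial>P) \<le> (1/2) ^ k"
        unfolding B_def using R rR by blast
      have "(\<integral>x. \<bar>shift_average (D n) f x - g x\<bar> \<partial>P)
          \<le> (\<integral>x. \<bar>shift_average (D n) f x - B k x\<bar> + \<bar>B k x - g x\<bar> \<partial>P)"
        using An Bi gi by (intro integral_mono) auto
      also have "\<dots> = (\<integral>x. \<bar>shift_average (D n) f x - B k x\<bar> \<partial>P) + (\<integral>x. \<bar>B k x - g x\<bar> \<partial>P)"
        using An Bi gi by (intro Bochner_Integration.integral_add) auto
      also have "\<dots> < e"
      proof -
        have "k1 \<le> k" by (simp add: k_def)
        then show ?thesis using 1 k1[of k] \<open>(1/2) ^ k \<le> (1/2) ^ k2\<close> k2 by linarith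
      qed
      finally show "norm ((\<integral>x. \<bar>shift_average (D n) f x - g x\<bar> \<partial>P) - 0) < e" by simp
    qed
  qed
  have "AE x in P. real_cond_exp P \<I> f x = g x"
  proof (rule real_cond_exp_charact)
    fix A assume A: "A \<in> sets \<I>"
    have [measurable]: "A \<in> sets borel" using A by (simp add: sets_\<I>)
    have im [measurable]: "(indicator A :: _ \<Rightarrow> real) \<in> borel_measurable \<I>" using A by simp
    have i: "integrable P (\<lambda>x. indicator A x * shift_average (D n) f x)"
         "integrable P (\<lambda>x. indicator A x * g x)" for n
      using c gb shift_average_bounded[of f c, OF bd]
      by (auto intro!: integrable_bounded[of _ c] simp: indicator_def)
    have "(\<lambda>n. (\<integral>x. indicator A x * shift_average (D n) f x \<partial>P) - (\<integral>x. indicator A x * g x \<partial>P)) \<longlonglongrightarrow> 0"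
    proof (rule Lim_null_comparison[OF _ Ag])
      show "\<forall>\<^sub>F n in sequentially. norm ((\<integral>x. indicator A x * shift_average (D n) f x \<partial>P)
         - (\<integral>x. indicator A x * g x \<partial>P)) \<le> (\<integral>x. \<bar>shift_average (D n) f x - g x\<bar> \<partial>P)"
      proof (intro always_eventually allI)
        fix n
        have "norm ((\<integral>x. indicator A x * shift_average (D n) f x \<partial>P) - (\<integral>x. indicator A x * g x \<partial>P))
           = norm (\<integral>x. indicator A x * (shift_average (D n) f x - g x) \<partial>P)"
          using i by (simp add: right_diff_distrib)
        also have "\<dots> \<le> (\<integral>x. norm (indicator A x * (shift_average (D n) f x - g x)) \<partial>P)"
          by (rule integral_norm_bound)
        also have "\<dots> \<le> (\<integral>x. \<bar>shift_average (D n) f x - g x\<bar> \<partial>P)"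
          using i An[of n] gi by (intro integral_mono)
            (auto simp: right_diff_distrib indicator_def)
        finally show "norm ((\<integral>x. indicator A x * shift_average (D n) f x \<partial>P)
         - (\<integral>x. indicator A x * g x \<partial>P)) \<le> (\<integral>x. \<bar>shift_average (D n) f x - g x\<bar> \<partial>P)" .
      qed
    qed
    then have "(\<lambda>n. \<integral>x. indicator A x * shift_average (D n) f x \<partial>P) \<longlonglongrightarrow> (\<integral>x. indicator A x * g x \<partial>P)"
      by (rule LIM_zero_cancel)
    moreover have "\<forall>\<^sub>F n in sequentially.
        (\<integral>x. indicator A x * shift_average (D n) f x \<partial>P) = (\<integral>x. indicator A x * f x \<partial>P)"
      using folner_eventually_pos[OF fol]
      by eventually_elim (rule integral_shift_average_mult_invariant[OF f bd im, of 1], auto)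
    ultimately have "(\<lambda>n::nat. \<integral>x. indicator A x * f x \<partial>P) \<longlonglongrightarrow> (\<integral>x. indicator A x * g x \<partial>P)"
      by (rule Lim_transform_eventually)
    then have "(\<integral>x. indicator A x * f x \<partial>P) = (\<integral>x. indicator A x * g x \<partial>P)"
      by (simp add: LIMSEQ_const_iff)
    then show "(\<integral>x\<in>A. f x \<partial>P) = (\<integral>x\<in>A. g x \<partial>P)"
      by (simp add: set_lebesgue_integral_def)
  qed (use fi gi gI in auto)
  then have eq: "AE x in P. \<bar>shift_average (D n) f x - real_cond_exp P \<I> f x\<bar>
      = \<bar>shift_average (D n) f x - g x\<bar>" for n
    by eventually_elim simp
  have "(\<integral>x. \<bar>shift_average (D n) f x - real_cond_exp P \<I> f x\<bar> \<partial>P)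
     = (\<integral>x. \<bar>shift_average (D n) f x - g x\<bar> \<partial>P)" for n
    by (rule integral_cong_AE[OF _ _ eq]) (auto intro: measurable_\<I>_borel simp: measurable_P)
  then show ?thesis using Ag by simp
qed

end

section \<open>Covariance bounds from the coefficients\<close>

lemma truncation_1_lipschitz:
  fixes \<phi> :: "'a::metric_space \<Rightarrow> real"
  assumes "1-lipschitz_on U \<phi>"
  shows "1-lipschitz_on U (\<lambda>x. max (- T) (min T (\<phi> x)))"
proof (rule lipschitz_onI)
  fix x y assume "x \<in> U" "y \<in> U"
  then have "\<bar>\<phi> x - \<phi> y\<bar> \<le> 1 * dist x y"
    using lipschitz_onD[OF assms] by (simp add: dist_real_def)
  then show "dist (max (- T) (min T (\<phi> x))) (max (- T) (min T (\<phi> y))) \<le> 1 * dist x y"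
    by (auto simp: dist_real_def max_def min_def)
qed simp

lemma cylinder_mult:
  fixes V W :: "('m::finite lattice \<Rightarrow> real) \<Rightarrow> real"
  assumes "cylinder \<Gamma> V" "cylinder \<Gamma> W"
  shows "cylinder \<Gamma> (\<lambda>x. V x * W x)"
  unfolding cylinder_def
proof (intro conjI allI impI)
  show "(\<lambda>x. V x * W x) \<in> borel_measurable borel"
    using assms by (intro borel_measurable_times cylinder_measurable)
  fix x y :: "'m lattice \<Rightarrow> real" assume "\<forall>i\<in>\<Gamma>. x i = y i"
  then have "V x = V y" "W x = W y" using assms unfolding cylinder_def by blast+
  then show "V x * W x = V y * W y" by simp
qed

lemma (in prob_space) cov_eq:
  assumes "integrable M f" "integrable M g" "integrable M (\<lambda>x. f x * g x)"
  shows "cov M f g = (\<integral>x. f x * g x \<partial>M) - (\<integral>x. f x \<partial>M) * (\<integral>x. g x \<partial>M)"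
proof -
  have "(f x - a) * (g x - b) = f x * g x - b * f x - a * g x + a * b" for x a b
    by (simp add: algebra_simps)
  then show ?thesis using assms unfolding cov_def by (simp add: prob_space)
qed

context stationary_law
begin

text \<open>
  A cylinder function on \<open>\<Gamma>\<close> becomes a function on \<open>\<real>\<^sup>u\<close> after enumerating \<open>\<Gamma>\<close>. The quotients that
  define \<open>\<theta>\<close> exist only for a non-zero denominator; a vanishing denominator means that one of the
  two variables is constant, so that the covariance vanishes.
\<close>

lemma cov_cylinder_le:
  fixes W :: "('m lattice \<Rightarrow> real) \<Rightarrow> real"
  assumes \<Gamma>: "finite \<Gamma>" "\<Gamma> \<subseteq> lex_past_dist j h"
    and W: "cylinder \<Gamma> W" and Wb: "\<And>x. \<bar>W x\<bar> \<le> c"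
    and G: "1-lipschitz_on UNIV G" and Gb: "\<And>y. \<bar>G y\<bar> \<le> B"
    and th: "theta_lex P (\<lambda>t x. x t) h \<le> ennreal r" "0 \<le> r"
  shows "\<bar>(\<integral>x. W x * G (x j) \<partial>P) - (\<integral>x. W x \<partial>P) * (\<integral>x. G (x j) \<partial>P)\<bar> \<le> c * r"
proof -
  have c: "0 \<le> c" using Wb[of undefined] by linarith
  have [measurable]: "W \<in> borel_measurable borel" using W by (rule cylinder_measurable)
  have [measurable]: "G \<in> borel_measurable borel"
    using G by (intro borel_measurable_continuous_onI lipschitz_on_continuous_on)
  have iW: "integrable P W" using Wb by (intro integrable_bounded[of _ c]) auto
  have iG: "integrable P (\<lambda>x. G (x j))" using Gb by (intro integrable_bounded[of _ B]) auto
  have iWG: "integrable P (\<lambda>x. W x * G (x j))"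
  proof (rule integrable_bounded)
    show "norm (W x * G (x j)) \<le> c * B" for x
      unfolding real_norm_def abs_mult using Wb Gb c by (intro mult_mono) auto
  qed measurable
  have covWG: "cov P W (\<lambda>x. G (x j)) = (\<integral>x. W x * G (x j) \<partial>P) - (\<integral>x. W x \<partial>P) * (\<integral>x. G (x j) \<partial>P)"
    using iW iG iWG by (rule cov_eq)
  have const_W: ?thesis if "\<And>x. W x = w" for w
    using that c th(2) by simp
  have const_G: ?thesis if "\<And>x. G x = w" for w
    using that c th(2) by simp
  define u where "u = card \<Gamma>"
  show ?thesis
  proof (cases "\<Gamma> = {}")
    case True
    have "W x = W (\<lambda>_. 0)" for x
      using W True unfolding cylinder_def by blast
    then show ?thesis by (rule const_W)
  next
    case False
    then have u: "u \<ge> 1" using \<Gamma>(1) by (simp add: u_def Suc_le_eq card_gt_0_iff)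
    obtain \<gamma> where \<gamma>: "bij_betw \<gamma> {..<u} \<Gamma>"
      using ex_bij_betw_nat_finite[OF \<Gamma>(1)] unfolding u_def lessThan_atLeast0 by blast
    define \<iota> where "\<iota> = inv_into {..<u} \<gamma>"
    have \<iota>: "\<iota> t < u" "\<gamma> (\<iota> t) = t" if "t \<in> \<Gamma>" for t
      using bij_betw_inv_into_right[OF \<gamma> that] bij_betw_apply[OF bij_betw_inv_into[OF \<gamma>] that]
      by (auto simp: \<iota>_def)
    define F where "F z = W (\<lambda>t. if t \<in> \<Gamma> then z (\<iota> t) else 0)" for z :: "nat \<Rightarrow> real"
    have FW: "F (\<lambda>i\<in>{..<u}. x (\<gamma> i)) = W x" for x
      using W \<iota> unfolding F_def cylinder_def by auto
    have Fm: "F \<in> borel_measurable (tuple_space u)"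
      unfolding F_def
    proof (rule measurable_compose[OF _ \<open>W \<in> borel_measurable borel\<close>])
      show "(\<lambda>z t. if t \<in> \<Gamma> then z (\<iota> t) else 0) \<in> borel_measurable (tuple_space u)"
      proof (rule measurable_coordinatewise_then_product)
        fix t
        show "(\<lambda>z. if t \<in> \<Gamma> then z (\<iota> t) else 0) \<in> borel_measurable (tuple_space u)"
          using \<iota>(1)[of t] by (cases "t \<in> \<Gamma>") (auto intro!: measurable_component_singleton)
      qed
    qed
    have Fb: "\<bar>F z\<bar> \<le> c" for z unfolding F_def by (rule Wb)
    have bdd: "bdd_above ((\<lambda>z. \<bar>F z\<bar>) ` space (tuple_space u))"
      using Fb by (intro bdd_aboveI2)
    have ne: "space (tuple_space u) \<noteq> {}" by (simp add: space_PiM PiE_eq_empty_iff)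
    define s where "s = tuple_sup_norm u F"
    have s_upper: "\<bar>F z\<bar> \<le> s" if "z \<in> space (tuple_space u)" for z
      unfolding s_def tuple_sup_norm_def using that bdd by (rule cSUP_upper)
    have "s \<le> c" unfolding s_def tuple_sup_norm_def using ne Fb by (rule cSUP_least)
    have "0 \<le> s" using s_upper ne by (meson abs_ge_zero all_not_in_conv order_trans)
    have L_set: "1 \<in> {L. lipschitz_on L UNIV G}" "\<And>L. L \<in> {L. lipschitz_on L UNIV G} \<Longrightarrow> 0 \<le> L"
      using G by (auto dest: lipschitz_on_nonneg)
    have "Lip G \<le> 1" unfolding Lip_def using L_set by (intro cInf_lower bdd_belowI[of _ 0]) auto
    have "0 \<le> Lip G" unfolding Lip_def using L_set by (intro cInf_greatest) auto
    consider "s = 0" | "Lip G = 0" | "s * Lip G \<noteq> 0" by fastforce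
    then show ?thesis
    proof cases
      case 1
      have "W x = 0" for x
        using s_upper[of "\<lambda>i\<in>{..<u}. x (\<gamma> i)"] 1 FW[of x] by (simp add: space_PiM)
      then show ?thesis by (rule const_W)
    next
      case 2
      have "G x = G 0" for x
      proof (rule ccontr)
        assume ne: "G x \<noteq> G 0"
        then have "x \<noteq> 0" by auto
        define e where "e = \<bar>G x - G 0\<bar> / \<bar>x\<bar>"
        have "e > 0" using ne \<open>x \<noteq> 0\<close> by (simp add: e_def)
        then have "\<exists>L\<in>{L. lipschitz_on L UNIV G}. L < e"
          using 2 L_set unfolding Lip_def by (subst cInf_less_iff[symmetric]) (auto intro: bdd_belowI[of _ 0])
        then obtain L where L: "lipschitz_on L UNIV G" "L < e" by auto
        then have "\<bar>G x - G 0\<bar> \<le> L * \<bar>x\<bar>"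
          using lipschitz_onD[OF L(1), of x 0] by (simp add: dist_real_def)
        also have "\<dots> < e * \<bar>x\<bar>" using L \<open>x \<noteq> 0\<close> by simp
        also have "\<dots> = \<bar>G x - G 0\<bar>" using \<open>x \<noteq> 0\<close> by (simp add: e_def)
        finally show False by simp
      qed
      then show ?thesis by (rule const_G)
    next
      case 3
      have "ennreal (\<bar>cov P W (\<lambda>x. G (x j))\<bar> / (s * Lip G)) \<le> theta_lex_tuple P (\<lambda>t x. x t) u h"
        unfolding theta_lex_tuple_def
      proof (rule Sup_upper, rule CollectI, intro exI conjI)
        show "ennreal (\<bar>cov P W (\<lambda>x. G (x j))\<bar> / (s * Lip G)) =
          ennreal (\<bar>cov P (\<lambda>\<omega>. F (\<lambda>i\<in>{..<u}. \<omega> (\<gamma> i))) (\<lambda>\<omega>. G (\<omega> j))\<bar> / (tuple_sup_norm u F * Lip G))"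
          by (simp add: FW s_def)
        show "F \<in> bounded_borel u"
          unfolding bounded_borel_def using Fm Fb by (auto intro!: boundedI)
        show "G \<in> bounded_lipschitz"
          unfolding bounded_lipschitz_def using G Gb by (auto intro!: boundedI)
        show "tuple_sup_norm u F * Lip G \<noteq> 0" using 3 by (simp add: s_def)
        show "inj_on \<gamma> {..<u}" using \<gamma> by (rule bij_betw_imp_inj_on)
        show "\<gamma> ` {..<u} \<subseteq> lex_past_dist j h" using \<gamma> \<Gamma> by (simp add: bij_betw_imp_surj_on)
      qed
      also have "\<dots> \<le> theta_lex P (\<lambda>t x. x t) h"
        unfolding theta_lex_def using u by (intro SUP_upper) simp
      also have "\<dots> \<le> ennreal r" by (rule th)
      finally have "\<bar>cov P W (\<lambda>x. G (x j))\<bar> / (s * Lip G) \<le> r"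
        using th(2) by (simp add: ennreal_le_iff)
      moreover have "s * Lip G > 0" using 3 \<open>0 \<le> s\<close> \<open>0 \<le> Lip G\<close> by (simp add: less_le)
      ultimately have "\<bar>cov P W (\<lambda>x. G (x j))\<bar> \<le> r * (s * Lip G)" by (simp add: field_simps)
      also have "\<dots> \<le> r * (c * 1)"
        using \<open>s \<le> c\<close> \<open>Lip G \<le> 1\<close> \<open>0 \<le> s\<close> \<open>0 \<le> Lip G\<close> th(2) c by (intro mult_left_mono mult_mono) auto
      finally show ?thesis unfolding covWG by (simp add: mult.commute)
    qed
  qed
qed

text \<open>
  An invariant variable \<open>H\<close> may be inserted for free: it is close to a cylinder function \<open>F\<close>, and
  by invariance equally close to every translate of \<open>F\<close>, in particular to one whose coordinates
  lie in the remote lexicographic past.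
\<close>

lemma cov_invariant_cylinder_le:
  fixes W :: "('m lattice \<Rightarrow> real) \<Rightarrow> real"
  assumes \<Gamma>: "finite \<Gamma>" "\<Gamma> \<subseteq> lex_past_dist j h"
    and W: "cylinder \<Gamma> W" and Wb: "\<And>x. \<bar>W x\<bar> \<le> c"
    and H: "H \<in> borel_measurable \<I>" "\<And>x. \<bar>H x\<bar> \<le> 1"
    and G: "1-lipschitz_on UNIV G" and Gb: "\<And>y. \<bar>G y\<bar> \<le> B"
    and th: "theta_lex P (\<lambda>t x. x t) h \<le> ennreal r" "0 \<le> r"
  shows "\<bar>(\<integral>x. H x * W x * G (x j) \<partial>P) - (\<integral>x. H x * W x \<partial>P) * (\<integral>x. G (x j) \<partial>P)\<bar> \<le> c * r"
proof (rule field_le_epsilon)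
  fix e :: real assume e: "e > 0"
  have c: "0 \<le> c" using Wb[of undefined] by linarith
  have B: "0 \<le> B" using Gb[of undefined] by linarith
  have [measurable]: "W \<in> borel_measurable borel" using W by (rule cylinder_measurable)
  have [measurable]: "H \<in> borel_measurable borel" using H by (intro measurable_\<I>_borel)
  have [measurable]: "G \<in> borel_measurable borel"
    using G by (intro borel_measurable_continuous_onI lipschitz_on_continuous_on)
  define d where "d = e / (2 * (c * B + 1))"
  have d: "d > 0" using e c B by (simp add: d_def add_nonneg_pos)
  obtain \<Gamma>' F where F: "finite \<Gamma>'" "cylinder \<Gamma>' F" "\<And>x. \<bar>F x\<bar> \<le> 1" "(\<integral>x. \<bar>H x - F x\<bar> \<partial>P) < d"
    using cylinder_bounded_approx[of H 1 d] H d by auto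
  have [measurable]: "F \<in> borel_measurable borel" using F(2) by (rule cylinder_measurable)
  obtain v where v: "(\<lambda>s. s + v) ` \<Gamma>' \<subseteq> lex_past_dist j h"
    using ex_translate_into_lex_past[OF F(1)] by blast
  define F' where "F' x = F (field_shift v x)" for x
  have [measurable]: "F' \<in> borel_measurable borel" unfolding F'_def by measurable
  have F'b: "\<bar>F' x\<bar> \<le> 1" for x unfolding F'_def by (rule F)
  have "(\<integral>x. \<bar>H x - F' x\<bar> \<partial>P) = (\<integral>x. \<bar>H (field_shift v x) - F (field_shift v x)\<bar> \<partial>P)"
    unfolding F'_def \<I>_measurable_shift[OF H(1)] ..
  also have "\<dots> = (\<integral>x. \<bar>H x - F x\<bar> \<partial>P)"
    by (rule integral_shift[of "\<lambda>x. \<bar>H x - F x\<bar>"]) measurable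
  finally have HF: "(\<integral>x. \<bar>H x - F' x\<bar> \<partial>P) < d" using F(4) by simp
  define V where "V x = F' x * W x" for x
  have V: "cylinder ((\<lambda>s. s + v) ` \<Gamma>' \<union> \<Gamma>) V"
  proof -
    have "cylinder ((\<lambda>s. s + v) ` \<Gamma>' \<union> \<Gamma>) F'" unfolding F'_def
      by (rule cylinder_mono[OF cylinder_shift[OF F(2)]]) simp
    moreover have "cylinder ((\<lambda>s. s + v) ` \<Gamma>' \<union> \<Gamma>) W" by (rule cylinder_mono[OF W]) simp
    ultimately show ?thesis unfolding V_def by (rule cylinder_mult)
  qed
  have Vb: "\<bar>V x\<bar> \<le> c" for x
    unfolding V_def abs_mult using mult_mono[OF F'b[of x] Wb[of x]] by simp
  have main: "\<bar>(\<integral>x. V x * G (x j) \<partial>P) - (\<integral>x. V x \<partial>P) * (\<integral>x. G (x j) \<partial>P)\<bar> \<le> c * r"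
    by (rule cov_cylinder_le[OF _ _ V Vb G Gb th]) (use F(1) \<Gamma> v in auto)
  have close: "\<bar>(\<integral>x. H x * W x * g x \<partial>P) - (\<integral>x. V x * g x \<partial>P)\<bar> \<le> c * b * d"
    if [measurable]: "g \<in> borel_measurable borel" and gb: "\<And>x. \<bar>g x\<bar> \<le> b" for g b
  proof -
    have b: "0 \<le> b" using gb[of undefined] by linarith
    have iH: "integrable P (\<lambda>x. H x * W x * g x)"
    proof (rule integrable_bounded)
      show "norm (H x * W x * g x) \<le> (1 * c) * b" for x
        unfolding real_norm_def abs_mult using H(2) Wb gb c by (intro mult_mono) auto
    qed measurable
    have iV: "integrable P (\<lambda>x. V x * g x)"
    proof (rule integrable_bounded)
      show "norm (V x * g x) \<le> c * b" for x
        unfolding real_norm_def abs_mult using Vb gb c by (intro mult_mono) auto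
    qed (simp add: V_def)
    have id: "integrable P (\<lambda>x. \<bar>H x - F' x\<bar>)"
      using H F'b by (intro integrable_abs Bochner_Integration.integrable_diff integrable_bounded[of _ 1]) auto
    have "\<bar>(\<integral>x. H x * W x * g x \<partial>P) - (\<integral>x. V x * g x \<partial>P)\<bar>
        = \<bar>\<integral>x. H x * W x * g x - V x * g x \<partial>P\<bar>" using iH iV by simp
    also have "\<dots> \<le> (\<integral>x. \<bar>H x * W x * g x - V x * g x\<bar> \<partial>P)" by (rule integral_abs_bound)
    also have "\<dots> \<le> (\<integral>x. \<bar>H x - F' x\<bar> * (c * b) \<partial>P)"
    proof (rule integral_mono)
      fix x
      have "\<bar>H x * W x * g x - V x * g x\<bar> = \<bar>H x - F' x\<bar> * (\<bar>W x\<bar> * \<bar>g x\<bar>)"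
        by (simp add: V_def abs_mult[symmetric] algebra_simps)
      also have "\<dots> \<le> \<bar>H x - F' x\<bar> * (c * b)"
        using Wb gb c by (intro mult_left_mono mult_mono) auto
      finally show "\<bar>H x * W x * g x - V x * g x\<bar> \<le> \<bar>H x - F' x\<bar> * (c * b)" .
    qed (use iH iV id in auto)
    also have "\<dots> = (c * b) * (\<integral>x. \<bar>H x - F' x\<bar> \<partial>P)" by simp
    also have "\<dots> \<le> (c * b) * d" using HF c b by (intro mult_left_mono) auto
    finally show ?thesis .
  qed
  have 1: "\<bar>(\<integral>x. H x * W x * G (x j) \<partial>P) - (\<integral>x. V x * G (x j) \<partial>P)\<bar> \<le> c * B * d"
    by (rule close) (use Gb in measurable)
  have 2: "\<bar>(\<integral>x. H x * W x \<partial>P) - (\<integral>x. V x \<partial>P)\<bar> \<le> c * d"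
    using close[of "\<lambda>_. 1" 1] by simp
  have EG: "\<bar>\<integral>x. G (x j) \<partial>P\<bar> \<le> B"
  proof -
    have "\<bar>\<integral>x. G (x j) \<partial>P\<bar> \<le> (\<integral>x. \<bar>G (x j)\<bar> \<partial>P)" by (rule integral_abs_bound)
    also have "\<dots> \<le> (\<integral>x. B \<partial>P)"
      using Gb B by (intro integral_mono integrable_abs integrable_bounded[of _ B]) auto
    finally show ?thesis by simp
  qed
  have "\<bar>(\<integral>x. H x * W x \<partial>P) * (\<integral>x. G (x j) \<partial>P) - (\<integral>x. V x \<partial>P) * (\<integral>x. G (x j) \<partial>P)\<bar>
      = \<bar>(\<integral>x. H x * W x \<partial>P) - (\<integral>x. V x \<partial>P)\<bar> * \<bar>\<integral>x. G (x j) \<partial>P\<bar>"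
    by (simp add: abs_mult[symmetric] left_diff_distrib)
  also have "\<dots> \<le> c * d * B" using 2 EG c d by (intro mult_mono) auto
  finally have 3: "\<bar>(\<integral>x. H x * W x \<partial>P) * (\<integral>x. G (x j) \<partial>P) - (\<integral>x. V x \<partial>P) * (\<integral>x. G (x j) \<partial>P)\<bar> \<le> c * d * B" .
  have "c * B * d + c * d * B \<le> 2 * (c * B + 1) * d"
    using d by (simp add: algebra_simps)
  also have "\<dots> = e"
  proof -
    have "c * B + 1 \<noteq> 0" using mult_nonneg_nonneg[OF c B] by linarith
    then show ?thesis by (simp add: d_def)
  qed
  finally show "\<bar>(\<integral>x. H x * W x * G (x j) \<partial>P) - (\<integral>x. H x * W x \<partial>P) * (\<integral>x. G (x j) \<partial>P)\<bar> \<le> c * r + e"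
    using main 1 3 by linarith
qed

end

section \<open>Summable covariances for Lipschitz functions of the field\<close>

lemma lipschitz_1_measurable:
  fixes G :: "real \<Rightarrow> real"
  shows "1-lipschitz_on UNIV G \<Longrightarrow> G \<in> borel_measurable borel"
  by (intro borel_measurable_continuous_onI lipschitz_on_continuous_on)

text \<open>
  For \<open>m = max a b\<close> one has \<open>a * b \<le> m\<^sup>2\<close>, and \<open>m \<ge> c\<close> makes \<open>m\<^sup>2\<close> at most
  \<open>c powr - \<delta> * m powr (2 + \<delta>)\<close>.
\<close>

lemma product_tail_le:
  fixes a b c \<delta> :: real
  assumes "0 < c" "c < a" "0 \<le> b" "0 < \<delta>"
  shows "a * b \<le> c powr - \<delta> * (a powr (2 + \<delta>) + b powr (2 + \<delta>))"
proof -
  define m where "m = max a b"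
  have m: "0 < m" "c \<le> m" using assms by (auto simp: m_def)
  have "a * b \<le> m * m" using assms by (intro mult_mono) (auto simp: m_def)
  also have "\<dots> = m powr - \<delta> * m powr (2 + \<delta>)"
    using m by (simp add: powr_add[symmetric] power2_eq_square)
  also have "\<dots> \<le> c powr - \<delta> * (a powr (2 + \<delta>) + b powr (2 + \<delta>))"
  proof (intro mult_mono)
    show "m powr - \<delta> \<le> c powr - \<delta>" using assms m by (intro powr_mono2') auto
    show "m powr (2 + \<delta>) \<le> a powr (2 + \<delta>) + b powr (2 + \<delta>)" by (auto simp: m_def max_def)
  qed auto
  finally show ?thesis .
qed

locale theta_law = stationary_law P
  for P :: "(('m::{finite,linorder}) lattice \<Rightarrow> real) measure" +
  fixes C \<alpha> \<delta> :: real and h0 :: nat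
  assumes theta_le: "h0 \<le> h \<Longrightarrow> theta_lex P (\<lambda>t x. x t) h \<le> ennreal (C * real h powr - \<alpha>)"
    and C_nonneg: "0 \<le> C" and h0_pos: "1 \<le> h0"
    and \<delta>_pos: "0 < \<delta>" and \<alpha>_large: "real CARD('m) * (1 + 1 / \<delta>) < \<alpha>"
    and moment: "integrable P (\<lambda>x. \<bar>x 0\<bar> powr (2 + \<delta>))"
    and centred: "(\<integral>x. x 0 \<partial>P) = 0"
begin

lemma integral_coordinate:
  fixes f :: "real \<Rightarrow> 'b::{banach, second_countable_topology}"
  assumes [measurable]: "f \<in> borel_measurable borel"
  shows "(\<integral>x. f (x t) \<partial>P) = (\<integral>x. f (x 0) \<partial>P)"
  using integral_shift[of "\<lambda>x. f (x 0)" t] by (simp add: field_shift_def)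

lemma integrable_coordinate:
  fixes f :: "real \<Rightarrow> 'b::{banach, second_countable_topology}"
  assumes "integrable P (\<lambda>x. f (x 0))"
  shows "integrable P (\<lambda>x. f (x t))"
  using integrable_shift[OF assms, of t] by (simp add: field_shift_def)

definition \<mu> :: real where "\<mu> = (\<integral>x. \<bar>x 0\<bar> \<partial>P)"

text \<open>
  A function that dominates all the functions \<open>\<phi>\<close> of the field used below, see
  \<open>admissible_le_env\<close>; bounds in terms of it are uniform in \<open>\<phi>\<close>.
\<close>

definition env :: "real \<Rightarrow> real" where "env y = \<bar>y\<bar> + \<mu>"

definition env_moment :: real where "env_moment = (\<integral>x. env (x 0) powr (2 + \<delta>) \<partial>P)"

definition env_square :: real where "env_square = (\<integral>x. (env (x 0))\<^sup>2 \<partial>P)"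

lemma env_measurable [measurable]: "env \<in> borel_measurable borel"
  unfolding env_def[abs_def] by measurable

lemma \<mu>_nonneg: "0 \<le> \<mu>" by (simp add: \<mu>_def)

lemma env_nonneg: "0 \<le> env y" using \<mu>_nonneg by (simp add: env_def)

lemma integrable_abs_coordinate: "integrable P (\<lambda>x. \<bar>x t\<bar>)"
proof (rule integrable_coordinate[of abs])
  show "integrable P (\<lambda>x. \<bar>x 0\<bar>)"
  proof (rule Bochner_Integration.integrable_bound)
    show "integrable P (\<lambda>x. 1 + \<bar>x 0\<bar> powr (2 + \<delta>))" using moment by simp
    show "AE x in P. norm \<bar>x 0\<bar> \<le> norm (1 + \<bar>x 0\<bar> powr (2 + \<delta>))"
    proof (rule AE_I2)
      fix x :: "'m lattice \<Rightarrow> real"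
      show "norm \<bar>x 0\<bar> \<le> norm (1 + \<bar>x 0\<bar> powr (2 + \<delta>))"
      proof (cases "\<bar>x 0\<bar> \<le> 1")
        case False
        then have "\<bar>x 0\<bar> powr 1 \<le> \<bar>x 0\<bar> powr (2 + \<delta>)" using \<delta>_pos by (intro powr_mono) auto
        then show ?thesis using False by simp
      next
        case True
        moreover have "0 \<le> \<bar>x 0\<bar> powr (2 + \<delta>)" by simp
        ultimately show ?thesis by (smt (verit) real_norm_def)
      qed
    qed
  qed measurable
qed

lemma integrable_env_powr: "integrable P (\<lambda>x. env (x t) powr (2 + \<delta>))"
proof (rule integrable_coordinate[of "\<lambda>y. env y powr (2 + \<delta>)"])
  show "integrable P (\<lambda>x. env (x 0) powr (2 + \<delta>))"
  proof (rule Bochner_Integration.integrable_bound)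
    show "integrable P (\<lambda>x. 2 powr (2 + \<delta>) * (\<bar>x 0\<bar> powr (2 + \<delta>) + \<mu> powr (2 + \<delta>)))"
      using moment by simp
    show "AE x in P. norm (env (x 0) powr (2 + \<delta>))
        \<le> norm (2 powr (2 + \<delta>) * (\<bar>x 0\<bar> powr (2 + \<delta>) + \<mu> powr (2 + \<delta>)))"
    proof (rule AE_I2)
      fix x :: "'m lattice \<Rightarrow> real"
      have "env (x 0) powr (2 + \<delta>) \<le> (2 * max \<bar>x 0\<bar> \<mu>) powr (2 + \<delta>)"
        using \<delta>_pos \<mu>_nonneg by (intro powr_mono2) (auto simp: env_def)
      also have "\<dots> = 2 powr (2 + \<delta>) * max \<bar>x 0\<bar> \<mu> powr (2 + \<delta>)"
        using \<mu>_nonneg by (simp add: powr_mult)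
      also have "\<dots> \<le> 2 powr (2 + \<delta>) * (\<bar>x 0\<bar> powr (2 + \<delta>) + \<mu> powr (2 + \<delta>))"
        by (intro mult_left_mono) (auto simp: max_def)
      finally show "norm (env (x 0) powr (2 + \<delta>))
        \<le> norm (2 powr (2 + \<delta>) * (\<bar>x 0\<bar> powr (2 + \<delta>) + \<mu> powr (2 + \<delta>)))" by simp
    qed
  qed measurable
qed

lemma integrable_env_square: "integrable P (\<lambda>x. (env (x t))\<^sup>2)"
proof (rule Bochner_Integration.integrable_bound)
  show "integrable P (\<lambda>x. 1 + env (x t) powr (2 + \<delta>))" using integrable_env_powr by simp
  show "AE x in P. norm ((env (x t))\<^sup>2) \<le> norm (1 + env (x t) powr (2 + \<delta>))"
  proof (rule AE_I2)
    fix x :: "'m lattice \<Rightarrow> real"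
    define e where "e = env (x t)"
    have e: "0 \<le> e" by (simp add: e_def env_nonneg)
    have "e\<^sup>2 \<le> 1 + e powr (2 + \<delta>)"
    proof (cases "e \<le> 1")
      case True
      then have "e\<^sup>2 \<le> 1" using e by (simp add: power_le_one)
      moreover have "0 \<le> e powr (2 + \<delta>)" by simp
      ultimately show ?thesis by linarith
    next
      case False
      then have "e powr 2 \<le> e powr (2 + \<delta>)" using \<delta>_pos by (intro powr_mono) auto
      then show ?thesis using False by simp
    qed
    then show "norm ((env (x t))\<^sup>2) \<le> norm (1 + env (x t) powr (2 + \<delta>))"
      by (simp add: e_def)
  qed
qed measurable

lemma integral_env_powr: "(\<integral>x. env (x t) powr (2 + \<delta>) \<partial>P) = env_moment"
  unfolding env_moment_def by (rule integral_coordinate) measurable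

lemma integral_env_square: "(\<integral>x. (env (x t))\<^sup>2 \<partial>P) = env_square"
  unfolding env_square_def by (rule integral_coordinate) measurable

lemma env_moment_nonneg: "0 \<le> env_moment" unfolding env_moment_def by simp
lemma env_square_nonneg: "0 \<le> env_square" unfolding env_square_def by simp

text \<open>
  The identity, the centred truncations and the remainders of the truncation are all of this kind, so
  one covariance bound serves the field, its bounded part and its negligible part.
\<close>

definition admissible :: "(real \<Rightarrow> real) \<Rightarrow> bool" where
  "admissible \<phi> \<longleftrightarrow> 1-lipschitz_on UNIV \<phi> \<and> (\<integral>x. \<phi> (x 0) \<partial>P) = 0"

lemma admissible_measurable: "admissible \<phi> \<Longrightarrow> \<phi> \<in> borel_measurable borel"
  unfolding admissible_def by (blast intro: lipschitz_1_measurable)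

lemma integrable_lipschitz_coordinate:
  fixes \<phi> :: "real \<Rightarrow> real"
  assumes "1-lipschitz_on UNIV \<phi>"
  shows "integrable P (\<lambda>x. \<phi> (x t))"
proof (rule Bochner_Integration.integrable_bound)
  have [measurable]: "\<phi> \<in> borel_measurable borel" by (rule lipschitz_1_measurable[OF assms])
  show "integrable P (\<lambda>x. \<bar>x t\<bar> + \<bar>\<phi> 0\<bar>)" using integrable_abs_coordinate by simp
  show "AE x in P. norm (\<phi> (x t)) \<le> norm (\<bar>x t\<bar> + \<bar>\<phi> 0\<bar>)"
  proof (rule AE_I2)
    fix x :: "'m lattice \<Rightarrow> real"
    show "norm (\<phi> (x t)) \<le> norm (\<bar>x t\<bar> + \<bar>\<phi> 0\<bar>)"
      using lipschitz_onD[OF assms, of "x t" 0] by (simp add: dist_real_def)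
  qed
  show "(\<lambda>x. \<phi> (x t)) \<in> borel_measurable P" by measurable
qed

text \<open>
  Since \<open>\<phi> (x 0)\<close> has mean zero, the Lipschitz bound gives \<open>\<bar>\<phi> 0\<bar> \<le> \<integral>\<bar>x 0\<bar>\<close>.
\<close>

lemma admissible_le_env:
  assumes "admissible \<phi>"
  shows "\<bar>\<phi> y\<bar> \<le> env y"
proof -
  have L: "1-lipschitz_on UNIV \<phi>" and 0: "(\<integral>x. \<phi> (x 0) \<partial>P) = 0"
    using assms by (auto simp: admissible_def)
  note i = integrable_lipschitz_coordinate[OF L, of 0]
  have "\<bar>\<phi> 0\<bar> = \<bar>\<integral>x. \<phi> 0 - \<phi> (x 0) \<partial>P\<bar>" using i 0 by simp
  also have "\<dots> \<le> (\<integral>x. \<bar>\<phi> 0 - \<phi> (x 0)\<bar> \<partial>P)" by (rule integral_abs_bound)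
  also have "\<dots> \<le> \<mu>" unfolding \<mu>_def
  proof (rule integral_mono)
    show "\<bar>\<phi> 0 - \<phi> (x 0)\<bar> \<le> \<bar>x 0\<bar>" for x
      using lipschitz_onD[OF L, of 0 "x 0"] by (simp add: dist_real_def)
  qed (use i integrable_abs_coordinate in auto)
  finally have "\<bar>\<phi> 0\<bar> \<le> \<mu>" .
  then show ?thesis
    using lipschitz_onD[OF L, of y 0] by (simp add: dist_real_def env_def)
qed

lemma integrable_mult_env:
  assumes m: "f \<in> borel_measurable borel" and bd: "\<And>x. \<bar>f x\<bar> \<le> env (x s) * env (x t)"
  shows "integrable P f"
proof (rule Bochner_Integration.integrable_bound)
  show "integrable P (\<lambda>x. (env (x s))\<^sup>2 + (env (x t))\<^sup>2)"
    using integrable_env_square by simp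
  show "AE x in P. norm (f x) \<le> norm ((env (x s))\<^sup>2 + (env (x t))\<^sup>2)"
  proof (rule AE_I2)
    fix x
    have "0 \<le> (env (x s) - env (x t))\<^sup>2 + (env (x s))\<^sup>2 + (env (x t))\<^sup>2" by simp
    then have "2 * (env (x s) * env (x t)) \<le> 2 * ((env (x s))\<^sup>2 + (env (x t))\<^sup>2)"
      by (simp add: power2_diff algebra_simps)
    then show "norm (f x) \<le> norm ((env (x s))\<^sup>2 + (env (x t))\<^sup>2)" using bd[of x] by simp
  qed
qed (use m measurable_P in simp)

lemma integral_mult_env_le:
  assumes m: "f \<in> borel_measurable borel" and bd: "\<And>x. \<bar>f x\<bar> \<le> env (x s) * env (x t)"
  shows "\<bar>\<integral>x. f x \<partial>P\<bar> \<le> env_square"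
proof -
  have "\<bar>\<integral>x. f x \<partial>P\<bar> \<le> (\<integral>x. \<bar>f x\<bar> \<partial>P)" by (rule integral_abs_bound)
  also have "\<dots> \<le> (\<integral>x. ((env (x s))\<^sup>2 + (env (x t))\<^sup>2) / 2 \<partial>P)"
  proof (rule integral_mono)
    show "integrable P (\<lambda>x. \<bar>f x\<bar>)" using integrable_mult_env[OF m bd] by simp
    show "integrable P (\<lambda>x. ((env (x s))\<^sup>2 + (env (x t))\<^sup>2) / 2)"
      using integrable_env_square by simp
    fix x
    have "0 \<le> (env (x s) - env (x t))\<^sup>2" by simp
    then show "\<bar>f x\<bar> \<le> ((env (x s))\<^sup>2 + (env (x t))\<^sup>2) / 2"
      using bd[of x] by (simp add: power2_diff)
  qed
  also have "\<dots> = env_square" using integrable_env_square by (simp add: integral_env_square)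
  finally show ?thesis .
qed

text \<open>
  The coefficients test bounded functions \<open>G\<close> only. The bound for \<open>\<phi>\<close> is the limit of the bounds for
  its truncations, which have the same Lipschitz constant.
\<close>

lemma cov_invariant_admissible_le:
  assumes \<phi>: "admissible \<phi>" and \<Gamma>: "finite \<Gamma>" "\<Gamma> \<subseteq> lex_past_dist j h" and h: "h0 \<le> h"
    and W: "cylinder \<Gamma> W" and Wb: "\<And>x. \<bar>W x\<bar> \<le> c"
    and H: "H \<in> borel_measurable \<I>" "\<And>x. \<bar>H x\<bar> \<le> 1"
  shows "\<bar>\<integral>x. H x * W x * \<phi> (x j) \<partial>P\<bar> \<le> c * (C * real h powr - \<alpha>)"
proof -
  have c: "0 \<le> c" using Wb[of undefined] by linarith
  have L: "1-lipschitz_on UNIV \<phi>" using \<phi> by (simp add: admissible_def)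
  have [measurable]: "\<phi> \<in> borel_measurable borel" by (rule admissible_measurable[OF \<phi>])
  have [measurable]: "W \<in> borel_measurable borel" using W by (rule cylinder_measurable)
  have [measurable]: "H \<in> borel_measurable borel" using H by (intro measurable_\<I>_borel)
  define G where "G n y = max (- real n) (min (real n) (\<phi> y))" for n y
  have GL: "1-lipschitz_on UNIV (G n)" for n
    unfolding G_def by (rule truncation_1_lipschitz[OF L])
  have [measurable]: "G n \<in> borel_measurable borel" for n by (rule lipschitz_1_measurable[OF GL])
  have Gb: "\<bar>G n y\<bar> \<le> real n" "\<bar>G n y\<bar> \<le> \<bar>\<phi> y\<bar>" for n y by (auto simp: G_def max_def min_def)
  have Glim: "(\<lambda>n. G n y) \<longlonglongrightarrow> \<phi> y" for y
  proof (rule tendsto_eventually)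
    obtain N :: nat where "\<bar>\<phi> y\<bar> \<le> real N" using real_arch_simple by blast
    then have "G n y = \<phi> y" if "n \<ge> N" for n
      using that unfolding G_def by (simp add: max_def min_def abs_le_iff)
    then show "\<forall>\<^sub>F n in sequentially. G n y = \<phi> y" by (auto simp: eventually_sequentially)
  qed
  have i\<phi>: "integrable P (\<lambda>x. \<bar>\<phi> (x j)\<bar>)" using integrable_lipschitz_coordinate[OF L] by simp
  have HW: "\<bar>H x * W x\<bar> \<le> c" for x
    unfolding abs_mult using mult_mono[OF H(2)[of x] Wb[of x]] by simp
  have l1: "(\<lambda>n. \<integral>x. H x * W x * G n (x j) \<partial>P) \<longlonglongrightarrow> (\<integral>x. H x * W x * \<phi> (x j) \<partial>P)"
  proof (rule integral_dominated_convergence[where w = "\<lambda>x. c * \<bar>\<phi> (x j)\<bar>"])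
    show "AE x in P. (\<lambda>n. H x * W x * G n (x j)) \<longlonglongrightarrow> H x * W x * \<phi> (x j)"
      by (intro AE_I2 tendsto_intros Glim)
    show "AE x in P. norm (H x * W x * G n (x j)) \<le> c * \<bar>\<phi> (x j)\<bar>" for n
    proof (rule AE_I2)
      fix x show "norm (H x * W x * G n (x j)) \<le> c * \<bar>\<phi> (x j)\<bar>"
        unfolding real_norm_def abs_mult[of "H x * W x"] using HW Gb c by (intro mult_mono) auto
    qed
  qed (use i\<phi> in auto)
  have l2: "(\<lambda>n. \<integral>x. G n (x j) \<partial>P) \<longlonglongrightarrow> (\<integral>x. \<phi> (x j) \<partial>P)"
  proof (rule integral_dominated_convergence[where w = "\<lambda>x. \<bar>\<phi> (x j)\<bar>"])
    show "AE x in P. (\<lambda>n. G n (x j)) \<longlonglongrightarrow> \<phi> (x j)" by (intro AE_I2 Glim)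
    show "AE x in P. norm (G n (x j)) \<le> \<bar>\<phi> (x j)\<bar>" for n
      by (rule AE_I2) (simp add: Gb)
  qed (use i\<phi> in auto)
  have "(\<integral>x. \<phi> (x j) \<partial>P) = 0"
    using integral_coordinate[of \<phi> j] \<phi> by (simp add: admissible_def)
  with l2 have l2: "(\<lambda>n. \<integral>x. G n (x j) \<partial>P) \<longlonglongrightarrow> 0" by simp
  have "(\<lambda>n. \<bar>(\<integral>x. H x * W x * G n (x j) \<partial>P) - (\<integral>x. H x * W x \<partial>P) * (\<integral>x. G n (x j) \<partial>P)\<bar>)
      \<longlonglongrightarrow> \<bar>(\<integral>x. H x * W x * \<phi> (x j) \<partial>P) - (\<integral>x. H x * W x \<partial>P) * 0\<bar>"
    by (intro tendsto_intros l1 l2)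
  then have "\<bar>(\<integral>x. H x * W x * \<phi> (x j) \<partial>P) - (\<integral>x. H x * W x \<partial>P) * 0\<bar> \<le> c * (C * real h powr - \<alpha>)"
    by (rule LIMSEQ_le_const2)
       (use cov_invariant_cylinder_le[OF \<Gamma> W Wb H GL Gb(1) theta_le[OF h]] C_nonneg in auto)
  then show ?thesis by simp
qed

text \<open>
  The decay rate of the covariances. It exceeds the dimension exactly because
  \<open>\<alpha> > m (1 + 1 / \<delta>)\<close>.
\<close>

definition \<beta> :: real where "\<beta> = \<alpha> * \<delta> / (1 + \<delta>)"

lemma \<beta>_gt: "real CARD('m) < \<beta>"
  using \<alpha>_large \<delta>_pos by (simp add: \<beta>_def field_simps)

lemma \<beta>_pos: "0 < \<beta>" using \<beta>_gt by (meson less_trans of_nat_0_less_iff zero_less_card_finite)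

lemma \<alpha>_gt: "real CARD('m) < \<alpha>"
proof -
  have "real CARD('m) * 1 \<le> real CARD('m) * (1 + 1 / \<delta>)"
    using \<delta>_pos by (intro mult_left_mono) auto
  then show ?thesis using \<alpha>_large unfolding mult_1_right by (rule order.strict_trans1)
qed

text \<open>
  The summands \<open>C\<close> and \<open>2 * env_moment\<close> are the two contributions of \<open>covariance_split_le\<close>; the last
  one covers the distances below \<open>h0\<close>, where the coefficients may be infinite.
\<close>

definition cov_bound :: "'m lattice \<Rightarrow> real" where
  "cov_bound k = (C + 2 * env_moment + env_square * real h0 powr \<beta>) * real_of_int (max 1 (sup_norm k)) powr - \<beta>"

lemma cov_bound_nonneg: "0 \<le> cov_bound k"
  unfolding cov_bound_def using C_nonneg env_moment_nonneg env_square_nonneg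
  by (intro mult_nonneg_nonneg add_nonneg_nonneg) auto

lemma cov_bound_summable: "cov_bound summable_on UNIV"
  unfolding cov_bound_def by (intro summable_on_cmult_right summable_on_sup_norm_powr \<beta>_gt)

text \<open>
  The value of \<open>\<phi>\<close> at the earlier point is cut off at level \<open>c\<close>: the bounded part is controlled by
  \<open>\<theta>\<close>, the rest by the moment of order \<open>2 + \<delta>\<close>.
\<close>

lemma covariance_split_le:
  assumes \<phi>: "admissible \<phi>" and k: "k \<in> lex_past_dist 0 h" and h: "h0 \<le> h" and c: "0 < c"
    and H: "H \<in> borel_measurable \<I>" "\<And>x. \<bar>H x\<bar> \<le> 1"
  shows "\<bar>\<integral>x. H x * (\<phi> (x k) * \<phi> (x 0)) \<partial>P\<bar> \<le> c * (C * real h powr - \<alpha>) + c powr - \<delta> * (2 * env_moment)"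
proof -
  have [measurable]: "\<phi> \<in> borel_measurable borel" by (rule admissible_measurable[OF \<phi>])
  have [measurable]: "H \<in> borel_measurable borel" using H by (intro measurable_\<I>_borel)
  note env = admissible_le_env[OF \<phi>]
  \<comment> \<open>the bounded part of the earlier variable; it depends on one coordinate\<close>
  define W where "W x = (if \<bar>\<phi> (x k)\<bar> \<le> c then \<phi> (x k) else 0)" for x :: "'m lattice \<Rightarrow> real"
  have Wm [measurable]: "W \<in> borel_measurable borel" unfolding W_def by measurable
  have W: "cylinder {k} W" unfolding cylinder_def using Wm by (auto simp: W_def)
  have Wb: "\<bar>W x\<bar> \<le> c" for x using c by (simp add: W_def)
  have W\<phi>: "\<bar>W x\<bar> \<le> \<bar>\<phi> (x k)\<bar>" for x by (simp add: W_def)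
  have near: "\<bar>\<integral>x. H x * W x * \<phi> (x 0) \<partial>P\<bar> \<le> c * (C * real h powr - \<alpha>)"
    by (rule cov_invariant_admissible_le[OF \<phi> _ _ h W Wb H]) (use k in auto)
  have le1: "\<bar>H x * W x * \<phi> (x 0)\<bar> \<le> env (x k) * env (x 0)" for x
  proof -
    have "\<bar>H x\<bar> * \<bar>W x\<bar> * \<bar>\<phi> (x 0)\<bar> \<le> (1 * env (x k)) * env (x 0)"
      using H(2) W\<phi>[of x] env[of "x k"] env[of "x 0"] env_nonneg by (intro mult_mono) auto
    then show ?thesis by (simp add: abs_mult)
  qed
  have i1: "integrable P (\<lambda>x. H x * W x * \<phi> (x 0))"
    by (rule integrable_mult_env[OF _ le1]) measurable
  have le2: "\<bar>H x * (\<phi> (x k) * \<phi> (x 0))\<bar> \<le> env (x k) * env (x 0)" for x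
  proof -
    have "\<bar>H x\<bar> * (\<bar>\<phi> (x k)\<bar> * \<bar>\<phi> (x 0)\<bar>) \<le> 1 * (env (x k) * env (x 0))"
      using H(2) env[of "x k"] env[of "x 0"] env_nonneg by (intro mult_mono) auto
    then show ?thesis by (simp add: abs_mult)
  qed
  have i2: "integrable P (\<lambda>x. H x * (\<phi> (x k) * \<phi> (x 0)))"
    by (rule integrable_mult_env[OF _ le2]) measurable
  have far: "\<bar>H x * (\<phi> (x k) * \<phi> (x 0)) - H x * W x * \<phi> (x 0)\<bar>
      \<le> c powr - \<delta> * (env (x k) powr (2 + \<delta>) + env (x 0) powr (2 + \<delta>))" for x
  proof (cases "\<bar>\<phi> (x k)\<bar> \<le> c")
    case True
    then show ?thesis by (simp add: W_def)
  next
    case False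
    then have "c < env (x k)" using env[of "x k"] by simp
    from product_tail_le[OF c this env_nonneg[of "x 0"] \<delta>_pos]
    show ?thesis using False le2[of x] by (simp add: W_def)
  qed
  have "\<bar>(\<integral>x. H x * (\<phi> (x k) * \<phi> (x 0)) \<partial>P) - (\<integral>x. H x * W x * \<phi> (x 0) \<partial>P)\<bar>
      = \<bar>\<integral>x. H x * (\<phi> (x k) * \<phi> (x 0)) - H x * W x * \<phi> (x 0) \<partial>P\<bar>" using i1 i2 by simp
  also have "\<dots> \<le> (\<integral>x. \<bar>H x * (\<phi> (x k) * \<phi> (x 0)) - H x * W x * \<phi> (x 0)\<bar> \<partial>P)"
    by (rule integral_abs_bound)
  also have "\<dots> \<le> (\<integral>x. c powr - \<delta> * (env (x k) powr (2 + \<delta>) + env (x 0) powr (2 + \<delta>)) \<partial>P)"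
    by (rule integral_mono[OF _ _ far]) (use i1 i2 integrable_env_powr in auto)
  also have "\<dots> = c powr - \<delta> * (2 * env_moment)"
    using integrable_env_powr by (simp add: integral_env_powr)
  finally show ?thesis using near by linarith
qed

text \<open>
  At distance \<open>h\<close> the level \<open>c = h powr (\<alpha> / (1 + \<delta>))\<close> balances the two terms of the previous bound.
  It applies if \<open>k\<close> precedes \<open>0\<close>; otherwise shifting by \<open>- k\<close> exchanges the roles of the two points.
\<close>

lemma covariance_le_cov_bound:
  assumes \<phi>: "admissible \<phi>" and H: "H \<in> borel_measurable \<I>" "\<And>x. \<bar>H x\<bar> \<le> 1"
  shows "\<bar>\<integral>x. H x * (\<phi> (x 0) * \<phi> (x k)) \<partial>P\<bar> \<le> cov_bound k"
proof -
  have [measurable]: "\<phi> \<in> borel_measurable borel" by (rule admissible_measurable[OF \<phi>])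
  have [measurable]: "H \<in> borel_measurable borel" using H by (intro measurable_\<I>_borel)
  note env = admissible_le_env[OF \<phi>]
  show ?thesis
  proof (cases "sup_norm k < int h0")
    case True
    have "\<bar>H x * (\<phi> (x 0) * \<phi> (x k))\<bar> \<le> env (x 0) * env (x k)" for x
    proof -
      have "\<bar>H x\<bar> * (\<bar>\<phi> (x 0)\<bar> * \<bar>\<phi> (x k)\<bar>) \<le> 1 * (env (x 0) * env (x k))"
        using H(2) env[of "x k"] env[of "x 0"] env_nonneg by (intro mult_mono) auto
      then show ?thesis by (simp add: abs_mult)
    qed
    then have "\<bar>\<integral>x. H x * (\<phi> (x 0) * \<phi> (x k)) \<partial>P\<bar> \<le> env_square"
      by (intro integral_mult_env_le) measurable
    also have "\<dots> = env_square * real h0 powr \<beta> * real h0 powr - \<beta>"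
      using h0_pos by (simp add: powr_minus field_simps)
    also have "\<dots> \<le> cov_bound k" unfolding cov_bound_def
    proof (intro mult_mono)
      show "real h0 powr - \<beta> \<le> real_of_int (max 1 (sup_norm k)) powr - \<beta>"
        using True h0_pos \<beta>_pos by (intro powr_mono2') (auto simp del: of_int_max)
    qed (use C_nonneg env_moment_nonneg env_square_nonneg in auto)
    finally show ?thesis .
  next
    case False
    define h where "h = nat (sup_norm k)"
    have h: "h0 \<le> h" "1 \<le> h" "int h = sup_norm k" using False h0_pos by (auto simp: h_def)
    have hk: "real_of_int (max 1 (sup_norm k)) = real h" using h by auto
    have past: "\<bar>\<integral>x. H x * (\<phi> (x k') * \<phi> (x 0)) \<partial>P\<bar> \<le> cov_bound k"
      if k': "lex_less k' 0" "sup_norm k' = sup_norm k" for k'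
    proof -
      define c where "c = real h powr (\<alpha> / (1 + \<delta>))"
      have c: "0 < c" using h by (simp add: c_def)
      have "k' \<in> lex_past_dist 0 h"
        using k' h by (intro mem_lex_past_distI) (auto simp: sup_norm_minus)
      from covariance_split_le[OF \<phi> this h(1) c H]
      have "\<bar>\<integral>x. H x * (\<phi> (x k') * \<phi> (x 0)) \<partial>P\<bar>
         \<le> c * (C * real h powr - \<alpha>) + c powr - \<delta> * (2 * env_moment)" .
      also have "c * (C * real h powr - \<alpha>) = C * real h powr - \<beta>"
      proof -
        have "\<alpha> / (1 + \<delta>) + - \<alpha> = - \<beta>" using \<delta>_pos by (simp add: \<beta>_def field_simps)
        then show ?thesis unfolding c_def
          by (metis (no_types, lifting) mult.assoc mult.commute powr_add)
      qed
      also have "c powr - \<delta> = real h powr - \<beta>"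
        unfolding c_def powr_powr by (simp add: \<beta>_def)
      also have "C * real h powr - \<beta> + real h powr - \<beta> * (2 * env_moment) = (C + 2 * env_moment) * real h powr - \<beta>"
        by (simp add: algebra_simps)
      also have "\<dots> \<le> cov_bound k" unfolding cov_bound_def hk
        using env_square_nonneg by (intro mult_right_mono) auto
      finally show ?thesis .
    qed
    have "k \<noteq> 0" using h sup_norm_eq_0_iff[of k] by auto
    then consider "lex_less k 0" | "lex_less 0 k" using lex_less_total by blast
    then show ?thesis
    proof cases
      case 1
      then show ?thesis using past[of k] by (simp add: mult.commute)
    next
      case 2
      have "(\<integral>x. H x * (\<phi> (x 0) * \<phi> (x k)) \<partial>P)
          = (\<integral>x. H (field_shift (-k) x) * (\<phi> (field_shift (-k) x 0) * \<phi> (field_shift (-k) x k)) \<partial>P)"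
        by (rule integral_shift[symmetric, of "\<lambda>x. H x * (\<phi> (x 0) * \<phi> (x k))"]) measurable
      also have "\<dots> = (\<integral>x. H x * (\<phi> (x (-k)) * \<phi> (x 0)) \<partial>P)"
        unfolding \<I>_measurable_shift[OF H(1)] by (simp add: field_shift_def)
      finally show ?thesis
        using past[of "-k"] 2 by (simp add: lex_less_uminus_iff sup_norm_minus)
    qed
  qed
qed

text \<open>
  By stationarity every row of the covariance matrix of the summands is bounded by the same series.
\<close>

lemma second_moment_sum_le:
  assumes \<phi>: "admissible \<phi>" and A: "finite A"
    and \<kappa>: "\<kappa> summable_on UNIV" "\<And>k. \<bar>\<integral>x. \<phi> (x 0) * \<phi> (x k) \<partial>P\<bar> \<le> \<kappa> k"
  shows "integrable P (\<lambda>x. (\<Sum>i\<in>A. \<phi> (x i))\<^sup>2)"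
    and "(\<integral>x. (\<Sum>i\<in>A. \<phi> (x i))\<^sup>2 \<partial>P) \<le> real (card A) * infsum \<kappa> UNIV"
proof -
  have [measurable]: "\<phi> \<in> borel_measurable borel" by (rule admissible_measurable[OF \<phi>])
  note env = admissible_le_env[OF \<phi>]
  have i: "integrable P (\<lambda>x. \<phi> (x s) * \<phi> (x t))" for s t
  proof (rule integrable_mult_env)
    show "\<bar>\<phi> (x s) * \<phi> (x t)\<bar> \<le> env (x s) * env (x t)" for x
      unfolding abs_mult using env env_nonneg by (intro mult_mono) auto
  qed measurable
  have sq: "(\<Sum>i\<in>A. \<phi> (x i))\<^sup>2 = (\<Sum>i\<in>A. \<Sum>j\<in>A. \<phi> (x i) * \<phi> (x j))" for x
    by (simp add: power2_eq_square sum_product)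
  show "integrable P (\<lambda>x. (\<Sum>i\<in>A. \<phi> (x i))\<^sup>2)" unfolding sq using i by auto
  have nn: "0 \<le> \<kappa> k" for k using \<kappa>(2)[of k] by linarith
  have sh: "(\<integral>x. \<phi> (x i) * \<phi> (x j) \<partial>P) = (\<integral>x. \<phi> (x 0) * \<phi> (x (j - i)) \<partial>P)" for i j
    using integral_shift[of "\<lambda>x. \<phi> (x 0) * \<phi> (x (j - i))" i] by (simp add: field_shift_def)
  have "(\<integral>x. (\<Sum>i\<in>A. \<phi> (x i))\<^sup>2 \<partial>P) = (\<Sum>i\<in>A. \<Sum>j\<in>A. \<integral>x. \<phi> (x i) * \<phi> (x j) \<partial>P)"
    unfolding sq using i by simp
  also have "\<dots> \<le> (\<Sum>i\<in>A. \<Sum>j\<in>A. \<kappa> (j - i))"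
  proof (intro sum_mono)
    fix i j show "(\<integral>x. \<phi> (x i) * \<phi> (x j) \<partial>P) \<le> \<kappa> (j - i)"
      using \<kappa>(2)[of "j - i"] sh[of i j] by linarith
  qed
  also have "\<dots> \<le> (\<Sum>i\<in>A. infsum \<kappa> UNIV)"
  proof (rule sum_mono)
    fix i
    have "(\<Sum>j\<in>A. \<kappa> (j - i)) = (\<Sum>k\<in>(\<lambda>j. j - i) ` A. \<kappa> k)"
      by (subst sum.reindex) (auto simp: inj_on_def)
    also have "\<dots> \<le> infsum \<kappa> UNIV"
      using A nn by (intro finite_sum_le_infsum \<kappa>(1)) auto
    finally show "(\<Sum>j\<in>A. \<kappa> (j - i)) \<le> infsum \<kappa> UNIV" .
  qed
  finally show "(\<integral>x. (\<Sum>i\<in>A. \<phi> (x i))\<^sup>2 \<partial>P) \<le> real (card A) * infsum \<kappa> UNIV" by simp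
qed

end

section \<open>Lexicographic replacement for a bounded field\<close>

lemma exp_minus_taylor1:
  fixes y :: real
  assumes "0 \<le> y"
  shows "\<bar>exp (- y) - (1 - y)\<bar> \<le> y\<^sup>2 / 2"
proof -
  have lower: "1 - y \<le> exp (- y)" using exp_ge_add_one_self[of "-y"] by simp
  have q: "1 + y + y\<^sup>2 / 2 \<le> exp y" by (rule exp_lower_Taylor_quadratic[OF assms])
  have pos: "0 < 1 + y + y\<^sup>2 / 2" using assms by (simp add: add_pos_nonneg)
  have "1 \<le> (1 - y + y\<^sup>2 / 2) * (1 + y + y\<^sup>2 / 2)"
  proof -
    have "(1 - y + y\<^sup>2 / 2) * (1 + y + y\<^sup>2 / 2) = 1 + (y\<^sup>2)\<^sup>2 / 4"
      by (simp add: power2_eq_square field_simps)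
    then show ?thesis by simp
  qed
  then have "1 / (1 + y + y\<^sup>2 / 2) \<le> 1 - y + y\<^sup>2 / 2" using pos by (simp add: divide_le_eq)
  moreover have "exp (- y) \<le> 1 / (1 + y + y\<^sup>2 / 2)"
    using q pos by (simp add: exp_minus inverse_eq_divide frac_le)
  ultimately show ?thesis using lower by (simp add: abs_le_iff)
qed

lemma iexp_sub_1_le: "cmod (iexp y - 1) \<le> \<bar>y\<bar>"
  using iexp_approx1[of y 0] by simp

lemma iexp_taylor1: "cmod (iexp y - 1 - \<i> * y) \<le> y\<^sup>2 / 2"
  using iexp_approx1[of y 1] by (simp add: numeral_2_eq_2 diff_diff_eq)

lemma iexp_taylor2: "cmod (iexp y - 1 - \<i> * y + y\<^sup>2 / 2) \<le> \<bar>y\<bar> ^ 3 / 6"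
proof -
  have "(\<Sum>k\<le>2. (\<i> * complex_of_real y) ^ k / fact k) = 1 + \<i> * y - y\<^sup>2 / 2"
    by (simp add: numeral_2_eq_2 power_mult_distrib)
  then show ?thesis
    using iexp_approx1[of y 2] by (simp add: fact_numeral diff_diff_eq eval_nat_numeral algebra_simps)
qed

lemma norm_iexp [simp]: "cmod (iexp y) = 1"
  by (simp add: norm_exp_eq_Re)

lemma iexp_diff_le: "cmod (iexp y - iexp z) \<le> \<bar>y - z\<bar>"
proof -
  have "iexp y = iexp z * iexp (y - z)"
    by (simp add: exp_add[symmetric] right_diff_distrib)
  then have "iexp y - iexp z = iexp z * (iexp (y - z) - 1)"
    by (simp only: right_diff_distrib mult_1_right)
  then show ?thesis using iexp_sub_1_le[of "y - z"] by (simp add: norm_mult)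
qed

lemma exp_minus_diff_le:
  fixes y z :: real
  assumes "0 \<le> y" "0 \<le> z"
  shows "\<bar>exp (- y) - exp (- z)\<bar> \<le> \<bar>y - z\<bar>"
proof -
  have *: "\<bar>exp (- y) - exp (- z)\<bar> \<le> z - y" if "0 \<le> y" "y \<le> z" for y z :: real
  proof -
    have "exp (- y) - exp (- z) = exp (- y) * (1 - exp (- (z - y)))"
      by (simp add: right_diff_distrib exp_add[symmetric])
    also have "\<dots> \<le> 1 * (z - y)"
    proof (rule mult_mono)
      show "1 - exp (- (z - y)) \<le> z - y" using exp_ge_add_one_self[of "- (z - y)"] by linarith
    qed (use that in auto)
    finally show ?thesis using that by simp
  qed
  show ?thesis using *[of y z] *[of z y] assms by (cases "y \<le> z") (auto simp: abs_minus_commute)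
qed

text \<open>
  The algebra of the second order expansion; \<open>h\<close> stands for \<open>1/2\<close> and \<open>j\<close> for the imaginary unit.
\<close>

lemma expansion_identity:
  fixes w S a D D' e e1 e2 e3 h j :: complex
  assumes "2 * h = 1" "j * j = - 1"
  shows "w * ((1 + j * (S * a) - h * (S * a)\<^sup>2 + e1) - (1 - h * (S\<^sup>2 * e) + e2))
      - j * S * (w * (e3 + 1 - j * (S * D)) * a)
      + h * S\<^sup>2 * (w * (a\<^sup>2 + 2 * (a * D) + 2 * (a * D') - e))
    = w * (e1 - e2 - e3 * (j * (S * a)) + S\<^sup>2 * (a * D'))"
  using assms by algebra

definition past :: "('m::{finite,linorder}) lattice set \<Rightarrow> 'm lattice \<Rightarrow> 'm lattice set" where
  "past A k = {j \<in> A. lex_less j k}"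

text \<open>
  The positions, relative to a point, of its lexicographic predecessors up to distance \<open>M\<close>.
\<close>

definition near :: "nat \<Rightarrow> ('m::{finite,linorder}) lattice set" where
  "near M = {v. lex_less v 0 \<and> sup_norm v \<le> int M}"

lemma finite_past: "finite A \<Longrightarrow> finite (past A k)"
  by (simp add: past_def)

lemma card_past_less: "finite A \<Longrightarrow> k \<in> A \<Longrightarrow> card (past A k) < card A"
proof (rule psubset_card_mono)
  assume "k \<in> A"
  then have "k \<in> A - past A k" by (simp add: past_def lex_less_irrefl)
  then show "past A k \<subset> A" by (auto simp: past_def)
qed

lemma finite_near: "finite (near M)"
  by (rule finite_subset[OF _ finite_sup_norm_ball[of "int M"]]) (auto simp: near_def)

lemma past_eq_far_near:
  "past A k = {j \<in> past A k. int M < sup_norm (k - j)} \<union> (\<lambda>v. k + v) ` {v \<in> near M. k + v \<in> A}"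
proof (intro set_eqI iffI)
  fix j assume j: "j \<in> past A k"
  show "j \<in> {j \<in> past A k. int M < sup_norm (k - j)} \<union> (\<lambda>v. k + v) ` {v \<in> near M. k + v \<in> A}"
  proof (cases "int M < sup_norm (k - j)")
    case False
    have "j - k \<in> near M"
      using j False lex_less_0_iff[of k "j - k"]
      by (auto simp: near_def past_def sup_norm_minus_commute[of j k])
    then have "j - k \<in> {v \<in> near M. k + v \<in> A}" using j by (simp add: past_def)
    then have "k + (j - k) \<in> (\<lambda>v. k + v) ` {v \<in> near M. k + v \<in> A}" by (rule imageI)
    then show ?thesis by simp
  qed (use j in simp)
qed (auto simp: past_def near_def lex_less_0_iff)

context theta_law
begin

text \<open>
  Points are added in lexicographic order. In a sum where the points from \<open>k\<close> on have been replaced by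
  independent centred Gaussians with conditional variance \<open>\<eta>\<close>, the Gaussians contribute
  \<open>damping\<close> to the characteristic function. The point \<open>k\<close> itself is left out (hence \<open>Suc\<close>): its
  increment is split off as a factor. For \<open>k\<close> outside \<open>A\<close> the subtraction may be cut off at \<open>0\<close>, which
  keeps \<open>damping\<close> at most \<open>1\<close>.
\<close>

definition damping :: "(('m lattice \<Rightarrow> real) \<Rightarrow> real) \<Rightarrow> real \<Rightarrow> 'm lattice set \<Rightarrow> 'm lattice \<Rightarrow>
     ('m lattice \<Rightarrow> real) \<Rightarrow> real" where
  "damping \<eta> s A k x = exp (- (s\<^sup>2 * real (card A - Suc (card (past A k))) * \<eta> x / 2))"

definition weight ::
    "(real \<Rightarrow> real) \<Rightarrow> (('m lattice \<Rightarrow> real) \<Rightarrow> real) \<Rightarrow> real \<Rightarrow> 'm lattice set \<Rightarrow> 'm lattice \<Rightarrow>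
     ('m lattice \<Rightarrow> real) \<Rightarrow> complex" where
  "weight \<phi> \<eta> s A k x = of_real (damping \<eta> s A k x) * iexp (s * (\<Sum>j\<in>past A k. \<phi> (x j)))"

text \<open>
  Its conditional expectation given the invariant events is the sum, up to distance \<open>M\<close>, of the
  conditional covariances of \<open>\<phi> (x 0)\<close> and \<open>\<phi> (x k)\<close>.
\<close>

definition local_variance :: "(real \<Rightarrow> real) \<Rightarrow> nat \<Rightarrow> ('m lattice \<Rightarrow> real) \<Rightarrow> real" where
  "local_variance \<phi> M x = (\<phi> (x 0))\<^sup>2 + 2 * (\<Sum>v\<in>near M. \<phi> (x 0) * \<phi> (x v))"

definition rate :: "'m lattice \<Rightarrow> real" where
  "rate k = C * real_of_int (max 1 (sup_norm k)) powr - \<alpha>"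

lemma rate_nonneg: "0 \<le> rate k"
  by (simp add: rate_def C_nonneg)

lemma rate_summable: "rate summable_on S"
proof -
  have "rate summable_on UNIV"
    unfolding rate_def by (intro summable_on_cmult_right summable_on_sup_norm_powr \<alpha>_gt)
  then show ?thesis by (rule summable_on_subset_banach) simp
qed

lemma weight_measurable [measurable]:
  assumes [measurable]: "\<phi> \<in> borel_measurable borel" "\<eta> \<in> borel_measurable borel"
  shows "weight \<phi> \<eta> s A k \<in> borel_measurable borel"
  unfolding weight_def[abs_def] damping_def by measurable

lemma norm_weight_le: "0 \<le> \<eta> x \<Longrightarrow> cmod (weight \<phi> \<eta> s A k x) \<le> 1"
  by (simp add: weight_def damping_def norm_mult)

lemma local_variance_measurable [measurable]:
  assumes [measurable]: "\<phi> \<in> borel_measurable borel"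
  shows "local_variance \<phi> M \<in> borel_measurable borel"
  unfolding local_variance_def[abs_def] by measurable

lemma local_variance_bounded:
  assumes "\<And>y. \<bar>\<phi> y\<bar> \<le> B"
  shows "\<bar>local_variance \<phi> M x\<bar> \<le> B\<^sup>2 + 2 * (real (card (near M :: 'm lattice set)) * B\<^sup>2)"
proof -
  have B: "0 \<le> B" using assms[of 0] by linarith
  have p: "\<bar>\<phi> y * \<phi> z\<bar> \<le> B\<^sup>2" for y z
    unfolding abs_mult power2_eq_square using assms B by (intro mult_mono) auto
  have "\<bar>\<Sum>v\<in>near M. \<phi> (x 0) * \<phi> (x v)\<bar> \<le> (\<Sum>v\<in>(near M :: 'm lattice set). B\<^sup>2)"
    by (rule order_trans[OF sum_abs sum_mono]) (rule p)
  then have s: "\<bar>\<Sum>v\<in>near M. \<phi> (x 0) * \<phi> (x v)\<bar> \<le> real (card (near M :: 'm lattice set)) * B\<^sup>2"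
    by simp
  have sq: "(\<phi> (x 0))\<^sup>2 \<le> B\<^sup>2" using p[of "x 0" "x 0"] by (simp add: power2_eq_square)
  show ?thesis
    unfolding local_variance_def abs_le_iff
    using abs_le_D1[OF s] abs_le_D2[OF s] sq zero_le_power2[of "\<phi> (x 0)"] zero_le_power2[of B]
    by (intro conjI) linarith+
qed

text \<open>
  Multiplying \<open>W\<close> by a complex number of modulus \<open>1\<close> makes the integral real and nonnegative, so the
  real bound carries over with the same constant.
\<close>

lemma cov_invariant_admissible_complex_le:
  fixes W :: "('m lattice \<Rightarrow> real) \<Rightarrow> complex"
  assumes \<phi>: "admissible \<phi>" and \<Gamma>: "finite \<Gamma>" "\<Gamma> \<subseteq> lex_past_dist j h" and h: "h0 \<le> h"
    and W: "cylinder \<Gamma> W" and Wb: "\<And>x. cmod (W x) \<le> c"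
    and H: "H \<in> borel_measurable \<I>" "\<And>x. \<bar>H x\<bar> \<le> 1"
  shows "cmod (\<integral>x. of_real (H x) * W x * of_real (\<phi> (x j)) \<partial>P) \<le> c * (C * real h powr - \<alpha>)"
proof -
  define I where "I = (\<integral>x. of_real (H x) * W x * of_real (\<phi> (x j)) \<partial>P)"
  have [measurable]: "\<phi> \<in> borel_measurable borel" by (rule admissible_measurable[OF \<phi>])
  have [measurable]: "W \<in> borel_measurable borel" using W by (rule cylinder_measurable)
  have [measurable]: "H \<in> borel_measurable borel" using H by (intro measurable_\<I>_borel)
  have c: "0 \<le> c" using Wb[of undefined] norm_ge_zero[of "W undefined"] by linarith
  have i: "integrable P (\<lambda>x. of_real (H x) * W x * of_real (\<phi> (x j)))"
  proof (rule Bochner_Integration.integrable_bound)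
    show "integrable P (\<lambda>x. c * \<bar>\<phi> (x j)\<bar>)"
      using \<phi> integrable_lipschitz_coordinate[of \<phi> j] by (simp add: admissible_def)
    show "AE x in P. norm (of_real (H x) * W x * of_real (\<phi> (x j))) \<le> norm (c * \<bar>\<phi> (x j)\<bar>)"
    proof (rule AE_I2)
      fix x
      have "\<bar>H x\<bar> * cmod (W x) * \<bar>\<phi> (x j)\<bar> \<le> (1 * c) * \<bar>\<phi> (x j)\<bar>"
        using H(2) Wb c by (intro mult_right_mono mult_mono) auto
      then show "norm (of_real (H x) * W x * of_real (\<phi> (x j))) \<le> norm (c * \<bar>\<phi> (x j)\<bar>)"
        using c by (simp add: norm_mult abs_mult)
    qed
  qed measurable
  show ?thesis
  proof (cases "I = 0")
    case True
    then show ?thesis using c C_nonneg by (simp add: I_def)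
  next
    case False
    define z where "z = cnj I / of_real (cmod I)"
    have z: "cmod z = 1" using False by (simp add: z_def norm_divide)
    have "z * I = of_real (cmod I)"
      using False by (simp add: z_def complex_norm_square[symmetric] power2_eq_square mult.commute)
    then have "cmod I = Re (z * I)" by simp
    also have "z * I = (\<integral>x. z * (of_real (H x) * W x * of_real (\<phi> (x j))) \<partial>P)"
      unfolding I_def by simp
    also have "Re \<dots> = (\<integral>x. Re (z * (of_real (H x) * W x * of_real (\<phi> (x j)))) \<partial>P)"
      using i by (intro integral_Re[symmetric]) simp
    also have "\<dots> = (\<integral>x. H x * Re (z * W x) * \<phi> (x j) \<partial>P)"
      by (intro Bochner_Integration.integral_cong) (auto simp: algebra_simps)
    also have "\<dots> \<le> \<bar>\<integral>x. H x * Re (z * W x) * \<phi> (x j) \<partial>P\<bar>" by simp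
    also have "\<dots> \<le> c * (C * real h powr - \<alpha>)"
    proof (rule cov_invariant_admissible_le[OF \<phi> \<Gamma> h _ _ H])
      show "cylinder \<Gamma> (\<lambda>x. Re (z * W x))"
        by (rule cylinder_comp[OF W, of "\<lambda>w. Re (z * w)"]) measurable
      show "\<bar>Re (z * W x)\<bar> \<le> c" for x
        using abs_Re_le_cmod[of "z * W x"] Wb[of x] by (simp add: norm_mult z)
    qed
    finally show ?thesis by (simp add: I_def)
  qed
qed

text \<open>
  The points of \<open>Q\<close> are removed one at a time, nearest first. Removing \<open>j\<close> changes the exponential by
  a factor that is small, of order \<open>s B\<close>, and that depends on points at distance at least
  \<open>\<bar>k - j\<bar>\<close> only, so it costs \<open>s B \<theta>(\<bar>k - j\<bar>)\<close>.
\<close>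

lemma far_past_le:
  assumes \<phi>: "admissible \<phi>" and \<phi>B: "\<And>y. \<bar>\<phi> y\<bar> \<le> B"
    and H: "H \<in> borel_measurable \<I>" "\<And>x. \<bar>H x\<bar> \<le> 1"
    and Q: "finite Q" "\<And>j. j \<in> Q \<Longrightarrow> lex_less j k" "\<And>j. j \<in> Q \<Longrightarrow> int h0 \<le> sup_norm (k - j)"
  shows "cmod (\<integral>x. of_real (H x) * iexp (s * (\<Sum>j\<in>Q. \<phi> (x j))) * of_real (\<phi> (x k)) \<partial>P)
     \<le> \<bar>s\<bar> * B * (\<Sum>j\<in>Q. rate (k - j))"
  using Q
proof (induction "card Q" arbitrary: Q)
  case 0
  then have Q: "Q = {}" by simp
  have "cmod (\<integral>x. of_real (H x) * 1 * of_real (\<phi> (x k)) \<partial>P) \<le> 1 * (C * real h powr - \<alpha>)"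
    if "h0 \<le> h" for h
    by (rule cov_invariant_admissible_complex_le[OF \<phi> finite.emptyI _ that _ _ H]) (auto simp: cylinder_def)
  then have "\<forall>\<^sub>F h in sequentially.
      cmod (\<integral>x. of_real (H x) * 1 * of_real (\<phi> (x k)) \<partial>P) \<le> 1 * (C * real h powr - \<alpha>)"
    unfolding eventually_sequentially by blast
  moreover have "(\<lambda>h. 1 * (C * real h powr - \<alpha>)) \<longlonglongrightarrow> 1 * (C * 0)"
  proof (intro tendsto_intros)
    have "0 < \<alpha>" using \<alpha>_gt by (meson less_trans of_nat_0_less_iff zero_less_card_finite)
    then show "(\<lambda>h. real h powr - \<alpha>) \<longlonglongrightarrow> 0"
      by (intro tendsto_neg_powr filterlim_real_sequentially) simp
  qed
  ultimately have "cmod (\<integral>x. of_real (H x) * 1 * of_real (\<phi> (x k)) \<partial>P) \<le> 1 * (C * 0)"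
    by (intro tendsto_lowerbound) auto
  then show ?case by (simp add: Q)
next
  case (Suc n)
  have B: "0 \<le> B" using \<phi>B[of 0] by linarith
  have [measurable]: "\<phi> \<in> borel_measurable borel" by (rule admissible_measurable[OF \<phi>])
  have [measurable]: "H \<in> borel_measurable borel" using H by (intro measurable_\<I>_borel)
  have ne: "Q \<noteq> {}" using Suc.hyps(2) by auto
  define d where "d = Min ((\<lambda>j. sup_norm (k - j)) ` Q)"
  have "d \<in> (\<lambda>j. sup_norm (k - j)) ` Q" unfolding d_def using Suc.prems(1) ne by (intro Min_in) auto
  then obtain j where j: "j \<in> Q" "sup_norm (k - j) = d" by auto
  have dmin: "d \<le> sup_norm (k - i)" if "i \<in> Q" for i
    unfolding d_def using that Suc.prems(1) by (intro Min_le) auto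
  define Q' where "Q' = Q - {j}"
  have Q': "Q = insert j Q'" "j \<notin> Q'" "finite Q'" "card Q' = n"
    using j Suc.prems(1) Suc.hyps(2) by (auto simp: Q'_def)
  define h where "h = nat d"
  have h: "int h = d" "h0 \<le> h" using Suc.prems(3)[OF j(1)] j(2) by (auto simp: h_def)
  define W where "W x = iexp (s * (\<Sum>i\<in>Q'. \<phi> (x i))) * (iexp (s * \<phi> (x j)) - 1)" for x :: "'m lattice \<Rightarrow> real"
  have Wm [measurable]: "W \<in> borel_measurable borel" unfolding W_def[abs_def] by measurable
  have split: "iexp (s * (\<Sum>j\<in>Q. \<phi> (x j))) = iexp (s * (\<Sum>i\<in>Q'. \<phi> (x i))) + W x" for x
    using Q' by (simp add: W_def ring_distribs exp_add mult.commute)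
  have Wb: "cmod (W x) \<le> \<bar>s\<bar> * B" for x
  proof -
    have "cmod (W x) \<le> \<bar>s * \<phi> (x j)\<bar>" using iexp_sub_1_le[of "s * \<phi> (x j)"] by (simp add: W_def norm_mult)
    also have "\<dots> \<le> \<bar>s\<bar> * B" unfolding abs_mult using \<phi>B by (intro mult_left_mono) auto
    finally show ?thesis .
  qed
  have cyl: "cylinder Q W"
    unfolding cylinder_def
  proof (intro conjI allI impI Wm)
    fix x y :: "'m lattice \<Rightarrow> real" assume "\<forall>i\<in>Q. x i = y i"
    then have "(\<Sum>i\<in>Q'. \<phi> (x i)) = (\<Sum>i\<in>Q'. \<phi> (y i))" "x j = y j"
      using Q' by (auto intro!: sum.cong)
    then show "W x = W y" by (simp add: W_def)
  qed
  have sub: "Q \<subseteq> lex_past_dist k h"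
    using Suc.prems(2) dmin h(1) by (auto intro!: mem_lex_past_distI)
  have 1: "cmod (\<integral>x. of_real (H x) * W x * of_real (\<phi> (x k)) \<partial>P) \<le> \<bar>s\<bar> * B * (C * real h powr - \<alpha>)"
    by (rule cov_invariant_admissible_complex_le[OF \<phi> Suc.prems(1) sub h(2) cyl Wb H])
  have "real_of_int (max 1 (sup_norm (k - j))) = real h"
    using j h h0_pos by auto
  then have rj: "rate (k - j) = C * real h powr - \<alpha>" by (simp only: rate_def)
  have IH: "cmod (\<integral>x. of_real (H x) * iexp (s * (\<Sum>j\<in>Q'. \<phi> (x j))) * of_real (\<phi> (x k)) \<partial>P)
     \<le> \<bar>s\<bar> * B * (\<Sum>j\<in>Q'. rate (k - j))"
    by (rule Suc.hyps(1)) (use Q' Suc.prems in auto)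
  have HB: "\<bar>H x\<bar> * \<bar>\<phi> (x k)\<bar> \<le> 1 * B" for x using H(2) \<phi>B B by (intro mult_mono) auto
  have i1: "integrable P (\<lambda>x. of_real (H x) * iexp (s * (\<Sum>i\<in>Q'. \<phi> (x i))) * of_real (\<phi> (x k)))"
    using HB by (intro integrable_bounded[of _ B]) (auto simp: norm_mult)
  have i2: "integrable P (\<lambda>x. of_real (H x) * W x * of_real (\<phi> (x k)))"
  proof (rule integrable_bounded)
    fix x
    have "\<bar>H x\<bar> * cmod (W x) * \<bar>\<phi> (x k)\<bar> \<le> 1 * (\<bar>s\<bar> * B) * B"
      using H(2) Wb \<phi>B B by (intro mult_mono) auto
    then show "norm (of_real (H x) * W x * of_real (\<phi> (x k))) \<le> 1 * (\<bar>s\<bar> * B) * B" by (simp add: norm_mult)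
  qed measurable
  have "(\<integral>x. of_real (H x) * iexp (s * (\<Sum>j\<in>Q. \<phi> (x j))) * of_real (\<phi> (x k)) \<partial>P)
    = (\<integral>x. of_real (H x) * iexp (s * (\<Sum>j\<in>Q'. \<phi> (x j))) * of_real (\<phi> (x k))
        + of_real (H x) * W x * of_real (\<phi> (x k)) \<partial>P)"
    unfolding split by (simp add: algebra_simps)
  also have "\<dots> = (\<integral>x. of_real (H x) * iexp (s * (\<Sum>j\<in>Q'. \<phi> (x j))) * of_real (\<phi> (x k)) \<partial>P)
        + (\<integral>x. of_real (H x) * W x * of_real (\<phi> (x k)) \<partial>P)"
    by (rule Bochner_Integration.integral_add[OF i1 i2])
  also have "cmod \<dots> \<le> \<bar>s\<bar> * B * (\<Sum>j\<in>Q'. rate (k - j)) + \<bar>s\<bar> * B * (C * real h powr - \<alpha>)"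
    by (rule norm_triangle_mono[OF IH 1])
  also have "\<dots> = \<bar>s\<bar> * B * (\<Sum>j\<in>Q. rate (k - j))"
    using Q' rj by (simp add: algebra_simps)
  finally show ?case .
qed

lemma damping_measurable_\<I>:
  assumes [measurable]: "\<eta> \<in> borel_measurable \<I>"
  shows "damping \<eta> s A k \<in> borel_measurable \<I>"
  unfolding damping_def[abs_def] by measurable

lemma damping_bounds:
  assumes "0 \<le> \<eta> x"
  shows "0 < damping \<eta> s A k x" "damping \<eta> s A k x \<le> 1"
  using assms by (auto simp: damping_def)

text \<open>
  One summand per point: exchanging one Gaussian factor for the exponential of the actual value changes
  the integrand by the weight times the difference of the two one-point factors.
\<close>

lemma weight_telescope:
  assumes "finite A"
  shows "iexp (s * (\<Sum>j\<in>A. \<phi> (x j))) - of_real (exp (- (s\<^sup>2 * real (card A) * \<eta> x / 2)))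
    = (\<Sum>k\<in>A. weight \<phi> \<eta> s A k x * (iexp (s * \<phi> (x k)) - of_real (exp (- (s\<^sup>2 * \<eta> x / 2)))))"
proof -
  define g where "g Q = complex_of_real (exp (- (s\<^sup>2 * real (card A - card Q) * \<eta> x / 2))) *
    iexp (s * (\<Sum>j\<in>Q. \<phi> (x j)))" for Q
  have "(\<Sum>k\<in>A. weight \<phi> \<eta> s A k x * (iexp (s * \<phi> (x k)) - of_real (exp (- (s\<^sup>2 * \<eta> x / 2)))))
      = (\<Sum>k\<in>A. g (insert k {j \<in> A. lex_less j k}) - g {j \<in> A. lex_less j k})"
  proof (rule sum.cong[OF refl])
    fix k assume k: "k \<in> A"
    define R where "R = past A k"
    have R: "finite R" "k \<notin> R" "card R < card A"
      using assms k card_past_less[OF assms k] by (auto simp: R_def past_def lex_less_irrefl)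
    define d where "d = card A - Suc (card R)"
    have d: "card A - card R = Suc d" using R by (simp add: d_def)
    have 1: "g (insert k R) = complex_of_real (exp (- (s\<^sup>2 * real d * \<eta> x / 2))) *
        (iexp (s * (\<Sum>j\<in>R. \<phi> (x j))) * iexp (s * \<phi> (x k)))"
      unfolding g_def using R
      by (simp add: d_def exp_add[symmetric] ring_distribs add.commute)
    have e: "exp (- (s\<^sup>2 * real (Suc d) * \<eta> x / 2)) = exp (- (s\<^sup>2 * real d * \<eta> x / 2)) * exp (- (s\<^sup>2 * \<eta> x / 2))"
      unfolding exp_add[symmetric] by (simp add: field_simps)
    have 2: "g R = complex_of_real (exp (- (s\<^sup>2 * real d * \<eta> x / 2)) * exp (- (s\<^sup>2 * \<eta> x / 2))) *
        iexp (s * (\<Sum>j\<in>R. \<phi> (x j)))"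
      unfolding g_def d e ..
    have "weight \<phi> \<eta> s A k x = complex_of_real (exp (- (s\<^sup>2 * real d * \<eta> x / 2))) * iexp (s * (\<Sum>j\<in>R. \<phi> (x j)))"
      unfolding weight_def damping_def R_def[symmetric] d_def[symmetric] ..
    then show "weight \<phi> \<eta> s A k x * (iexp (s * \<phi> (x k)) - of_real (exp (- (s\<^sup>2 * \<eta> x / 2))))
        = g (insert k {j \<in> A. lex_less j k}) - g {j \<in> A. lex_less j k}"
      unfolding past_def[symmetric] R_def[symmetric] 1 2 of_real_mult
      by (simp only: right_diff_distrib mult.assoc mult.commute mult.left_commute)
  qed
  also have "\<dots> = g A - g {}" by (rule lex_telescope[OF assms])
  finally show ?thesis by (simp add: g_def)
qed

definition far :: "nat \<Rightarrow> 'm lattice set \<Rightarrow> 'm lattice \<Rightarrow> 'm lattice set" where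
  "far M A k = {j \<in> past A k. int M < sup_norm (k - j)}"

text \<open>
  The second order expansion of one increment. The linear term is replaced by the one that sees
  only the far past; the correction for the near past turns the square of the new variable into
  \<open>local_variance\<close>.
\<close>

lemma increment_expansion:
  assumes A: "finite A" and \<phi>B: "\<And>y. \<bar>\<phi> y\<bar> \<le> B" and \<eta>: "0 \<le> \<eta> x" "\<eta> x \<le> b"
  shows "cmod (weight \<phi> \<eta> s A k x * (iexp (s * \<phi> (x k)) - of_real (exp (- (s\<^sup>2 * \<eta> x / 2))))
      - \<i> * s * (of_real (damping \<eta> s A k x) * iexp (s * (\<Sum>j\<in>far M A k. \<phi> (x j))) * of_real (\<phi> (x k)))
      + s\<^sup>2 / 2 * (weight \<phi> \<eta> s A k x * of_real (local_variance \<phi> M (field_shift k x) - \<eta> x)))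
    \<le> \<bar>s\<bar> ^ 3 * (B ^ 3 / 6 + B ^ 3 * (real (card (near M :: 'm lattice set)))\<^sup>2 / 2) + s ^ 4 * (b\<^sup>2 / 8)
      + s\<^sup>2 * B\<^sup>2 * real (card {v \<in> near M. k + v \<notin> A})"
proof -
  define q where "q = real (card (near M :: 'm lattice set))"
  define a where "a = \<phi> (x k)"
  define \<Delta> where "\<Delta> = (\<Sum>v\<in>{v \<in> near M. k + v \<in> A}. \<phi> (x (k + v)))"
  define \<Delta>' where "\<Delta>' = (\<Sum>v\<in>{v \<in> near M. k + v \<notin> A}. \<phi> (x (k + v)))"
  define F where "F = (\<Sum>j\<in>far M A k. \<phi> (x j))"
  define w where "w = weight \<phi> \<eta> s A k x"
  define H where "H = complex_of_real (damping \<eta> s A k x)"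
  define y where "y = s\<^sup>2 * \<eta> x / 2"
  have B: "0 \<le> B" using \<phi>B[of 0] by linarith
  have aB: "\<bar>a\<bar> \<le> B" unfolding a_def by (rule \<phi>B)
  have w1: "cmod w \<le> 1" unfolding w_def using \<eta>(1) by (rule norm_weight_le)
  have S: "(\<Sum>j\<in>past A k. \<phi> (x j)) = F + \<Delta>"
  proof -
    have "(\<Sum>j\<in>past A k. \<phi> (x j)) = (\<Sum>j\<in>far M A k. \<phi> (x j)) +
        (\<Sum>j\<in>(\<lambda>v. k + v) ` {v \<in> near M. k + v \<in> A}. \<phi> (x j))"
      unfolding far_def
    proof (subst past_eq_far_near[of A k M], rule sum.union_disjoint)
      show "finite {j \<in> past A k. int M < sup_norm (k - j)}" using finite_past[OF A] by simp
      show "finite ((\<lambda>v. k + v) ` {v \<in> near M. k + v \<in> A})"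
        by (intro finite_imageI finite_subset[OF _ finite_near[of M]]) auto
      show "{j \<in> past A k. int M < sup_norm (k - j)} \<inter> (\<lambda>v. k + v) ` {v \<in> near M. k + v \<in> A} = {}"
        by (auto simp: near_def sup_norm_minus)
    qed
    then show ?thesis unfolding F_def \<Delta>_def by (subst (asm) sum.reindex) (auto simp: inj_on_def)
  qed
  have lv: "local_variance \<phi> M (field_shift k x) = a\<^sup>2 + 2 * (a * \<Delta>) + 2 * (a * \<Delta>')"
  proof -
    have "(\<Sum>v\<in>near M. \<phi> (x (k + v))) = \<Delta> + \<Delta>'"
    proof -
      have "near M = {v \<in> near M. k + v \<in> A} \<union> {v \<in> near M. k + v \<notin> A}" by auto
      then show ?thesis unfolding \<Delta>_def \<Delta>'_def
        using finite_near[where 'a = 'm, of M]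
        by (subst sum.union_disjoint[symmetric]) auto
    qed
    moreover have "local_variance \<phi> M (field_shift k x) = a\<^sup>2 + 2 * (a * (\<Sum>v\<in>near M. \<phi> (x (k + v))))"
      unfolding local_variance_def field_shift_def a_def sum_distrib_left
      by (simp add: add.commute[of _ k])
    ultimately show ?thesis by (simp only: distrib_left add.assoc)
  qed
  have near_le: "card {v \<in> (near M :: 'm lattice set). Q v} \<le> card (near M :: 'm lattice set)" for Q
    by (rule card_mono[OF finite_near]) auto
  have \<Delta>B: "\<bar>\<Delta>\<bar> \<le> q * B"
  proof -
    have "\<bar>\<Delta>\<bar> \<le> (\<Sum>v\<in>{v \<in> near M. k + v \<in> A}. B)"
      unfolding \<Delta>_def by (rule order_trans[OF sum_abs sum_mono]) (rule \<phi>B)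
    also have "\<dots> \<le> q * B" using near_le B by (simp add: q_def mult_right_mono)
    finally show ?thesis .
  qed
  have \<Delta>'B: "\<bar>\<Delta>'\<bar> \<le> real (card {v \<in> near M. k + v \<notin> A}) * B"
  proof -
    have "\<bar>\<Delta>'\<bar> \<le> (\<Sum>v\<in>{v \<in> near M. k + v \<notin> A}. B)"
      unfolding \<Delta>'_def by (rule order_trans[OF sum_abs sum_mono]) (rule \<phi>B)
    then show ?thesis by simp
  qed
  \<comment> \<open>the errors in the expansions of the field factor, the Gaussian factor and the near past\<close>
  define e1 where "e1 = iexp (s * a) - 1 - \<i> * (s * a) + (s * a)\<^sup>2 / 2"
  define e2 where "e2 = exp (- y) - (1 - y)"
  define e3 where "e3 = iexp (- s * \<Delta>) - 1 - \<i> * (- s * \<Delta>)"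
  have y0: "0 \<le> y" using \<eta> by (simp add: y_def)
  have e1: "cmod e1 \<le> \<bar>s\<bar> ^ 3 * (B ^ 3 / 6)"
  proof -
    have "cmod e1 \<le> \<bar>s * a\<bar> ^ 3 / 6" unfolding e1_def
      using iexp_taylor2[of "s * a"] by simp
    also have "\<dots> = \<bar>s\<bar> ^ 3 * (\<bar>a\<bar> ^ 3 / 6)" by (simp add: abs_mult power_mult_distrib)
    also have "\<dots> \<le> \<bar>s\<bar> ^ 3 * (B ^ 3 / 6)"
      using aB by (intro mult_left_mono divide_right_mono power_mono) auto
    finally show ?thesis .
  qed
  have e2: "\<bar>e2\<bar> \<le> s ^ 4 * (b\<^sup>2 / 8)"
  proof -
    have "\<bar>e2\<bar> \<le> y\<^sup>2 / 2" unfolding e2_def by (rule exp_minus_taylor1[OF y0])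
    also have "\<dots> = s ^ 4 * ((\<eta> x)\<^sup>2 / 8)" by (simp add: y_def power2_eq_square eval_nat_numeral)
    also have "\<dots> \<le> s ^ 4 * (b\<^sup>2 / 8)"
      using \<eta> by (intro mult_left_mono divide_right_mono power_mono) auto
    finally show ?thesis .
  qed
  have e3: "cmod (e3 * (\<i> * (s * a))) \<le> \<bar>s\<bar> ^ 3 * (B ^ 3 * q\<^sup>2 / 2)"
  proof -
    have "cmod e3 \<le> (- s * \<Delta>)\<^sup>2 / 2" unfolding e3_def using iexp_taylor1[of "- s * \<Delta>"] by simp
    also have "\<dots> = s\<^sup>2 * \<bar>\<Delta>\<bar>\<^sup>2 / 2" by (simp add: power_mult_distrib)
    also have "\<dots> \<le> s\<^sup>2 * (q * B)\<^sup>2 / 2"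
      using \<Delta>B by (intro divide_right_mono mult_left_mono power_mono) auto
    finally have "cmod e3 * (\<bar>s\<bar> * \<bar>a\<bar>) \<le> (s\<^sup>2 * (q * B)\<^sup>2 / 2) * (\<bar>s\<bar> * B)"
      using aB by (intro mult_mono) auto
    also have "\<dots> = \<bar>s\<bar> ^ 3 * (B ^ 3 * q\<^sup>2 / 2)"
      by (simp add: power_mult_distrib eval_nat_numeral power2_abs[of s, symmetric] del: power2_abs)
    finally show ?thesis by (simp add: norm_mult abs_mult)
  qed
  have e4: "cmod (of_real (s\<^sup>2 * (a * \<Delta>'))) \<le> s\<^sup>2 * B\<^sup>2 * real (card {v \<in> near M. k + v \<notin> A})"
  proof -
    have "\<bar>a\<bar> * \<bar>\<Delta>'\<bar> \<le> B * (real (card {v \<in> near M. k + v \<notin> A}) * B)"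
      using aB \<Delta>'B B by (intro mult_mono) auto
    then have "s\<^sup>2 * (\<bar>a\<bar> * \<bar>\<Delta>'\<bar>) \<le> s\<^sup>2 * (B * (real (card {v \<in> near M. k + v \<notin> A}) * B))"
      by (intro mult_left_mono) auto
    then show ?thesis unfolding norm_of_real by (simp add: abs_mult power2_eq_square algebra_simps)
  qed
  have w: "w = H * (iexp (s * F) * iexp (s * \<Delta>))"
    unfolding w_def weight_def S H_def by (simp add: exp_add[symmetric] ring_distribs)
  have HF: "H * iexp (s * F) = w * (e3 + 1 - \<i> * (s * \<Delta>))"
  proof -
    have "iexp (s * \<Delta>) * iexp (- s * \<Delta>) = 1" by (simp add: exp_add[symmetric])
    then have "w * iexp (- s * \<Delta>) = H * iexp (s * F)" unfolding w by (simp add: mult.assoc)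
    then show ?thesis by (simp add: e3_def)
  qed
  have E1: "iexp (s * a) = 1 + \<i> * (s * a) - (s * a)\<^sup>2 / 2 + e1" by (simp add: e1_def)
  have E2: "complex_of_real (exp (- y)) = 1 - of_real y + of_real e2" by (simp add: e2_def)
  have "w * (iexp (s * a) - of_real (exp (- y))) - \<i> * s * (H * iexp (s * F) * of_real a)
      + s\<^sup>2 / 2 * (w * of_real (local_variance \<phi> M (field_shift k x) - \<eta> x))
    = w * (e1 - of_real e2 - e3 * (\<i> * (s * a)) + of_real (s\<^sup>2 * (a * \<Delta>')))"
    unfolding E1 E2 HF lv unfolding y_def
    using expansion_identity[of "1/2" \<i> w "of_real s" "of_real a" e1 "of_real (\<eta> x)" "of_real e2" e3
      "of_real \<Delta>" "of_real \<Delta>'"]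
    by simp
  then have "cmod (w * (iexp (s * a) - of_real (exp (- y))) - \<i> * s * (H * iexp (s * F) * of_real a)
      + s\<^sup>2 / 2 * (w * of_real (local_variance \<phi> M (field_shift k x) - \<eta> x)))
    \<le> 1 * cmod (e1 - of_real e2 - e3 * (\<i> * (s * a)) + of_real (s\<^sup>2 * (a * \<Delta>')))"
    using w1 by (simp add: norm_mult mult_left_le_one_le)
  also have "\<dots> \<le> cmod e1 + \<bar>e2\<bar> + cmod (e3 * (\<i> * (s * a))) + cmod (of_real (s\<^sup>2 * (a * \<Delta>')))"
    using norm_triangle_ineq[of "e1 - of_real e2 - e3 * (\<i> * (s * a))" "of_real (s\<^sup>2 * (a * \<Delta>'))"]
      norm_triangle_ineq4[of "e1 - of_real e2" "e3 * (\<i> * (s * a))"]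
      norm_triangle_ineq4[of e1 "of_real e2"] by simp
  also have "\<dots> \<le> \<bar>s\<bar> ^ 3 * (B ^ 3 / 6) + s ^ 4 * (b\<^sup>2 / 8) + \<bar>s\<bar> ^ 3 * (B ^ 3 * q\<^sup>2 / 2)
      + s\<^sup>2 * B\<^sup>2 * real (card {v \<in> near M. k + v \<notin> A})"
    by (intro add_mono e1 e2 e3 e4)
  finally show ?thesis
    unfolding w_def a_def H_def F_def y_def q_def by (simp add: algebra_simps)
qed

text \<open>
  Summing the expansions over all points. Each of the \<open>card A\<close> linear terms costs
  \<open>s\<^sup>2 B\<close> times the tail of the coefficients, by \<open>far_past_le\<close>; what remains of order \<open>s\<^sup>2\<close> is the
  weighted sum of the centred local variances.
\<close>

lemma comparison_le:
  assumes A: "finite A" and \<phi>: "admissible \<phi>" and \<phi>B: "\<And>y. \<bar>\<phi> y\<bar> \<le> B"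
    and \<eta>: "\<eta> \<in> borel_measurable \<I>" "\<And>x. 0 \<le> \<eta> x" "\<And>x. \<eta> x \<le> b" and M: "h0 \<le> M"
  shows "cmod ((\<integral>x. iexp (s * (\<Sum>j\<in>A. \<phi> (x j))) \<partial>P)
        - (\<integral>x. of_real (exp (- (s\<^sup>2 * real (card A) * \<eta> x / 2))) \<partial>P))
    \<le> real (card A) * (s\<^sup>2 * B * infsum rate {v. int M < sup_norm v})
      + s\<^sup>2 / 2 * cmod (\<Sum>k\<in>A. \<integral>x. weight \<phi> \<eta> s A k x * of_real (local_variance \<phi> M (field_shift k x) - \<eta> x) \<partial>P)
      + real (card A) * (\<bar>s\<bar> ^ 3 * (B ^ 3 / 6 + B ^ 3 * (real (card (near M :: 'm lattice set)))\<^sup>2 / 2)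
          + s ^ 4 * (b\<^sup>2 / 8))
      + s\<^sup>2 * B\<^sup>2 * (\<Sum>v\<in>near M. real (card {k \<in> A. k + v \<notin> A}))"
proof -
  have B: "0 \<le> B" using \<phi>B[of 0] by linarith
  have b: "0 \<le> b" using \<eta>(2,3) order_trans by blast
  have [measurable]: "\<phi> \<in> borel_measurable borel" by (rule admissible_measurable[OF \<phi>])
  have [measurable]: "\<eta> \<in> borel_measurable borel" using \<eta> by (intro measurable_\<I>_borel)
  define t where "t k x = weight \<phi> \<eta> s A k x * (iexp (s * \<phi> (x k)) - of_real (exp (- (s\<^sup>2 * \<eta> x / 2))))" for k x
  define u where "u k x = of_real (damping \<eta> s A k x) * iexp (s * (\<Sum>j\<in>far M A k. \<phi> (x j))) * of_real (\<phi> (x k))" for k x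
  define z where "z k x = weight \<phi> \<eta> s A k x * of_real (local_variance \<phi> M (field_shift k x) - \<eta> x)" for k x
  define c where "c = \<bar>s\<bar> ^ 3 * (B ^ 3 / 6 + B ^ 3 * (real (card (near M :: 'm lattice set)))\<^sup>2 / 2) + s ^ 4 * (b\<^sup>2 / 8)"
  define \<epsilon> where "\<epsilon> k = c + s\<^sup>2 * B\<^sup>2 * real (card {v \<in> near M. k + v \<notin> A})" for k
  have [measurable]: "damping \<eta> s A k \<in> borel_measurable borel" for k
    by (intro measurable_\<I>_borel damping_measurable_\<I> \<eta>)
  have [measurable]: "t k \<in> borel_measurable borel" "u k \<in> borel_measurable borel" "z k \<in> borel_measurable borel" for k
    unfolding t_def[abs_def] u_def[abs_def] z_def[abs_def] by measurable
  have it: "integrable P (t k)" for k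
  proof (rule integrable_bounded)
    fix x
    have "cmod (iexp (s * \<phi> (x k)) - of_real (exp (- (s\<^sup>2 * \<eta> x / 2)))) \<le> 1 + 1"
    proof -
      have "exp (- (s\<^sup>2 * \<eta> x / 2)) \<le> 1" using \<eta>(2)[of x] by simp
      then have "cmod (complex_of_real (exp (- (s\<^sup>2 * \<eta> x / 2)))) \<le> 1" unfolding norm_of_real by simp
      then show ?thesis
        using norm_triangle_ineq4[of "iexp (s * \<phi> (x k))" "complex_of_real (exp (- (s\<^sup>2 * \<eta> x / 2)))"]
        unfolding norm_iexp by linarith
    qed
    then have "cmod (t k x) \<le> 1 * 2"
      unfolding t_def norm_mult using norm_weight_le[of \<eta> x, OF \<eta>(2)] by (intro mult_mono) auto
    then show "norm (t k x) \<le> 1 * 2" .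
  qed measurable
  have dm: "\<bar>damping \<eta> s A k x\<bar> \<le> 1" for k x using damping_bounds[of \<eta> x s A k, OF \<eta>(2)] by simp
  have iu: "integrable P (u k)" for k
  proof (rule integrable_bounded)
    fix x
    have "\<bar>damping \<eta> s A k x\<bar> * 1 * \<bar>\<phi> (x k)\<bar> \<le> 1 * 1 * B"
      using dm \<phi>B by (intro mult_mono) auto
    then show "norm (u k x) \<le> 1 * 1 * B" by (simp add: u_def norm_mult)
  qed measurable
  define G where "G = B\<^sup>2 + 2 * (real (card (near M :: 'm lattice set)) * B\<^sup>2) + b"
  have iz: "integrable P (z k)" for k
  proof (rule integrable_bounded)
    fix x
    have "\<bar>local_variance \<phi> M (field_shift k x) - \<eta> x\<bar> \<le> G"
      using abs_triangle_ineq4[of "local_variance \<phi> M (field_shift k x)" "\<eta> x"]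
        local_variance_bounded[of \<phi> B M "field_shift k x", OF \<phi>B] \<eta>(2,3)[of x]
      by (simp add: G_def)
    then have "cmod (z k x) \<le> 1 * G"
      unfolding z_def norm_mult norm_of_real using norm_weight_le[of \<eta> x, OF \<eta>(2)] by (intro mult_mono) auto
    then show "norm (z k x) \<le> 1 * G" .
  qed measurable
  have err: "cmod ((\<integral>x. t k x \<partial>P) - \<i> * s * (\<integral>x. u k x \<partial>P) + s\<^sup>2 / 2 * (\<integral>x. z k x \<partial>P)) \<le> \<epsilon> k" for k
  proof -
    have "(\<integral>x. t k x \<partial>P) - \<i> * s * (\<integral>x. u k x \<partial>P) + s\<^sup>2 / 2 * (\<integral>x. z k x \<partial>P)
        = (\<integral>x. t k x - \<i> * s * u k x + s\<^sup>2 / 2 * z k x \<partial>P)"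
      using it iu iz by simp
    also have "cmod \<dots> \<le> (\<integral>x. cmod (t k x - \<i> * s * u k x + s\<^sup>2 / 2 * z k x) \<partial>P)"
      by (rule integral_norm_bound)
    also have "\<dots> \<le> (\<integral>x. \<epsilon> k \<partial>P)"
    proof (rule integral_mono)
      show "integrable P (\<lambda>x. cmod (t k x - \<i> * s * u k x + s\<^sup>2 / 2 * z k x))"
        using it iu iz by (intro integrable_norm Bochner_Integration.integrable_add
          Bochner_Integration.integrable_diff integrable_mult_right) auto
      fix x
      show "cmod (t k x - \<i> * s * u k x + s\<^sup>2 / 2 * z k x) \<le> \<epsilon> k"
        using increment_expansion[where \<eta> = \<eta> and x = x and \<phi> = \<phi> and s = s and k = k and M = M,
          OF A \<phi>B \<eta>(2) \<eta>(3)]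
        unfolding t_def u_def z_def \<epsilon>_def c_def of_real_divide of_real_power of_real_numeral .
    qed simp
    finally show ?thesis by simp
  qed
  have ub: "cmod (\<integral>x. u k x \<partial>P) \<le> \<bar>s\<bar> * B * infsum rate {v. int M < sup_norm v}" if "k \<in> A" for k
  proof -
    have ff: "finite (far M A k)" using finite_past[OF A] by (simp add: far_def)
    have "cmod (\<integral>x. u k x \<partial>P) \<le> \<bar>s\<bar> * B * (\<Sum>j\<in>far M A k. rate (k - j))"
      unfolding u_def
      by (rule far_past_le[OF \<phi> \<phi>B damping_measurable_\<I>[OF \<eta>(1)] dm ff])
         (use M in \<open>auto simp: far_def past_def\<close>)
    also have "(\<Sum>j\<in>far M A k. rate (k - j)) = (\<Sum>v\<in>(\<lambda>j. k - j) ` far M A k. rate v)"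
      by (subst sum.reindex) (auto simp: inj_on_def)
    also have "\<dots> \<le> infsum rate {v. int M < sup_norm v}"
      using ff by (intro finite_sum_le_infsum rate_summable) (auto simp: far_def rate_nonneg)
    finally show ?thesis using B by (simp add: mult_left_mono)
  qed
  have tri: "cmod (a - b + c) \<le> cmod a + cmod b + cmod c" for a b c :: complex
    using norm_triangle_ineq[of "a - b" c] norm_triangle_ineq4[of a b] by linarith
  have "(\<integral>x. iexp (s * (\<Sum>j\<in>A. \<phi> (x j))) \<partial>P)
        - (\<integral>x. of_real (exp (- (s\<^sup>2 * real (card A) * \<eta> x / 2))) \<partial>P)
      = (\<integral>x. iexp (s * (\<Sum>j\<in>A. \<phi> (x j))) - of_real (exp (- (s\<^sup>2 * real (card A) * \<eta> x / 2))) \<partial>P)"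
  proof (rule Bochner_Integration.integral_diff[symmetric])
    show "integrable P (\<lambda>x. iexp (s * (\<Sum>j\<in>A. \<phi> (x j))))"
      by (rule integrable_bounded[of _ 1]) auto
    show "integrable P (\<lambda>x. complex_of_real (exp (- (s\<^sup>2 * real (card A) * \<eta> x / 2))))"
      using \<eta>(2) by (intro integrable_bounded[of _ 1]) (auto simp del: of_real_exp)
  qed
  also have "\<dots> = (\<integral>x. (\<Sum>k\<in>A. t k x) \<partial>P)"
    unfolding t_def by (simp only: weight_telescope[OF A])
  also have "\<dots> = (\<Sum>k\<in>A. \<integral>x. t k x \<partial>P)" using it by simp
  also have "\<dots> = \<i> * s * (\<Sum>k\<in>A. \<integral>x. u k x \<partial>P) - s\<^sup>2 / 2 * (\<Sum>k\<in>A. \<integral>x. z k x \<partial>P)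
      + (\<Sum>k\<in>A. (\<integral>x. t k x \<partial>P) - \<i> * s * (\<integral>x. u k x \<partial>P) + s\<^sup>2 / 2 * (\<integral>x. z k x \<partial>P))"
    by (simp add: sum.distrib sum_subtractf sum_distrib_left)
  finally have main: "(\<integral>x. iexp (s * (\<Sum>j\<in>A. \<phi> (x j))) \<partial>P)
        - (\<integral>x. of_real (exp (- (s\<^sup>2 * real (card A) * \<eta> x / 2))) \<partial>P)
      = \<i> * s * (\<Sum>k\<in>A. \<integral>x. u k x \<partial>P) - s\<^sup>2 / 2 * (\<Sum>k\<in>A. \<integral>x. z k x \<partial>P)
      + (\<Sum>k\<in>A. (\<integral>x. t k x \<partial>P) - \<i> * s * (\<integral>x. u k x \<partial>P) + s\<^sup>2 / 2 * (\<integral>x. z k x \<partial>P))" .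
  have "cmod ((\<integral>x. iexp (s * (\<Sum>j\<in>A. \<phi> (x j))) \<partial>P)
        - (\<integral>x. of_real (exp (- (s\<^sup>2 * real (card A) * \<eta> x / 2))) \<partial>P))
      \<le> cmod (\<i> * s * (\<Sum>k\<in>A. \<integral>x. u k x \<partial>P))
      + cmod (s\<^sup>2 / 2 * (\<Sum>k\<in>A. \<integral>x. z k x \<partial>P))
      + cmod (\<Sum>k\<in>A. (\<integral>x. t k x \<partial>P) - \<i> * s * (\<integral>x. u k x \<partial>P) + s\<^sup>2 / 2 * (\<integral>x. z k x \<partial>P))"
    unfolding main by (rule tri)
  also have "\<dots> \<le> \<bar>s\<bar> * (\<Sum>k\<in>A. \<bar>s\<bar> * B * infsum rate {v. int M < sup_norm v})
      + s\<^sup>2 / 2 * cmod (\<Sum>k\<in>A. \<integral>x. z k x \<partial>P) + (\<Sum>k\<in>A. \<epsilon> k)"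
  proof (intro add_mono)
    have "cmod (\<Sum>k\<in>A. \<integral>x. u k x \<partial>P) \<le> (\<Sum>k\<in>A. \<bar>s\<bar> * B * infsum rate {v. int M < sup_norm v})"
      by (intro sum_norm_le ub)
    then show "cmod (\<i> * s * (\<Sum>k\<in>A. \<integral>x. u k x \<partial>P)) \<le> \<bar>s\<bar> * (\<Sum>k\<in>A. \<bar>s\<bar> * B * infsum rate {v. int M < sup_norm v})"
      unfolding norm_mult by (simp add: mult_left_mono)
    show "cmod (s\<^sup>2 / 2 * (\<Sum>k\<in>A. \<integral>x. z k x \<partial>P)) \<le> s\<^sup>2 / 2 * cmod (\<Sum>k\<in>A. \<integral>x. z k x \<partial>P)"
      by (simp add: norm_mult norm_power)
    show "cmod (\<Sum>k\<in>A. (\<integral>x. t k x \<partial>P) - \<i> * s * (\<integral>x. u k x \<partial>P) + s\<^sup>2 / 2 * (\<integral>x. z k x \<partial>P)) \<le> (\<Sum>k\<in>A. \<epsilon> k)"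
      by (intro sum_norm_le err)
  qed
  also have "(\<Sum>k\<in>A. \<epsilon> k) = real (card A) * c + s\<^sup>2 * B\<^sup>2 * (\<Sum>v\<in>near M. real (card {k \<in> A. k + v \<notin> A}))"
  proof -
    have "(\<Sum>k\<in>A. real (card {v \<in> near M. k + v \<notin> A})) = (\<Sum>k\<in>A. \<Sum>v\<in>near M. of_bool (k + v \<notin> A))"
      using finite_near[where 'a = 'm, of M] by (simp add: Int_def)
    also have "\<dots> = (\<Sum>v\<in>near M. \<Sum>k\<in>A. of_bool (k + v \<notin> A))" by (rule sum.swap)
    also have "\<dots> = (\<Sum>v\<in>near M. real (card {k \<in> A. k + v \<notin> A}))"
      using A by (simp add: Int_def)
    finally show ?thesis by (simp add: \<epsilon>_def sum.distrib sum_distrib_left[symmetric])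
  qed
  also have "\<bar>s\<bar> * (\<Sum>k\<in>A. \<bar>s\<bar> * B * infsum rate {v. int M < sup_norm v})
      = real (card A) * (s\<^sup>2 * B * infsum rate {v. int M < sup_norm v})"
    by (simp add: power2_eq_square algebra_simps flip: abs_mult)
  finally show ?thesis unfolding z_def c_def by (simp add: algebra_simps)
qed

section \<open>Averaging against slowly varying weights\<close>

definition past_change :: "'m lattice set \<Rightarrow> 'm lattice \<Rightarrow> 'm lattice \<Rightarrow> 'm lattice set" where
  "past_change A k v = {j \<in> A. lex_less j (k + v) \<noteq> lex_less j k}"

text \<open>
  Lexicographic pasts are nested, so the partial sums over two of them differ by a sum over the
  points that lie in exactly one.
\<close>

lemma past_change_sum:
  assumes A: "finite A"
  shows "\<bar>(\<Sum>j\<in>past A (k + v). f j) - (\<Sum>j\<in>past A k. f j)\<bar> = \<bar>\<Sum>j\<in>past_change A k v. f j :: real\<bar>"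
proof -
  have *: "\<bar>(\<Sum>j\<in>P. f j) - (\<Sum>j\<in>Q. f j)\<bar> = \<bar>\<Sum>j\<in>P - Q. f j\<bar>" if "Q \<subseteq> P" "finite P" for P Q
    using sum_diff[OF that(2,1), of f] by simp
  consider "k + v = k" | "lex_less k (k + v)" | "lex_less (k + v) k"
    using lex_less_total by blast
  then show ?thesis
  proof cases
    case 1
    then show ?thesis by (simp add: past_change_def)
  next
    case 2
    then have "past A k \<subseteq> past A (k + v)" "past_change A k v = past A (k + v) - past A k"
      using lex_less_trans by (auto simp: past_def past_change_def)
    then show ?thesis using *[OF _ finite_past[OF A]] by simp
  next
    case 3
    then have s: "past A (k + v) \<subseteq> past A k" "past_change A k v = past A k - past A (k + v)"
      using lex_less_trans by (auto simp: past_def past_change_def)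
    show ?thesis using *[OF s(1) finite_past[OF A]] unfolding s(2) by (metis abs_minus_commute)
  qed
qed

text \<open>
  Both factors of the weight are Lipschitz functions of quantities that change on \<open>past_change\<close> only.
\<close>

lemma weight_shift_le:
  assumes A: "finite A" and \<eta>: "0 \<le> \<eta> x" "\<eta> x \<le> b"
  shows "cmod (weight \<phi> \<eta> s A (k + v) x - weight \<phi> \<eta> s A k x)
    \<le> s\<^sup>2 * b / 2 * real (card (past_change A k v)) + \<bar>s\<bar> * \<bar>\<Sum>j\<in>past_change A k v. \<phi> (x j)\<bar>"
proof -
  define H where "H = damping \<eta> s A k x"
  define H' where "H' = damping \<eta> s A (k + v) x"
  define I where "I = iexp (s * (\<Sum>j\<in>past A k. \<phi> (x j)))"
  define I' where "I' = iexp (s * (\<Sum>j\<in>past A (k + v). \<phi> (x j)))"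
  define N where "N = card A - Suc (card (past A k))"
  define N' where "N' = card A - Suc (card (past A (k + v)))"
  have "\<bar>real (card (past A (k + v))) - real (card (past A k))\<bar> = real (card (past_change A k v))"
    using past_change_sum[OF A, of "\<lambda>_. 1" k v] by simp
  moreover have "\<bar>real N' - real N\<bar> \<le> \<bar>real (card (past A (k + v))) - real (card (past A k))\<bar>"
    unfolding N_def N'_def by linarith
  ultimately have NN: "\<bar>real N' - real N\<bar> \<le> real (card (past_change A k v))" by simp
  have "\<bar>H' - H\<bar> \<le> \<bar>s\<^sup>2 * real N' * \<eta> x / 2 - s\<^sup>2 * real N * \<eta> x / 2\<bar>"
    unfolding H_def H'_def damping_def N_def N'_def using \<eta> by (intro exp_minus_diff_le) auto
  also have "s\<^sup>2 * real N' * \<eta> x / 2 - s\<^sup>2 * real N * \<eta> x / 2 = (s\<^sup>2 * \<eta> x / 2) * (real N' - real N)"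
    by (simp add: algebra_simps diff_divide_distrib)
  also have "\<bar>\<dots>\<bar> = (s\<^sup>2 * \<eta> x / 2) * \<bar>real N' - real N\<bar>"
    using \<eta> by (simp add: abs_mult)
  also have "\<dots> \<le> (s\<^sup>2 * b / 2) * real (card (past_change A k v))"
    using NN \<eta> by (intro mult_mono divide_right_mono mult_left_mono) auto
  finally have HH: "\<bar>H' - H\<bar> \<le> s\<^sup>2 * b / 2 * real (card (past_change A k v))" .
  have "cmod (I' - I) \<le> \<bar>s * (\<Sum>j\<in>past A (k + v). \<phi> (x j)) - s * (\<Sum>j\<in>past A k. \<phi> (x j))\<bar>"
    unfolding I_def I'_def by (rule iexp_diff_le)
  also have "\<dots> = \<bar>s\<bar> * \<bar>(\<Sum>j\<in>past A (k + v). \<phi> (x j)) - (\<Sum>j\<in>past A k. \<phi> (x j))\<bar>"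
    by (simp only: right_diff_distrib[symmetric] abs_mult)
  finally have II: "cmod (I' - I) \<le> \<bar>s\<bar> * \<bar>\<Sum>j\<in>past_change A k v. \<phi> (x j)\<bar>"
    unfolding past_change_sum[OF A] .
  have H0: "0 \<le> H" "H \<le> 1" using damping_bounds[of \<eta> x s A k, OF \<eta>(1)] by (auto simp: H_def)
  have "of_real H' * I' - of_real H * I = of_real (H' - H) * I' + of_real H * (I' - I)"
    by (simp add: algebra_simps)
  then have "cmod (of_real H' * I' - of_real H * I) \<le> \<bar>H' - H\<bar> * cmod I' + \<bar>H\<bar> * cmod (I' - I)"
    using norm_triangle_ineq[of "of_real (H' - H) * I'" "of_real H * (I' - I)"]
    unfolding norm_mult norm_of_real by simp
  also have "\<dots> \<le> \<bar>H' - H\<bar> * 1 + 1 * cmod (I' - I)"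
    using H0 by (intro add_mono mult_mono) (auto simp: I'_def)
  also have "\<dots> \<le> s\<^sup>2 * b / 2 * real (card (past_change A k v)) + \<bar>s\<bar> * \<bar>\<Sum>j\<in>past_change A k v. \<phi> (x j)\<bar>"
    using add_mono[OF HH II] by simp
  finally show ?thesis
    unfolding weight_def H_def H'_def I_def I'_def .
qed

text \<open>
  The weights hardly change under a translation by an element of \<open>E\<close>, because only few points change
  sides and the sum over them is small in \<open>L\<^sup>2\<close>. Hence \<open>f\<close> may be replaced by its average over the
  translations in \<open>E\<close>, to which the ergodic theorem applies.
\<close>

lemma weighted_average_le:
  assumes A: "finite A" and \<phi>: "admissible \<phi>"
    and \<eta>: "\<eta> \<in> borel_measurable \<I>" "\<And>x. 0 \<le> \<eta> x" "\<And>x. \<eta> x \<le> b"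
    and f [measurable]: "f \<in> borel_measurable borel" and fF: "\<And>x. \<bar>f x\<bar> \<le> F"
    and E: "finite E" "card E > 0" and c: "0 < c"
    and exit: "\<And>v. v \<in> E \<Longrightarrow> real (card {k \<in> A. k + v \<notin> A}) \<le> c"
    and change: "\<And>v k. v \<in> E \<Longrightarrow> real (card (past_change A k v)) \<le> c"
  shows "cmod (\<Sum>k\<in>A. \<integral>x. weight \<phi> \<eta> s A k x * of_real (f (field_shift k x) - \<eta> x) \<partial>P)
    \<le> real (card A) * (\<integral>x. \<bar>shift_average E f x - \<eta> x\<bar> \<partial>P)
      + (2 * F * c + real (card A) * (F * (s\<^sup>2 * b / 2 * c + \<bar>s\<bar> * sqrt (c * (infsum cov_bound UNIV + 1)))))"
proof -
  have F: "0 \<le> F" using fF[of undefined] by linarith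
  have b: "0 \<le> b" using \<eta>(2,3) order_trans by blast
  have \<kappa>0: "0 \<le> infsum cov_bound UNIV" by (rule infsum_nonneg) (rule cov_bound_nonneg)
  have [measurable]: "\<phi> \<in> borel_measurable borel" by (rule admissible_measurable[OF \<phi>])
  have [measurable]: "\<eta> \<in> borel_measurable borel" using \<eta> by (intro measurable_\<I>_borel)
  define w where "w k = weight \<phi> \<eta> s A k" for k
  have [measurable]: "w k \<in> borel_measurable borel" for k unfolding w_def by measurable
  have w1: "cmod (w k x) \<le> 1" for k x
    unfolding w_def by (rule norm_weight_le) (rule \<eta>)
  have iwg: "integrable P (\<lambda>x. w k x * of_real (g x))"
    if [measurable]: "g \<in> borel_measurable borel" and "\<And>x. \<bar>g x\<bar> \<le> G" for g k G
  proof (rule integrable_bounded)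
    fix x show "norm (w k x * of_real (g x)) \<le> 1 * G"
      unfolding norm_mult norm_of_real using w1 that(2) by (intro mult_mono) auto
  qed measurable
  define I where "I k l = (\<integral>x. w k x * of_real (f (field_shift l x)) \<partial>P)" for k l
  have iI: "integrable P (\<lambda>x. w k x * of_real (f (field_shift l x)))" for k l
    by (rule iwg[of _ F]) (use fF in auto)
  have Ib: "cmod (I k l) \<le> F" for k l
  proof -
    have "cmod (I k l) \<le> (\<integral>x. cmod (w k x * of_real (f (field_shift l x))) \<partial>P)"
      unfolding I_def by (rule integral_norm_bound)
    also have "\<dots> \<le> (\<integral>x. F \<partial>P)"
    proof (rule integral_mono)
      show "cmod (w k x * of_real (f (field_shift l x))) \<le> F" for x
        unfolding norm_mult norm_of_real using mult_mono[OF w1[of k x] fF[of "field_shift l x"]] by simp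
    qed (use iI in auto)
    finally show ?thesis by simp
  qed
  define dv where "dv = s\<^sup>2 * b / 2 * c + \<bar>s\<bar> * sqrt (c * (infsum cov_bound UNIV + 1))"
  have move: "cmod (I (k + v) l - I k l) \<le> F * dv" if v: "v \<in> E" for k v l
  proof -
    define Q where "Q = past_change A k v"
    have Q: "finite Q" "real (card Q) \<le> c" using A change[OF v] by (auto simp: Q_def past_change_def)
    define g where "g x = (\<Sum>j\<in>Q. \<phi> (x j))" for x :: "'m lattice \<Rightarrow> real"
    have g2: "integrable P (\<lambda>x. (g x)\<^sup>2)" "(\<integral>x. (g x)\<^sup>2 \<partial>P) \<le> real (card Q) * infsum cov_bound UNIV"
    proof -
      have cov: "\<bar>\<integral>x. \<phi> (x 0) * \<phi> (x k) \<partial>P\<bar> \<le> cov_bound k" for k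
        using covariance_le_cov_bound[OF \<phi>, of "\<lambda>_. 1" k] by simp
      show "integrable P (\<lambda>x. (g x)\<^sup>2)" "(\<integral>x. (g x)\<^sup>2 \<partial>P) \<le> real (card Q) * infsum cov_bound UNIV"
        unfolding g_def by (rule second_moment_sum_le[OF \<phi> Q(1) cov_bound_summable cov])+
    qed
    have gi: "integrable P g"
      unfolding g_def using \<phi> integrable_lipschitz_coordinate by (auto simp: admissible_def)
    have "(\<integral>x. (g x)\<^sup>2 \<partial>P) \<le> c * (infsum cov_bound UNIV + 1)"
      using g2(2) mult_mono[OF Q(2), of "infsum cov_bound UNIV" "infsum cov_bound UNIV + 1"] c \<kappa>0 by simp
    also have "\<dots> = (sqrt (c * (infsum cov_bound UNIV + 1)))\<^sup>2" using c \<kappa>0 by simp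
    finally have ga: "(\<integral>x. \<bar>g x\<bar> \<partial>P) \<le> sqrt (c * (infsum cov_bound UNIV + 1))"
      using g2(1) gi c \<kappa>0 by (intro expectation_abs_le_if_square_le) auto
    have "I (k + v) l - I k l = (\<integral>x. (w (k + v) x - w k x) * of_real (f (field_shift l x)) \<partial>P)"
      unfolding I_def using iI by (simp add: left_diff_distrib)
    also have "cmod \<dots> \<le> (\<integral>x. cmod ((w (k + v) x - w k x) * of_real (f (field_shift l x))) \<partial>P)"
      by (rule integral_norm_bound)
    also have "\<dots> \<le> (\<integral>x. (s\<^sup>2 * b / 2 * c + \<bar>s\<bar> * \<bar>g x\<bar>) * F \<partial>P)"
    proof (rule integral_mono)
      show "integrable P (\<lambda>x. cmod ((w (k + v) x - w k x) * of_real (f (field_shift l x))))"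
        unfolding left_diff_distrib using iI by (intro integrable_norm Bochner_Integration.integrable_diff)
      show "integrable P (\<lambda>x. (s\<^sup>2 * b / 2 * c + \<bar>s\<bar> * \<bar>g x\<bar>) * F)" using gi by auto
      fix x
      have "cmod (w (k + v) x - w k x) \<le> s\<^sup>2 * b / 2 * real (card Q) + \<bar>s\<bar> * \<bar>g x\<bar>"
        unfolding w_def Q_def g_def by (rule weight_shift_le[of A \<eta> x b, OF A \<eta>(2) \<eta>(3)])
      also have "\<dots> \<le> s\<^sup>2 * b / 2 * c + \<bar>s\<bar> * \<bar>g x\<bar>"
        using Q(2) b by (intro add_right_mono mult_left_mono) auto
      finally show "cmod ((w (k + v) x - w k x) * of_real (f (field_shift l x)))
          \<le> (s\<^sup>2 * b / 2 * c + \<bar>s\<bar> * \<bar>g x\<bar>) * F"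
        unfolding norm_mult norm_of_real using fF b c by (intro mult_mono) auto
    qed
    also have "\<dots> = (s\<^sup>2 * b / 2 * c + \<bar>s\<bar> * (\<integral>x. \<bar>g x\<bar> \<partial>P)) * F" using gi by simp
    also have "\<dots> \<le> F * dv"
      unfolding dv_def using ga F by (subst mult.commute) (intro mult_left_mono add_left_mono, auto)
    finally show ?thesis .
  qed
  define X where "X = (\<Sum>k\<in>A. I k k)"
  define Y where "Y v = (\<Sum>k\<in>A. I k (k + v))" for v
  define Z where "Z = (\<Sum>k\<in>A. \<integral>x. w k x * of_real (\<eta> x) \<partial>P)"
  define R where "R = 2 * F * c + real (card A) * (F * dv)"
  have XY: "cmod (X - Y v) \<le> R" if v: "v \<in> E" for v
  proof -
    have "cmod ((\<Sum>k\<in>A. I (k + v) (k + v)) - X) \<le> 2 * F * real (card {k \<in> A. k + v \<notin> A})"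
      unfolding X_def by (rule sum_translate_diff_le[OF A]) (rule Ib)
    also have "\<dots> \<le> 2 * F * c" using exit[OF v] F by (intro mult_left_mono) auto
    finally have 1: "cmod (X - (\<Sum>k\<in>A. I (k + v) (k + v))) \<le> 2 * F * c"
      by (simp add: norm_minus_commute)
    have "cmod ((\<Sum>k\<in>A. I (k + v) (k + v)) - Y v) \<le> (\<Sum>k\<in>A. F * dv)"
      unfolding Y_def sum_subtractf[symmetric] by (intro sum_norm_le move v)
    then show ?thesis
      using norm_triangle_ineq[of "X - (\<Sum>k\<in>A. I (k + v) (k + v))" "(\<Sum>k\<in>A. I (k + v) (k + v)) - Y v"] 1
      by (simp add: R_def)
  qed
  have EX: "X = (\<Sum>v\<in>E. Y v) / of_nat (card E) + (\<Sum>v\<in>E. X - Y v) / of_nat (card E)"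
  proof -
    have "complex_of_nat (card E) \<noteq> 0" using E by auto
    then show ?thesis by (simp add: sum_subtractf diff_divide_distrib)
  qed
  have "cmod ((\<Sum>v\<in>E. X - Y v) / of_nat (card E)) \<le> (\<Sum>v\<in>E. R) / real (card E)"
    unfolding norm_divide norm_of_nat by (intro divide_right_mono sum_norm_le XY) auto
  also have "\<dots> = R" using E by (auto simp: card_gt_0_iff)
  finally have part1: "cmod ((\<Sum>v\<in>E. X - Y v) / of_nat (card E)) \<le> R" .
  have iSA: "integrable P (\<lambda>x. w k x * of_real (shift_average E f (field_shift k x)))" for k
    by (rule iwg[of _ F]) (use shift_average_bounded[of f F, OF fF] in auto)
  have i\<eta>: "integrable P (\<lambda>x. w k x * of_real (\<eta> x))" for k
    by (rule iwg[of _ b]) (use \<eta> in auto)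
  have "(\<Sum>v\<in>E. Y v) / of_nat (card E) = (\<Sum>k\<in>A. \<integral>x. w k x * of_real (shift_average E f (field_shift k x)) \<partial>P)"
  proof -
    have "(\<integral>x. w k x * of_real (shift_average E f (field_shift k x)) \<partial>P) = (\<Sum>v\<in>E. I k (k + v)) / of_nat (card E)" for k
    proof -
      have "(\<integral>x. w k x * of_real (shift_average E f (field_shift k x)) \<partial>P)
          = (\<integral>x. (\<Sum>v\<in>E. w k x * of_real (f (field_shift (k + v) x))) / of_nat (card E) \<partial>P)"
        by (simp add: shift_average_def field_shift_field_shift sum_distrib_left add.commute[of _ k])
      also have "\<dots> = (\<Sum>v\<in>E. I k (k + v)) / of_nat (card E)"
        unfolding I_def using iI by simp
      finally show ?thesis .
    qed
    then show ?thesis unfolding Y_def sum_divide_distrib[symmetric]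
      by (simp add: sum.swap[of _ E] sum_divide_distrib[symmetric])
  qed
  then have "(\<Sum>v\<in>E. Y v) / of_nat (card E) - Z
      = (\<Sum>k\<in>A. \<integral>x. w k x * of_real (shift_average E f (field_shift k x) - \<eta> x) \<partial>P)"
    unfolding Z_def using iSA i\<eta> by (simp add: sum_subtractf right_diff_distrib)
  also have "cmod \<dots> \<le> (\<Sum>k\<in>A. \<integral>x. \<bar>shift_average E f x - \<eta> x\<bar> \<partial>P)"
  proof (rule sum_norm_le)
    fix k assume "k \<in> A"
    define D where "D x = \<bar>shift_average E f x - \<eta> x\<bar>" for x
    have [measurable]: "D \<in> borel_measurable borel" unfolding D_def by measurable
    have Di: "integrable P D"
      unfolding D_def using shift_average_bounded[of f F, OF fF] \<eta>
      by (intro integrable_abs Bochner_Integration.integrable_diff integrable_bounded[of _ F] integrable_bounded[of _ b])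
         auto
    have "cmod (\<integral>x. w k x * of_real (shift_average E f (field_shift k x) - \<eta> x) \<partial>P)
        \<le> (\<integral>x. cmod (w k x * of_real (shift_average E f (field_shift k x) - \<eta> x)) \<partial>P)"
      by (rule integral_norm_bound)
    also have "\<dots> \<le> (\<integral>x. D (field_shift k x) \<partial>P)"
    proof (rule integral_mono)
      show "integrable P (\<lambda>x. cmod (w k x * of_real (shift_average E f (field_shift k x) - \<eta> x)))"
        using iSA i\<eta> by (intro integrable_norm) (simp add: right_diff_distrib)
      show "integrable P (\<lambda>x. D (field_shift k x))" by (rule integrable_shift[OF Di])
      fix x
      show "cmod (w k x * of_real (shift_average E f (field_shift k x) - \<eta> x)) \<le> D (field_shift k x)"
        unfolding D_def norm_mult norm_of_real \<I>_measurable_shift[OF \<eta>(1)]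
        using w1[of k x] by (intro mult_left_le_one_le) auto
    qed
    also have "\<dots> = (\<integral>x. D x \<partial>P)" by (rule integral_shift) measurable
    finally show "cmod (\<integral>x. w k x * of_real (shift_average E f (field_shift k x) - \<eta> x) \<partial>P)
        \<le> (\<integral>x. \<bar>shift_average E f x - \<eta> x\<bar> \<partial>P)" by (simp add: D_def)
  qed
  finally have part2: "cmod ((\<Sum>v\<in>E. Y v) / of_nat (card E) - Z)
      \<le> real (card A) * (\<integral>x. \<bar>shift_average E f x - \<eta> x\<bar> \<partial>P)" by simp
  have "(\<Sum>k\<in>A. \<integral>x. weight \<phi> \<eta> s A k x * of_real (f (field_shift k x) - \<eta> x) \<partial>P) = X - Z"
    unfolding X_def Z_def I_def w_def[symmetric] using iI i\<eta>
    by (simp add: sum_subtractf right_diff_distrib)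
  also have "X - Z = ((\<Sum>v\<in>E. Y v) / of_nat (card E) - Z) + (\<Sum>v\<in>E. X - Y v) / of_nat (card E)"
    using EX by (simp add: algebra_simps)
  finally have "cmod (\<Sum>k\<in>A. \<integral>x. weight \<phi> \<eta> s A k x * of_real (f (field_shift k x) - \<eta> x) \<partial>P)
    \<le> cmod ((\<Sum>v\<in>E. Y v) / of_nat (card E) - Z) + cmod ((\<Sum>v\<in>E. X - Y v) / of_nat (card E))"
    by (simp only: norm_triangle_ineq)
  then show ?thesis using part1 part2 unfolding R_def dv_def by linarith
qed

text \<open>
  All error terms but two vanish along a Folner sequence. The remaining ones are the tail of the
  coefficients beyond distance \<open>M\<close> and the distance between \<open>\<eta>\<close> and the conditional local variance.
\<close>

theorem bounded_comparison:
  assumes fol: "folner D" and inf: "filterlim (\<lambda>n. card (D n)) at_top sequentially"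
    and \<phi>: "admissible \<phi>" and \<phi>B: "\<And>y. \<bar>\<phi> y\<bar> \<le> B"
    and \<eta>: "\<eta> \<in> borel_measurable \<I>" "\<And>x. 0 \<le> \<eta> x" "\<And>x. \<eta> x \<le> b" and M: "h0 \<le> M" and e: "0 < e"
  shows "\<forall>\<^sub>F n in sequentially.
    cmod ((\<integral>x. iexp (u / sqrt (real (card (D n))) * (\<Sum>j\<in>D n. \<phi> (x j))) \<partial>P)
        - (\<integral>x. of_real (exp (- (u\<^sup>2 * \<eta> x / 2))) \<partial>P))
    \<le> u\<^sup>2 * B * infsum rate {v. int M < sup_norm v}
      + u\<^sup>2 / 2 * (\<integral>x. \<bar>real_cond_exp P \<I> (local_variance \<phi> M) x - \<eta> x\<bar> \<partial>P) + e"
proof -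
  have B: "0 \<le> B" using \<phi>B[of 0] by linarith
  have b: "0 \<le> b" using \<eta>(2,3) order_trans by blast
  have [measurable]: "\<phi> \<in> borel_measurable borel" by (rule admissible_measurable[OF \<phi>])
  have [measurable]: "\<eta> \<in> borel_measurable borel" using \<eta> by (intro measurable_\<I>_borel)
  define f where "f = local_variance \<phi> M"
  have f [measurable]: "f \<in> borel_measurable borel" unfolding f_def by measurable
  define F where "F = B\<^sup>2 + 2 * (real (card (near M :: 'm lattice set)) * B\<^sup>2)"
  have fF: "\<bar>f x\<bar> \<le> F" for x unfolding f_def F_def by (rule local_variance_bounded[OF \<phi>B])
  have F: "0 \<le> F" by (simp add: F_def)
  define ce where "ce = real_cond_exp P \<I> f"
  define c1 where "c1 = B ^ 3 / 6 + B ^ 3 * (real (card (near M :: 'm lattice set)))\<^sup>2 / 2"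
  define c2 where "c2 = b\<^sup>2 / 8"
  define q where "q = real (card (near M :: 'm lattice set))"
  define \<kappa> where "\<kappa> = infsum cov_bound UNIV + 1"
  define G where "G \<epsilon> = u\<^sup>2 * (\<epsilon> * c1 + \<epsilon>\<^sup>2 * c2) + u\<^sup>2 * B\<^sup>2 * (q * \<epsilon>)
      + u\<^sup>2 / 2 * (2 * F * \<epsilon> + F * (u\<^sup>2 * b / 2 * \<epsilon> + \<bar>u\<bar> * sqrt (\<epsilon> * \<kappa>)))" for \<epsilon>
  \<comment> \<open>\<open>G\<close> collects the vanishing errors when all proportions are at most \<open>\<epsilon>\<close>\<close>
  have "(G \<longlongrightarrow> G 0) (at_right 0)"
    unfolding G_def[abs_def] by (intro tendsto_intros)
  moreover have "G 0 = 0" by (simp add: G_def)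
  ultimately have "\<forall>\<^sub>F \<epsilon> in at_right 0. G \<epsilon> < e / 2"
    using e by (intro order_tendstoD(2)[of G 0]) auto
  then obtain \<epsilon> where \<epsilon>: "0 < \<epsilon>" "G \<epsilon> < e / 2"
    using eventually_happens'[OF _ eventually_conj[OF eventually_at_right_less[of 0]], of "\<lambda>\<epsilon>. G \<epsilon> < e / 2"]
    by auto
  have "(\<lambda>n. \<integral>x. \<bar>shift_average (D n) f x - ce x\<bar> \<partial>P) \<longlonglongrightarrow> 0"
    unfolding ce_def by (rule mean_ergodic[OF fol f fF])
  then have "\<forall>\<^sub>F n in sequentially. (\<integral>x. \<bar>shift_average (D n) f x - ce x\<bar> \<partial>P) < e / (u\<^sup>2 + 1)"
    using e by (intro order_tendstoD) (auto simp: add_nonneg_pos)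
  from eventually_happens'[OF _ eventually_conj[OF this folner_eventually_pos[OF fol]]]
  obtain p where p: "(\<integral>x. \<bar>shift_average (D p) f x - ce x\<bar> \<partial>P) < e / (u\<^sup>2 + 1)" "0 < card (D p)"
    by auto
  define E where "E = D p"
  have E: "finite E" "0 < card E" using p(2) folner_finite[OF fol] by (auto simp: E_def)
  have fi: "integrable P f" by (rule integrable_bounded[OF f]) (use fF in auto)
  have cei: "integrable P ce" unfolding ce_def using fi by (rule real_cond_exp_int)
  have "(\<integral>x. \<bar>shift_average E f x - \<eta> x\<bar> \<partial>P) \<le> (\<integral>x. \<bar>shift_average E f x - ce x\<bar> + \<bar>ce x - \<eta> x\<bar> \<partial>P)"
    using shift_average_bounded[of f F, OF fF] \<eta> cei
    by (intro integral_mono integrable_abs Bochner_Integration.integrable_diff Bochner_Integration.integrable_add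
        integrable_bounded[of "shift_average E f" F] integrable_bounded[of \<eta> b]) auto
  also have "\<dots> = (\<integral>x. \<bar>shift_average E f x - ce x\<bar> \<partial>P) + (\<integral>x. \<bar>ce x - \<eta> x\<bar> \<partial>P)"
    using shift_average_bounded[of f F, OF fF] \<eta> cei
    by (intro Bochner_Integration.integral_add integrable_abs Bochner_Integration.integrable_diff
        integrable_bounded[of "shift_average E f" F] integrable_bounded[of \<eta> b]) auto
  finally have avg: "(\<integral>x. \<bar>shift_average E f x - \<eta> x\<bar> \<partial>P) \<le> e / (u\<^sup>2 + 1) + (\<integral>x. \<bar>ce x - \<eta> x\<bar> \<partial>P)"
    using p(1) by (simp add: E_def)
  have "u\<^sup>2 / 2 * (e / (u\<^sup>2 + 1)) \<le> e / 2"
  proof -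
    have "u\<^sup>2 / (u\<^sup>2 + 1) \<le> 1" by (subst divide_le_eq_1_pos) (auto simp: add_nonneg_pos)
    then have "e / 2 * (u\<^sup>2 / (u\<^sup>2 + 1)) \<le> e / 2 * 1" using e by (intro mult_left_mono) auto
    then show ?thesis by (simp add: mult.commute)
  qed
  then have avg: "u\<^sup>2 / 2 * (\<integral>x. \<bar>shift_average E f x - \<eta> x\<bar> \<partial>P) \<le> e / 2 + u\<^sup>2 / 2 * (\<integral>x. \<bar>ce x - \<eta> x\<bar> \<partial>P)"
    using mult_left_mono[OF avg, of "u\<^sup>2 / 2"] by (simp add: distrib_left)
  have exE: "\<forall>\<^sub>F n in sequentially. \<forall>v\<in>E \<union> near M. real (card {k \<in> D n. k + v \<notin> D n}) \<le> \<epsilon> * real (card (D n))"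
    using E finite_near by (intro eventually_ball_finite ballI folner_eventually_exit_le[OF fol \<epsilon>(1)]) auto
  have chE: "\<forall>\<^sub>F n in sequentially. \<forall>v\<in>E. \<forall>k. real (card (past_change (D n) k v)) \<le> \<epsilon> * real (card (D n))"
    unfolding past_change_def
    using E by (intro eventually_ball_finite ballI folner_lex_past_stable[OF fol \<epsilon>(1)]) auto
  have "(\<lambda>n. \<bar>u\<bar> / sqrt (real (card (D n)))) \<longlonglongrightarrow> 0"
    by (intro real_tendsto_divide_at_top[OF tendsto_const] filterlim_compose[OF sqrt_at_top]
        filterlim_compose[OF filterlim_real_sequentially inf])
  then have sE: "\<forall>\<^sub>F n in sequentially. \<bar>u\<bar> / sqrt (real (card (D n))) < \<epsilon>"
    using \<epsilon> by (intro order_tendstoD)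
  from exE chE sE folner_eventually_pos[OF fol] show ?thesis
  proof eventually_elim
    case (elim n)
    define A where "A = D n"
    define N where "N = real (card A)"
    define s where "s = u / sqrt N"
    have A: "finite A" using folner_finite[OF fol] by (simp add: A_def)
    have N: "0 < N" using elim(4) by (simp add: N_def A_def)
    have s2: "s\<^sup>2 * N = u\<^sup>2" using N by (simp add: s_def power_divide)
    have sle: "\<bar>s\<bar> \<le> \<epsilon>" using elim(3) N by (simp add: s_def N_def A_def abs_divide)
    have s2le: "s\<^sup>2 \<le> \<epsilon>\<^sup>2" using sle \<epsilon>(1) by (simp add: abs_le_square_iff[symmetric])
    have c: "0 < \<epsilon> * N" using \<epsilon> N by simp
    define J where "J = cmod (\<Sum>k\<in>A. \<integral>x. weight \<phi> \<eta> s A k x * of_real (f (field_shift k x) - \<eta> x) \<partial>P)"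
    have J: "J \<le> N * (\<integral>x. \<bar>shift_average E f x - \<eta> x\<bar> \<partial>P)
      + (2 * F * (\<epsilon> * N) + N * (F * (s\<^sup>2 * b / 2 * (\<epsilon> * N) + \<bar>s\<bar> * sqrt (\<epsilon> * N * \<kappa>))))"
      unfolding J_def N_def \<kappa>_def
      by (rule weighted_average_le[OF A \<phi> \<eta> f fF E])
         (use c elim(1,2) in \<open>auto simp: A_def N_def\<close>)
    have r1: "s\<^sup>2 * b / 2 * (\<epsilon> * N) = u\<^sup>2 * b / 2 * \<epsilon>" using s2[symmetric] by simp
    have r2: "\<bar>s\<bar> * sqrt (\<epsilon> * N * \<kappa>) = \<bar>u\<bar> * sqrt (\<epsilon> * \<kappa>)"
      using N by (simp add: s_def abs_divide real_sqrt_mult)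
    have "s\<^sup>2 / 2 * J \<le> s\<^sup>2 / 2 * (N * (\<integral>x. \<bar>shift_average E f x - \<eta> x\<bar> \<partial>P)
      + (2 * F * (\<epsilon> * N) + N * (F * (u\<^sup>2 * b / 2 * \<epsilon> + \<bar>u\<bar> * sqrt (\<epsilon> * \<kappa>)))))"
      using J unfolding r1 r2 by (intro mult_left_mono) simp_all
    also have "\<dots> = (s\<^sup>2 * N) / 2 * (\<integral>x. \<bar>shift_average E f x - \<eta> x\<bar> \<partial>P)
      + (s\<^sup>2 * N) / 2 * (2 * F * \<epsilon> + F * (u\<^sup>2 * b / 2 * \<epsilon> + \<bar>u\<bar> * sqrt (\<epsilon> * \<kappa>)))"
      by (simp add: algebra_simps)
    finally have J2: "s\<^sup>2 / 2 * J \<le> u\<^sup>2 / 2 * (\<integral>x. \<bar>shift_average E f x - \<eta> x\<bar> \<partial>P)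
      + u\<^sup>2 / 2 * (2 * F * \<epsilon> + F * (u\<^sup>2 * b / 2 * \<epsilon> + \<bar>u\<bar> * sqrt (\<epsilon> * \<kappa>)))"
      unfolding s2 .
    have t3: "N * (\<bar>s\<bar> ^ 3 * c1 + s ^ 4 * c2) \<le> u\<^sup>2 * (\<epsilon> * c1 + \<epsilon>\<^sup>2 * c2)"
    proof -
      have s3: "\<bar>s\<bar> ^ 3 = s\<^sup>2 * \<bar>s\<bar>" by (simp add: power3_eq_cube power2_eq_square)
      have s4: "s ^ 4 = s\<^sup>2 * s\<^sup>2" by (simp add: power4_eq_xxxx power2_eq_square)
      have "N * (\<bar>s\<bar> ^ 3 * c1 + s ^ 4 * c2) = (s\<^sup>2 * N) * (\<bar>s\<bar> * c1 + s\<^sup>2 * c2)"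
        unfolding s3 s4 by (simp only: distrib_left mult.assoc mult.commute mult.left_commute)
      also have "\<dots> \<le> (s\<^sup>2 * N) * (\<epsilon> * c1 + \<epsilon>\<^sup>2 * c2)"
        using sle s2le B N by (intro mult_left_mono add_mono mult_right_mono) (auto simp: c1_def c2_def)
      finally show ?thesis unfolding s2 .
    qed
    have t4: "s\<^sup>2 * B\<^sup>2 * (\<Sum>v\<in>near M. real (card {k \<in> A. k + v \<notin> A})) \<le> u\<^sup>2 * B\<^sup>2 * (q * \<epsilon>)"
    proof -
      have "(\<Sum>v\<in>near M. real (card {k \<in> A. k + v \<notin> A})) \<le> (\<Sum>v\<in>(near M :: 'm lattice set). \<epsilon> * N)"
        using elim(1) by (intro sum_mono) (auto simp: A_def N_def)
      then have "s\<^sup>2 * B\<^sup>2 * (\<Sum>v\<in>near M. real (card {k \<in> A. k + v \<notin> A})) \<le> s\<^sup>2 * B\<^sup>2 * (q * (\<epsilon> * N))"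
        by (intro mult_left_mono) (auto simp: q_def)
      also have "\<dots> = (s\<^sup>2 * N) * B\<^sup>2 * (q * \<epsilon>)" by simp
      finally show ?thesis unfolding s2 .
    qed
    have t1: "N * (s\<^sup>2 * B * infsum rate {v. int M < sup_norm v}) = u\<^sup>2 * B * infsum rate {v. int M < sup_norm v}"
      using s2[symmetric] by simp
    have u2: "s\<^sup>2 * real (card A) * \<eta> x / 2 = u\<^sup>2 * \<eta> x / 2" for x using s2 by (simp add: N_def)
    have "cmod ((\<integral>x. iexp (s * (\<Sum>j\<in>A. \<phi> (x j))) \<partial>P) - (\<integral>x. of_real (exp (- (u\<^sup>2 * \<eta> x / 2))) \<partial>P))
      \<le> N * (s\<^sup>2 * B * infsum rate {v. int M < sup_norm v}) + s\<^sup>2 / 2 * J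
        + N * (\<bar>s\<bar> ^ 3 * c1 + s ^ 4 * c2)
        + s\<^sup>2 * B\<^sup>2 * (\<Sum>v\<in>near M. real (card {k \<in> A. k + v \<notin> A}))"
      using comparison_le[OF A \<phi> \<phi>B \<eta> M, of s]
      unfolding J_def N_def f_def c1_def c2_def u2 .
    also have "\<dots> \<le> u\<^sup>2 * B * infsum rate {v. int M < sup_norm v}
        + (u\<^sup>2 / 2 * (\<integral>x. \<bar>shift_average E f x - \<eta> x\<bar> \<partial>P)
           + u\<^sup>2 / 2 * (2 * F * \<epsilon> + F * (u\<^sup>2 * b / 2 * \<epsilon> + \<bar>u\<bar> * sqrt (\<epsilon> * \<kappa>))))
        + u\<^sup>2 * (\<epsilon> * c1 + \<epsilon>\<^sup>2 * c2) + u\<^sup>2 * B\<^sup>2 * (q * \<epsilon>)"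
      unfolding t1 by (intro add_mono order_refl J2 t3 t4)
    also have "\<dots> = u\<^sup>2 * B * infsum rate {v. int M < sup_norm v}
        + u\<^sup>2 / 2 * (\<integral>x. \<bar>shift_average E f x - \<eta> x\<bar> \<partial>P) + G \<epsilon>"
      by (simp add: G_def)
    also have "\<dots> \<le> u\<^sup>2 * B * infsum rate {v. int M < sup_norm v}
        + u\<^sup>2 / 2 * (\<integral>x. \<bar>ce x - \<eta> x\<bar> \<partial>P) + e"
      using avg \<epsilon>(2) by linarith
    finally show ?case
      unfolding s_def N_def A_def ce_def f_def .
  qed
qed

end

section \<open>Series indexed by the lattice\<close>

lemma summable_on_iff_integrable_count_space:
  fixes f :: "'i \<Rightarrow> real"
  shows "f summable_on UNIV \<longleftrightarrow> integrable (count_space UNIV) f"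
  using summable_on_iff_abs_summable_on_real[of f UNIV] abs_summable_equivalent[of f UNIV]
    Infinite_Set_Sum.abs_summable_on_def[of f UNIV] by blast

lemma infsum_eq_integral_count_space:
  fixes f :: "'i \<Rightarrow> real"
  shows "infsum f UNIV = (\<integral>i. f i \<partial>count_space UNIV)"
proof (cases "f summable_on UNIV")
  case True
  then have "Infinite_Set_Sum.abs_summable_on f UNIV"
    by (simp add: Infinite_Set_Sum.abs_summable_on_def summable_on_iff_integrable_count_space)
  then show ?thesis using infsetsum_infsum[of f UNIV] by (simp add: infsetsum_def)
next
  case False
  then show ?thesis
    using not_integrable_integral_eq summable_on_iff_integrable_count_space[of f]
    by (simp add: infsum_not_exists not_integrable_integral_eq)
qed

lemma infsum_dominated_convergence:
  fixes f :: "nat \<Rightarrow> 'i \<Rightarrow> real"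
  assumes "g summable_on UNIV" "\<And>n k. \<bar>f n k\<bar> \<le> g k" "\<And>k. (\<lambda>n. f n k) \<longlonglongrightarrow> l k"
  shows "(\<lambda>n. infsum (f n) UNIV) \<longlonglongrightarrow> infsum l UNIV"
  unfolding infsum_eq_integral_count_space
  by (rule integral_dominated_convergence[where w = g])
     (use assms in \<open>auto simp: summable_on_iff_integrable_count_space AE_count_space\<close>)

lemma infsum_restrict_finite:
  fixes f :: "'i \<Rightarrow> real"
  assumes "finite B"
  shows "infsum (\<lambda>k. if k \<in> B then f k else 0) UNIV = sum f B"
proof -
  have "infsum (\<lambda>k. if k \<in> B then f k else 0) UNIV = infsum f B"
    by (rule infsum_cong_neutral) auto
  then show ?thesis using assms by simp
qed

lemma sum_exhaustion_tendsto:
  fixes f :: "'i \<Rightarrow> real"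
  assumes f: "f summable_on UNIV" and B: "\<And>n. finite (B n)" "\<And>k. \<forall>\<^sub>F n in sequentially. k \<in> B n"
  shows "(\<lambda>n. sum f (B n)) \<longlonglongrightarrow> infsum f UNIV"
proof -
  have "(\<lambda>n. infsum (\<lambda>k. if k \<in> B n then f k else 0) UNIV) \<longlonglongrightarrow> infsum f UNIV"
  proof (rule infsum_dominated_convergence)
    show "(\<lambda>k. \<bar>f k\<bar>) summable_on UNIV"
      using f summable_on_iff_abs_summable_on_real[of f UNIV] by simp
    show "(\<lambda>n. if k \<in> B n then f k else 0) \<longlonglongrightarrow> f k" for k
      by (rule tendsto_eventually) (use B(2)[of k] in eventually_elim, simp)
  qed auto
  then show ?thesis using B(1) by (simp add: infsum_restrict_finite)
qed

lemma infsum_outside_tendsto_0: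
  fixes f :: "'i \<Rightarrow> real"
  assumes f: "f summable_on UNIV" and B: "\<And>k. \<forall>\<^sub>F n in sequentially. k \<in> B n"
  shows "(\<lambda>n. infsum f (- B n)) \<longlonglongrightarrow> 0"
proof -
  have "(\<lambda>n. infsum (\<lambda>k. if k \<in> B n then 0 else f k) UNIV) \<longlonglongrightarrow> infsum (\<lambda>_ :: 'i. 0 :: real) UNIV"
  proof (rule infsum_dominated_convergence)
    show "(\<lambda>k. \<bar>f k\<bar>) summable_on UNIV"
      using f summable_on_iff_abs_summable_on_real[of f UNIV] by simp
    show "(\<lambda>n. if k \<in> B n then 0 else f k) \<longlonglongrightarrow> 0" for k
      by (rule tendsto_eventually) (use B[of k] in eventually_elim, simp)
  qed auto
  moreover have "infsum (\<lambda>k. if k \<in> B n then 0 else f k) UNIV = infsum f (- B n)" for n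
    by (rule infsum_cong_neutral) auto
  ultimately show ?thesis by simp
qed

text \<open>
  An unordered sum of reals is the integral with respect to the counting measure, including the
  default value \<open>0\<close> where the sum does not exist.
\<close>

lemma infsum_measurable:
  fixes c :: "'i::countable \<Rightarrow> 'a \<Rightarrow> real"
  assumes [measurable]: "\<And>k. c k \<in> borel_measurable N"
  shows "(\<lambda>x. infsum (\<lambda>k. c k x) UNIV) \<in> borel_measurable N"
proof -
  interpret sigma_finite_measure "count_space (UNIV :: 'i set)" by (rule sigma_finite_measure_count_space)
  show ?thesis
    unfolding infsum_eq_integral_count_space
  proof (rule borel_measurable_lebesgue_integral)
    show "case_prod (\<lambda>x k. c k x) \<in> borel_measurable (N \<Otimes>\<^sub>M count_space UNIV)"
      unfolding split_beta'
      by (rule measurable_compose_countable'[where f = "\<lambda>k p. c k (fst p)" and g = snd and I = UNIV]) auto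
  qed
qed

text \<open>
  The sum of the absolute values is integrable by Tonelli's theorem and dominates all partial sums.
\<close>

lemma L1_summable_series:
  fixes c :: "'i::countable \<Rightarrow> 'a \<Rightarrow> real"
  assumes c: "\<And>k. integrable N (c k)" and \<kappa>: "\<kappa> summable_on UNIV" "\<And>k. (\<integral>x. \<bar>c k x\<bar> \<partial>N) \<le> \<kappa> k"
  shows "AE x in N. (\<lambda>k. c k x) summable_on UNIV"
    and "integrable N (\<lambda>x. infsum (\<lambda>k. c k x) UNIV)"
    and "\<lbrakk>\<And>n. finite (B n); \<And>k. \<forall>\<^sub>F n in sequentially. k \<in> B n\<rbrakk> \<Longrightarrow>
      (\<lambda>n. \<integral>x. \<bar>(\<Sum>k\<in>B n. c k x) - infsum (\<lambda>k. c k x) UNIV\<bar> \<partial>N) \<longlonglongrightarrow> 0"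
proof -
  have [measurable]: "c k \<in> borel_measurable N" for k using c by blast
  have \<kappa>0: "0 \<le> \<kappa> k" for k using \<kappa>(2)[of k] by (rule order_trans[rotated]) simp
  define W where "W x = (\<integral>\<^sup>+k. ennreal \<bar>c k x\<bar> \<partial>count_space UNIV)" for x
  have "(\<integral>\<^sup>+x. W x \<partial>N) = (\<integral>\<^sup>+k. \<integral>\<^sup>+x. ennreal \<bar>c k x\<bar> \<partial>N \<partial>count_space UNIV)"
    unfolding W_def by (rule nn_integral_count_space_nn_integral) auto
  also have "\<dots> \<le> (\<integral>\<^sup>+k. ennreal (\<kappa> k) \<partial>count_space UNIV)"
  proof (rule nn_integral_mono)
    fix k
    have "(\<integral>\<^sup>+x. ennreal \<bar>c k x\<bar> \<partial>N) = ennreal (\<integral>x. \<bar>c k x\<bar> \<partial>N)"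
      using c by (intro nn_integral_eq_integral) auto
    then show "(\<integral>\<^sup>+x. ennreal \<bar>c k x\<bar> \<partial>N) \<le> ennreal (\<kappa> k)" using \<kappa>(2) by (simp add: ennreal_leI)
  qed
  also have "\<dots> = ennreal (infsum \<kappa> UNIV)"
    unfolding infsum_eq_integral_count_space
    using \<kappa>(1) \<kappa>0 by (intro nn_integral_eq_integral) (auto simp: summable_on_iff_integrable_count_space)
  finally have W: "(\<integral>\<^sup>+x. W x \<partial>N) < \<infinity>" by (simp add: le_less_trans)
  have Weq: "W x = (\<integral>\<^sup>+k. ennreal (norm (c k x)) \<partial>count_space UNIV)" for x by (simp add: W_def)
  have Wm: "W \<in> borel_measurable N"
  proof -
    interpret sigma_finite_measure "count_space (UNIV :: 'i set)" by (rule sigma_finite_measure_count_space)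
    show ?thesis unfolding W_def[abs_def]
    proof (rule borel_measurable_nn_integral)
      show "case_prod (\<lambda>x k. ennreal \<bar>c k x\<bar>) \<in> borel_measurable (N \<Otimes>\<^sub>M count_space UNIV)"
        unfolding split_beta'
        by (rule measurable_compose_countable'[where f = "\<lambda>k p. ennreal \<bar>c k (fst p)\<bar>" and g = snd and I = UNIV])
           auto
    qed
  qed
  have AEW: "AE x in N. W x \<noteq> \<infinity>" by (rule nn_integral_PInf_AE[OF Wm]) (use W in auto)
  show summ: "AE x in N. (\<lambda>k. c k x) summable_on UNIV"
    using AEW by eventually_elim
      (auto simp: summable_on_iff_integrable_count_space Weq less_top intro!: integrableI_bounded)
  define w where "w x = infsum (\<lambda>k. \<bar>c k x\<bar>) UNIV" for x
  have wm: "w \<in> borel_measurable N" unfolding w_def[abs_def] by (rule infsum_measurable) auto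
  have w0: "0 \<le> w x" for x unfolding w_def by (rule infsum_nonneg) simp
  have wi: "integrable N w"
  proof (rule integrableI_bounded[OF wm])
    have "AE x in N. ennreal (norm (w x)) \<le> W x"
      using summ
    proof eventually_elim
      case (elim x)
      then have "integrable (count_space UNIV) (\<lambda>k. \<bar>c k x\<bar>)"
        by (simp add: summable_on_iff_integrable_count_space)
      then have "ennreal (w x) = W x"
        unfolding w_def W_def infsum_eq_integral_count_space by (intro nn_integral_eq_integral[symmetric]) auto
      then show ?case using w0 by simp
    qed
    then have "(\<integral>\<^sup>+x. ennreal (norm (w x)) \<partial>N) \<le> (\<integral>\<^sup>+x. W x \<partial>N)" by (rule nn_integral_mono_AE)
    then show "(\<integral>\<^sup>+x. ennreal (norm (w x)) \<partial>N) < \<infinity>" using W by (rule le_less_trans)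
  qed
  have sm: "(\<lambda>x. infsum (\<lambda>k. c k x) UNIV) \<in> borel_measurable N" by (rule infsum_measurable) auto
  have le: "\<bar>infsum (\<lambda>k. c k x) UNIV\<bar> \<le> w x" for x
    unfolding w_def infsum_eq_integral_count_space by (rule integral_abs_bound)
  show "integrable N (\<lambda>x. infsum (\<lambda>k. c k x) UNIV)"
    by (rule Bochner_Integration.integrable_bound[OF wi sm]) (use le w0 in auto)
  assume B: "\<And>n. finite (B n)" "\<And>k. \<forall>\<^sub>F n in sequentially. k \<in> B n"
  have "(\<lambda>n. \<integral>x. \<bar>(\<Sum>k\<in>B n. c k x) - infsum (\<lambda>k. c k x) UNIV\<bar> \<partial>N) \<longlonglongrightarrow> (\<integral>x. 0 \<partial>N)"
  proof (rule integral_dominated_convergence[where w = "\<lambda>x. 2 * w x"])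
    show "AE x in N. (\<lambda>n. \<bar>(\<Sum>k\<in>B n. c k x) - infsum (\<lambda>k. c k x) UNIV\<bar>) \<longlonglongrightarrow> 0"
      using summ
    proof eventually_elim
      case (elim x)
      show ?case by (intro tendsto_rabs_zero LIM_zero sum_exhaustion_tendsto elim B)
    qed
    show "AE x in N. norm \<bar>(\<Sum>k\<in>B n. c k x) - infsum (\<lambda>k. c k x) UNIV\<bar> \<le> 2 * w x" for n
      using summ
    proof eventually_elim
      case (elim x)
      then have "(\<lambda>k. \<bar>c k x\<bar>) summable_on UNIV"
        using summable_on_iff_abs_summable_on_real[of "\<lambda>k. c k x" UNIV] by simp
      then have "(\<Sum>k\<in>B n. \<bar>c k x\<bar>) \<le> w x"
        unfolding w_def using B(1) by (intro finite_sum_le_infsum) auto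
      then have "\<bar>\<Sum>k\<in>B n. c k x\<bar> \<le> w x" using sum_abs[of "\<lambda>k. c k x" "B n"] by linarith
      then show ?case
        using le[of x] abs_triangle_ineq4[of "\<Sum>k\<in>B n. c k x" "infsum (\<lambda>k. c k x) UNIV"] by simp
    qed
    show "(\<lambda>x. \<bar>(\<Sum>k\<in>B n. c k x) - infsum (\<lambda>k. c k x) UNIV\<bar>) \<in> borel_measurable N" for n
      using sm by (intro borel_measurable_abs borel_measurable_diff borel_measurable_sum) auto
  qed (use wi in auto)
  then show "(\<lambda>n. \<integral>x. \<bar>(\<Sum>k\<in>B n. c k x) - infsum (\<lambda>k. c k x) UNIV\<bar> \<partial>N) \<longlonglongrightarrow> 0" by simp
qed

section \<open>The asymptotic variance\<close>

context stationary_law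
begin

text \<open>Testing against the sign of the conditional expectation computes its \<open>L\<^sup>1\<close>-norm.\<close>

lemma real_cond_exp_L1_le:
  assumes f: "integrable P f"
    and le: "\<And>H. H \<in> borel_measurable \<I> \<Longrightarrow> (\<And>x. \<bar>H x\<bar> \<le> 1) \<Longrightarrow> \<bar>\<integral>x. H x * f x \<partial>P\<bar> \<le> c"
  shows "(\<integral>x. \<bar>real_cond_exp P \<I> f x\<bar> \<partial>P) \<le> c"
proof -
  define H where "H x = sgn (real_cond_exp P \<I> f x)" for x
  have H [measurable]: "H \<in> borel_measurable \<I>" unfolding H_def[abs_def] by measurable
  have [measurable]: "H \<in> borel_measurable borel" using H by (rule measurable_\<I>_borel)
  have H1: "\<bar>H x\<bar> \<le> 1" for x by (simp add: H_def sgn_if)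
  have fm: "f \<in> borel_measurable P" using f by blast
  have Hf: "integrable P (\<lambda>x. H x * f x)"
    by (rule Bochner_Integration.integrable_bound[OF f])
       (use H1 fm in \<open>auto simp: abs_mult intro!: mult_left_le_one_le\<close>)
  have "(\<integral>x. \<bar>real_cond_exp P \<I> f x\<bar> \<partial>P) = (\<integral>x. H x * real_cond_exp P \<I> f x \<partial>P)"
    by (intro Bochner_Integration.integral_cong) (auto simp: H_def sgn_if)
  also have "\<dots> = (\<integral>x. H x * f x \<partial>P)" by (rule real_cond_exp_intg(2)[OF Hf H fm])
  also have "\<dots> \<le> c" using le[OF H H1] by linarith
  finally show ?thesis .
qed

end

context theta_law
begin

abbreviation cond_cov :: "'m lattice \<Rightarrow> ('m lattice \<Rightarrow> real) \<Rightarrow> real" where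
  "cond_cov \<equiv> invariant_covariance P (\<lambda>t x. x t)"

abbreviation V :: "('m lattice \<Rightarrow> real) \<Rightarrow> real" where
  "V \<equiv> asymptotic_variance P (\<lambda>t x. x t)"

definition sup_ball :: "nat \<Rightarrow> 'm lattice set" where
  "sup_ball n = {k. sup_norm k \<le> int n}"

lemma finite_sup_ball: "finite (sup_ball n)"
  unfolding sup_ball_def by (rule finite_sup_norm_ball)

lemma eventually_in_sup_ball: "\<forall>\<^sub>F n in sequentially. k \<in> sup_ball n"
  unfolding sup_ball_def eventually_sequentially
  by (rule exI[of _ "nat (sup_norm k)"]) auto

lemma admissible_ident: "admissible (\<lambda>y. y)"
  using centred by (auto simp: admissible_def intro!: lipschitz_onI)

lemma integrable_admissible_mult:
  assumes "admissible \<phi>"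
  shows "integrable P (\<lambda>x. \<phi> (x s) * \<phi> (x t))"
proof (rule integrable_mult_env)
  have [measurable]: "\<phi> \<in> borel_measurable borel" by (rule admissible_measurable[OF assms])
  show "(\<lambda>x. \<phi> (x s) * \<phi> (x t)) \<in> borel_measurable borel" by measurable
  show "\<bar>\<phi> (x s) * \<phi> (x t)\<bar> \<le> env (x s) * env (x t)" for x
    unfolding abs_mult using admissible_le_env[OF assms] env_nonneg by (intro mult_mono) auto
qed

lemma cond_cov_measurable [measurable]: "cond_cov k \<in> borel_measurable \<I>"
  unfolding invariant_covariance_def by measurable

lemma cond_cov_integrable: "integrable P (cond_cov k)"
  unfolding invariant_covariance_def
  using integrable_admissible_mult[OF admissible_ident, of 0 k] by (intro real_cond_exp_int) simp

lemma cond_cov_L1_le: "(\<integral>x. \<bar>cond_cov k x\<bar> \<partial>P) \<le> cov_bound k"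
  unfolding invariant_covariance_def
  using integrable_admissible_mult[OF admissible_ident, of 0 k] covariance_le_cov_bound[OF admissible_ident]
  by (intro real_cond_exp_L1_le) auto

lemma V_eq_infsum: "V = (\<lambda>x. infsum (\<lambda>k. cond_cov k x) UNIV)"
  by (simp add: asymptotic_variance_def[abs_def])

lemma V_measurable [measurable]: "V \<in> borel_measurable \<I>"
  unfolding V_eq_infsum by (rule infsum_measurable) measurable

lemma V_integrable: "integrable P V"
  unfolding V_eq_infsum by (rule L1_summable_series(2)[OF cond_cov_integrable cov_bound_summable cond_cov_L1_le])

lemma cond_cov_summable: "AE x in P. (\<lambda>k. cond_cov k x) summable_on UNIV"
  by (rule L1_summable_series(1)[OF cond_cov_integrable cov_bound_summable cond_cov_L1_le])

lemma cond_cov_partial_sums: "(\<lambda>n. \<integral>x. \<bar>(\<Sum>k\<in>sup_ball n. cond_cov k x) - V x\<bar> \<partial>P) \<longlonglongrightarrow> 0"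
  unfolding V_eq_infsum
  by (rule L1_summable_series(3)[OF cond_cov_integrable cov_bound_summable cond_cov_L1_le finite_sup_ball
      eventually_in_sup_ball])

lemma integral_mult_cond_cov:
  assumes H: "H \<in> borel_measurable \<I>" "\<And>x. \<bar>H x\<bar> \<le> 1"
  shows "(\<integral>x. H x * cond_cov k x \<partial>P) = (\<integral>x. H x * (x 0 * x k) \<partial>P)"
proof -
  have [measurable]: "H \<in> borel_measurable borel" using H by (intro measurable_\<I>_borel)
  have i: "integrable P (\<lambda>x. x 0 * x k)" using integrable_admissible_mult[OF admissible_ident, of 0 k] .
  have "integrable P (\<lambda>x. H x * (x 0 * x k))"
    by (rule Bochner_Integration.integrable_bound[OF i])
       (use H in \<open>auto simp: abs_mult intro!: mult_left_le_one_le\<close>)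
  then show ?thesis unfolding invariant_covariance_def
    by (intro real_cond_exp_intg(2) H) measurable
qed

text \<open>
  In the double sum the number \<open>a k\<close> occurs for all \<open>i\<close> in \<open>D n\<close> but those with \<open>i + k\<close> outside
  \<open>D n\<close>. Along a Folner sequence this is almost \<open>card (D n)\<close> times, so the double sum divided by
  \<open>card (D n)\<close> is close to the full sum of \<open>a\<close>.
\<close>

lemma folner_sum_nonneg:
  fixes a :: "'m lattice \<Rightarrow> real"
  assumes fol: "folner D" and a: "\<And>k. \<bar>a k\<bar> \<le> cov_bound k"
    and pos: "\<And>n. 0 \<le> (\<Sum>i\<in>D n. \<Sum>j\<in>D n. a (j - i))" and B: "finite B"
  shows "- infsum cov_bound (- B) \<le> sum a B"
proof -
  have summ: "cov_bound summable_on S" for S by (rule summable_on_subset_banach[OF cov_bound_summable]) simp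
  define ex where "ex n k = real (card {i \<in> D n. i + k \<notin> D n}) / real (card (D n))" for n k
  have "(\<lambda>n. - (\<Sum>k\<in>B. cov_bound k * ex n k) - infsum cov_bound (- B)) \<longlonglongrightarrow> - (\<Sum>k\<in>B. cov_bound k * 0) - infsum cov_bound (- B)"
    unfolding ex_def by (intro tendsto_intros folner_exit_tendsto[OF fol])
  moreover have "\<forall>\<^sub>F n in sequentially. - (\<Sum>k\<in>B. cov_bound k * ex n k) - infsum cov_bound (- B) \<le> sum a B"
    using folner_eventually_pos[OF fol]
  proof eventually_elim
    case (elim n)
    define N where "N = real (card (D n))"
    have N: "0 < N" using elim by (simp add: N_def)
    have fin: "finite (D n)" by (rule folner_finite[OF fol])
    have row: "(\<Sum>j\<in>D n. a (j - i)) \<le> sum a B + (\<Sum>k\<in>B. cov_bound k * of_bool (i + k \<notin> D n)) + infsum cov_bound (- B)" for i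
    proof -
      define R where "R = (\<lambda>j. j - i) ` D n"
      have R: "finite R" "k \<in> R \<longleftrightarrow> i + k \<in> D n" for k
      proof -
        show "finite R" using fin by (simp add: R_def)
        show "k \<in> R \<longleftrightarrow> i + k \<in> D n"
          unfolding R_def by (auto simp: image_iff intro!: bexI[of _ "i + k"])
      qed
      have 1: "(\<Sum>j\<in>D n. a (j - i)) = sum a R"
        unfolding R_def by (subst sum.reindex) (auto simp: inj_on_def)
      have 2: "sum a R = sum a (R \<inter> B) + sum a (R - B)"
        using sum.Int_Diff[OF R(1), of a B] by simp
      have 3: "sum a (R - B) \<le> sum cov_bound (R - B)"
        using a abs_le_D1 by (intro sum_mono) blast
      have 4: "sum cov_bound (R - B) \<le> infsum cov_bound (- B)"
        using R(1) by (intro finite_sum_le_infsum summ) (auto simp: cov_bound_nonneg)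
      have 5: "sum a (R \<inter> B) = sum a B - sum a (B - R)"
        using sum.Int_Diff[OF B, of a R] by (simp add: Int_commute)
      have "- sum a (B - R) \<le> sum cov_bound (B - R)"
        unfolding sum_negf[symmetric] using a abs_le_D2 by (intro sum_mono) blast
      also have "\<dots> = (\<Sum>k\<in>B. cov_bound k * of_bool (k \<notin> R))"
        using B by (simp add: of_bool_def if_distrib sum.If_cases Diff_eq Collect_neg_eq cong: if_cong)
      finally have 6: "- sum a (B - R) \<le> (\<Sum>k\<in>B. cov_bound k * of_bool (i + k \<notin> D n))"
        using R(2) by simp
      show ?thesis using 1 2 3 4 5 6 by linarith
    qed
    have "0 \<le> (\<Sum>i\<in>D n. \<Sum>j\<in>D n. a (j - i))" by (rule pos)
    also have "\<dots> \<le> (\<Sum>i\<in>D n. sum a B + (\<Sum>k\<in>B. cov_bound k * of_bool (i + k \<notin> D n)) + infsum cov_bound (- B))"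
      by (rule sum_mono) (rule row)
    also have "\<dots> = N * sum a B + (\<Sum>i\<in>D n. \<Sum>k\<in>B. cov_bound k * of_bool (i + k \<notin> D n)) + N * infsum cov_bound (- B)"
      by (simp add: sum.distrib N_def)
    also have "(\<Sum>i\<in>D n. \<Sum>k\<in>B. cov_bound k * of_bool (i + k \<notin> D n)) = (\<Sum>k\<in>B. cov_bound k * (N * ex n k))"
    proof -
      have "(\<Sum>i\<in>D n. of_bool (i + k \<notin> D n) :: real) = N * ex n k" for k
        using fin N by (simp add: ex_def N_def Int_def)
      then show ?thesis by (subst sum.swap) (simp add: sum_distrib_left[symmetric])
    qed
    also have "\<dots> = N * (\<Sum>k\<in>B. cov_bound k * ex n k)" by (simp add: sum_distrib_left algebra_simps)
    finally have "0 \<le> N * (sum a B + (\<Sum>k\<in>B. cov_bound k * ex n k) + infsum cov_bound (- B))"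
      by (simp add: algebra_simps)
    then have "0 \<le> sum a B + (\<Sum>k\<in>B. cov_bound k * ex n k) + infsum cov_bound (- B)"
      using N by (simp add: zero_le_mult_iff)
    then show ?case by linarith
  qed
  ultimately have "- (\<Sum>k\<in>B. cov_bound k * 0) - infsum cov_bound (- B) \<le> sum a B"
    by (intro tendsto_upperbound) auto
  then show ?thesis by simp
qed

text \<open>
  For an invariant event \<open>A\<close> and the numbers \<open>a k = \<integral>\<^sub>A x 0 * x k\<close>, the double sum over \<open>D n\<close> is the
  integral over \<open>A\<close> of the square of a sum of the field, hence nonnegative. So \<open>V\<close> has a nonnegative
  integral over every invariant event, in particular over the event that it is negative.
\<close>

lemma V_nonneg:
  fixes D :: "nat \<Rightarrow> 'm lattice set"
  assumes fol: "folner D"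
  shows "AE x in P. 0 \<le> V x"
proof -
  define A where "A = V -` {..<0}"
  have A: "A \<in> sets \<I>" unfolding A_def using measurable_sets[OF V_measurable, of "{..<0}"] by simp
  define H where "H = (indicator A :: _ \<Rightarrow> real)"
  have H: "H \<in> borel_measurable \<I>" "\<And>x. \<bar>H x\<bar> \<le> 1"
    using A by (auto simp: H_def)
  have Hm [measurable]: "H \<in> borel_measurable borel" using H by (intro measurable_\<I>_borel)
  have Vm [measurable]: "V \<in> borel_measurable borel" by (rule measurable_\<I>_borel[OF V_measurable])
  have Hint: "integrable P (\<lambda>x. H x * f x)" if "integrable P f" for f :: "_ \<Rightarrow> real"
    by (rule Bochner_Integration.integrable_bound[OF that])
       (use H that in \<open>auto simp: abs_mult intro!: mult_left_le_one_le\<close>)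
  define a where "a k = (\<integral>x. H x * (x 0 * x k) \<partial>P)" for k
  note i = integrable_admissible_mult[OF admissible_ident]
  have ak: "\<bar>a k\<bar> \<le> cov_bound k" for k
    unfolding a_def by (rule covariance_le_cov_bound[OF admissible_ident H])
  have sh: "a (j - i) = (\<integral>x. H x * (x i * x j) \<partial>P)" for i j
  proof -
    have "a (j - i) = (\<integral>x. H (field_shift i x) * (field_shift i x 0 * field_shift i x (j - i)) \<partial>P)"
      unfolding a_def by (rule integral_shift[symmetric, of "\<lambda>x. H x * (x 0 * x (j - i))"]) measurable
    then show ?thesis unfolding \<I>_measurable_shift[OF H(1)] by (simp add: field_shift_def)
  qed
  have pos: "0 \<le> (\<Sum>i\<in>D n. \<Sum>j\<in>D n. a (j - i))" for n
  proof -
    have "(\<Sum>i\<in>D n. \<Sum>j\<in>D n. a (j - i)) = (\<integral>x. (\<Sum>i\<in>D n. \<Sum>j\<in>D n. H x * (x i * x j)) \<partial>P)"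
      unfolding sh using Hint[OF i] by simp
    also have "\<dots> = (\<integral>x. H x * (\<Sum>i\<in>D n. x i)\<^sup>2 \<partial>P)"
      unfolding power2_eq_square sum_product by (simp only: sum_distrib_left)
    also have "0 \<le> \<dots>" by (intro Bochner_Integration.integral_nonneg) (simp add: H_def)
    finally show ?thesis .
  qed
  have "(\<lambda>n. sum a (sup_ball n) - (\<integral>x. H x * V x \<partial>P)) \<longlonglongrightarrow> 0"
  proof (rule Lim_null_comparison[OF _ cond_cov_partial_sums], intro always_eventually allI)
    fix n
    have cs: "integrable P (\<lambda>x. \<Sum>k\<in>sup_ball n. cond_cov k x)" using cond_cov_integrable by auto
    have "sum a (sup_ball n) = (\<Sum>k\<in>sup_ball n. \<integral>x. H x * cond_cov k x \<partial>P)"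
      unfolding a_def by (intro sum.cong refl integral_mult_cond_cov[OF H, symmetric])
    also have "\<dots> = (\<integral>x. H x * (\<Sum>k\<in>sup_ball n. cond_cov k x) \<partial>P)"
      using Hint[OF cond_cov_integrable] by (simp add: sum_distrib_left)
    finally have "sum a (sup_ball n) - (\<integral>x. H x * V x \<partial>P)
        = (\<integral>x. H x * ((\<Sum>k\<in>sup_ball n. cond_cov k x) - V x) \<partial>P)"
      using Hint[OF cs] Hint[OF V_integrable] by (simp add: right_diff_distrib)
    also have "norm \<dots> \<le> (\<integral>x. norm (H x * ((\<Sum>k\<in>sup_ball n. cond_cov k x) - V x)) \<partial>P)"
      by (rule integral_norm_bound)
    also have "\<dots> \<le> (\<integral>x. \<bar>(\<Sum>k\<in>sup_ball n. cond_cov k x) - V x\<bar> \<partial>P)"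
      using cs V_integrable H(2)
      by (intro integral_mono integrable_norm Hint Bochner_Integration.integrable_diff integrable_abs)
         (auto simp: abs_mult intro!: mult_left_le_one_le)
    finally show "norm (sum a (sup_ball n) - (\<integral>x. H x * V x \<partial>P))
        \<le> (\<integral>x. \<bar>(\<Sum>k\<in>sup_ball n. cond_cov k x) - V x\<bar> \<partial>P)" .
  qed
  then have l1: "(\<lambda>n. sum a (sup_ball n)) \<longlonglongrightarrow> (\<integral>x. H x * V x \<partial>P)" by (rule LIM_zero_cancel)
  have l2: "(\<lambda>n. - infsum cov_bound (- sup_ball n)) \<longlonglongrightarrow> - 0"
    by (intro tendsto_minus infsum_outside_tendsto_0 cov_bound_summable eventually_in_sup_ball)
  have "- 0 \<le> (\<integral>x. H x * V x \<partial>P)"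
    by (rule LIMSEQ_le[OF l2 l1]) (use folner_sum_nonneg[OF fol ak pos finite_sup_ball] in blast)
  moreover have le0: "0 \<le> - (H x * V x)" for x by (simp add: H_def A_def indicator_def)
  ultimately have "(\<integral>x. - (H x * V x) \<partial>P) = 0"
    using Bochner_Integration.integral_nonneg[of P "\<lambda>x. - (H x * V x)"] Hint[OF V_integrable] by simp
  then have "AE x in P. - (H x * V x) = 0"
    using integral_nonneg_eq_0_iff_AE[of P "\<lambda>x. - (H x * V x)"] Hint[OF V_integrable] le0 by simp
  then show ?thesis
    by eventually_elim (auto simp: H_def A_def indicator_def split: if_splits)
qed

section \<open>Truncation\<close>

definition truncated :: "nat \<Rightarrow> real \<Rightarrow> real" where
  "truncated n y = max (- real n) (min (real n) y) - (\<integral>x. max (- real n) (min (real n) (x 0)) \<partial>P)"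

definition remainder :: "nat \<Rightarrow> real \<Rightarrow> real" where
  "remainder n y = y - truncated n y"

lemma abs_truncation_le: "\<bar>max (- real n) (min (real n) y)\<bar> \<le> real n"
  by (auto simp: max_def min_def)

lemma truncation_integrable: "integrable P (\<lambda>x. max (- real n) (min (real n) (x t)))"
  by (rule integrable_bounded[of _ "real n"]) (auto simp: abs_truncation_le[simplified])

lemma truncated_admissible: "admissible (truncated n)"
  unfolding admissible_def
proof
  have "1-lipschitz_on UNIV (\<lambda>y. max (- real n) (min (real n) y))"
    by (rule truncation_1_lipschitz) (auto intro!: lipschitz_onI)
  then show "1-lipschitz_on UNIV (truncated n)"
    unfolding lipschitz_on_def truncated_def dist_real_def by simp
  show "(\<integral>x. truncated n (x 0) \<partial>P) = 0"
    unfolding truncated_def using truncation_integrable by simp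
qed

lemma remainder_admissible: "admissible (remainder n)"
  unfolding admissible_def
proof
  show "1-lipschitz_on UNIV (remainder n)"
    by (rule lipschitz_onI) (auto simp: remainder_def truncated_def dist_real_def max_def min_def)
  have "integrable P (\<lambda>x. truncated n (x 0))"
    using truncated_admissible[of n] integrable_lipschitz_coordinate by (simp add: admissible_def)
  moreover have "integrable P (\<lambda>x. x 0)"
    using admissible_ident integrable_lipschitz_coordinate[of "\<lambda>y. y"] by (simp add: admissible_def)
  ultimately show "(\<integral>x. remainder n (x 0) \<partial>P) = 0"
    unfolding remainder_def using centred truncated_admissible[of n] by (simp add: admissible_def)
qed

lemma truncated_bounded: "\<bar>truncated n y\<bar> \<le> 2 * real n"
proof -
  have "\<bar>\<integral>x. max (- real n) (min (real n) (x 0)) \<partial>P\<bar> \<le> (\<integral>x. \<bar>max (- real n) (min (real n) (x 0))\<bar> \<partial>P)"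
    by (rule integral_abs_bound)
  also have "\<dots> \<le> (\<integral>x. real n \<partial>P)"
    using truncation_integrable by (intro integral_mono integrable_abs abs_truncation_le) auto
  finally show ?thesis
    unfolding truncated_def using abs_truncation_le[of n y] by simp
qed

lemma truncated_tendsto: "(\<lambda>n. truncated n y) \<longlonglongrightarrow> y"
proof -
  have pt: "(\<lambda>n. max (- real n) (min (real n) y)) \<longlonglongrightarrow> y" for y
  proof (rule tendsto_eventually)
    obtain N :: nat where "\<bar>y\<bar> \<le> real N" using real_arch_simple by blast
    then have "max (- real n) (min (real n) y) = y" if "n \<ge> N" for n
      using that by (simp add: max_def min_def abs_le_iff)
    then show "\<forall>\<^sub>F n in sequentially. max (- real n) (min (real n) y) = y"
      by (auto simp: eventually_sequentially)
  qed
  have "(\<lambda>n. \<integral>x. max (- real n) (min (real n) (x 0)) \<partial>P) \<longlonglongrightarrow> (\<integral>x. x 0 \<partial>P)"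
  proof (rule integral_dominated_convergence[where w = "\<lambda>x. \<bar>x 0\<bar>"])
    show "AE x in P. norm (max (- real n) (min (real n) (x 0))) \<le> \<bar>x 0\<bar>" for n
      by (rule AE_I2) (auto simp: max_def min_def)
  qed (use pt integrable_abs_coordinate in auto)
  then have "(\<lambda>n. truncated n y) \<longlonglongrightarrow> y - 0"
    unfolding truncated_def using centred by (intro tendsto_diff pt) simp
  then show ?thesis by simp
qed

lemma remainder_tendsto: "(\<lambda>n. remainder n y) \<longlonglongrightarrow> 0"
  unfolding remainder_def using tendsto_diff[OF tendsto_const truncated_tendsto, of y y] by simp

text \<open>
  The first bound is summable in \<open>k\<close> uniformly in \<open>n\<close>, the second vanishes for every \<open>k\<close> as \<open>n\<close> grows.
\<close>

definition truncation_defect :: "nat \<Rightarrow> 'm lattice \<Rightarrow> real" where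
  "truncation_defect n k = min (2 * cov_bound k) (\<integral>x. \<bar>truncated n (x 0) * truncated n (x k) - x 0 * x k\<bar> \<partial>P)"

lemma truncation_defect_nonneg: "0 \<le> truncation_defect n k"
  using cov_bound_nonneg[of k] by (simp add: truncation_defect_def)

lemma truncation_defect_summable: "truncation_defect n summable_on UNIV"
proof (rule summable_on_comparison_test)
  show "(\<lambda>k. 2 * cov_bound k) summable_on UNIV" by (intro summable_on_cmult_right cov_bound_summable)
qed (auto simp: truncation_defect_nonneg, simp add: truncation_defect_def)

lemma env_dominated_tendsto_0:
  assumes [measurable]: "\<And>n. f n \<in> borel_measurable borel"
    and bd: "\<And>n x. \<bar>f n x\<bar> \<le> 2 * (env (x s) * env (x t))" and lim: "\<And>x. (\<lambda>n. f n x) \<longlonglongrightarrow> 0"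
  shows "(\<lambda>n. \<integral>x. \<bar>f n x\<bar> \<partial>P) \<longlonglongrightarrow> 0"
proof -
  have "(\<lambda>n. \<integral>x. \<bar>f n x\<bar> \<partial>P) \<longlonglongrightarrow> (\<integral>x. 0 \<partial>P)"
  proof (rule integral_dominated_convergence[where w = "\<lambda>x. 2 * (env (x s) * env (x t))"])
    have "integrable P (\<lambda>x. env (x s) * env (x t))"
      by (rule integrable_mult_env[of _ s t]) (auto simp: env_nonneg abs_mult)
    then show "integrable P (\<lambda>x. 2 * (env (x s) * env (x t)))" by simp
    show "AE x in P. (\<lambda>n. \<bar>f n x\<bar>) \<longlonglongrightarrow> 0" by (intro AE_I2 tendsto_rabs_zero lim)
    show "AE x in P. norm \<bar>f n x\<bar> \<le> 2 * (env (x s) * env (x t))" for n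
      using bd by (intro AE_I2) simp
  qed auto
  then show ?thesis by simp
qed

lemma admissible_mult_le_env:
  "admissible \<phi> \<Longrightarrow> \<bar>\<phi> y * \<phi> z\<bar> \<le> env y * env z"
  unfolding abs_mult using admissible_le_env env_nonneg by (intro mult_mono) auto

lemma truncation_defect_tendsto: "(\<lambda>n. infsum (truncation_defect n) UNIV) \<longlonglongrightarrow> 0"
proof -
  have [measurable]: "truncated n \<in> borel_measurable borel" for n
    by (rule admissible_measurable[OF truncated_admissible])
  have "(\<lambda>n. infsum (truncation_defect n) UNIV) \<longlonglongrightarrow> infsum (\<lambda>_ :: 'm lattice. 0 :: real) UNIV"
  proof (rule infsum_dominated_convergence)
    show "(\<lambda>k. 2 * cov_bound k) summable_on UNIV" by (intro summable_on_cmult_right cov_bound_summable)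
    show "\<bar>truncation_defect n k\<bar> \<le> 2 * cov_bound k" for n k
      using truncation_defect_nonneg[of n k] by (simp add: truncation_defect_def)
    fix k
    have "(\<lambda>n. \<integral>x. \<bar>truncated n (x 0) * truncated n (x k) - x 0 * x k\<bar> \<partial>P) \<longlonglongrightarrow> 0"
    proof (rule env_dominated_tendsto_0)
      show "\<bar>truncated n (x 0) * truncated n (x k) - x 0 * x k\<bar> \<le> 2 * (env (x 0) * env (x k))" for n x
        using admissible_mult_le_env[OF truncated_admissible, of n "x 0" "x k"]
          admissible_mult_le_env[OF admissible_ident, of "x 0" "x k"] by linarith
      show "(\<lambda>n. truncated n (x 0) * truncated n (x k) - x 0 * x k) \<longlonglongrightarrow> 0" for x
        by (intro LIM_zero tendsto_mult truncated_tendsto)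
    qed measurable
    then show "(\<lambda>n. truncation_defect n k) \<longlonglongrightarrow> 0"
      by (rule tendsto_sandwich[OF _ _ tendsto_const, rotated 2])
         (auto simp: truncation_defect_nonneg, simp add: truncation_defect_def)
  qed
  then show ?thesis by simp
qed

lemma remainder_covariance_tendsto:
  "(\<lambda>n. infsum (\<lambda>k. \<bar>\<integral>x. remainder n (x 0) * remainder n (x k) \<partial>P\<bar>) UNIV) \<longlonglongrightarrow> 0"
proof -
  have [measurable]: "remainder n \<in> borel_measurable borel" for n
    by (rule admissible_measurable[OF remainder_admissible])
  have "(\<lambda>n. infsum (\<lambda>k. \<bar>\<integral>x. remainder n (x 0) * remainder n (x k) \<partial>P\<bar>) UNIV)
      \<longlonglongrightarrow> infsum (\<lambda>_ :: 'm lattice. 0 :: real) UNIV"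
  proof (rule infsum_dominated_convergence[OF cov_bound_summable])
    show "\<bar>\<bar>\<integral>x. remainder n (x 0) * remainder n (x k) \<partial>P\<bar>\<bar> \<le> cov_bound k" for n k
      using covariance_le_cov_bound[OF remainder_admissible, of "\<lambda>_. 1" n k] by simp
    fix k
    have "(\<lambda>n. \<integral>x. \<bar>remainder n (x 0) * remainder n (x k)\<bar> \<partial>P) \<longlonglongrightarrow> 0"
    proof (rule env_dominated_tendsto_0)
      show "\<bar>remainder n (x 0) * remainder n (x k)\<bar> \<le> 2 * (env (x 0) * env (x k))" for n x
        using admissible_mult_le_env[OF remainder_admissible, of n "x 0" "x k"]
          mult_nonneg_nonneg[OF env_nonneg[of "x 0"] env_nonneg[of "x k"]] by linarith
      show "(\<lambda>n. remainder n (x 0) * remainder n (x k)) \<longlonglongrightarrow> 0" for x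
        using tendsto_mult[OF remainder_tendsto remainder_tendsto] by simp
    qed measurable
    then show "(\<lambda>n. \<bar>\<integral>x. remainder n (x 0) * remainder n (x k) \<partial>P\<bar>) \<longlonglongrightarrow> 0"
      by (rule Lim_null_comparison[rotated]) (auto intro!: always_eventually integral_abs_bound)
  qed
  then show ?thesis by simp
qed

section \<open>Convergence of the characteristic functions\<close>

lemma sup_ball_eq: "sup_ball M = insert 0 (near M \<union> uminus ` near M)"
proof (intro set_eqI iffI)
  fix k :: "'m lattice" assume k: "k \<in> sup_ball M"
  consider "k = 0" | "lex_less k 0" | "lex_less 0 k" using lex_less_total by blast
  then show "k \<in> insert 0 (near M \<union> uminus ` near M)"
  proof cases
    case 3
    then have "- k \<in> near M" using k by (simp add: near_def sup_ball_def lex_less_uminus_iff sup_norm_minus)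
    then have "- (- k) \<in> uminus ` near M" by (rule imageI)
    then show ?thesis by simp
  qed (use k in \<open>auto simp: near_def sup_ball_def\<close>)
qed (auto simp: near_def sup_ball_def sup_norm_minus sup_norm_eq_0_iff[THEN iffD2])

text \<open>
  The covariances at \<open>k\<close> and at \<open>- k\<close> agree, by shift invariance, also in the presence of the invariant
  factor \<open>H\<close>. This explains the factor \<open>2\<close> in \<open>local_variance\<close>.
\<close>

lemma integral_mult_local_variance:
  assumes \<phi>: "admissible \<phi>" and H: "H \<in> borel_measurable \<I>" "\<And>x. \<bar>H x\<bar> \<le> 1"
  shows "(\<integral>x. H x * local_variance \<phi> M x \<partial>P) = (\<Sum>k\<in>sup_ball M. \<integral>x. H x * (\<phi> (x 0) * \<phi> (x k)) \<partial>P)"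
proof -
  have [measurable]: "\<phi> \<in> borel_measurable borel" by (rule admissible_measurable[OF \<phi>])
  have [measurable]: "H \<in> borel_measurable borel" using H by (intro measurable_\<I>_borel)
  define a where "a k = (\<integral>x. H x * (\<phi> (x 0) * \<phi> (x k)) \<partial>P)" for k
  have i: "integrable P (\<lambda>x. H x * (\<phi> (x s) * \<phi> (x t)))" for s t
    by (rule Bochner_Integration.integrable_bound[OF integrable_admissible_mult[OF \<phi>, of s t]])
       (use H in \<open>auto simp: abs_mult intro!: mult_left_le_one_le\<close>)
  have sym: "a (- k) = a k" for k
  proof -
    have "a (- k) = (\<integral>x. H (field_shift k x) * (\<phi> (field_shift k x 0) * \<phi> (field_shift k x (- k))) \<partial>P)"
      unfolding a_def by (rule integral_shift[symmetric, of "\<lambda>x. H x * (\<phi> (x 0) * \<phi> (x (- k)))"]) measurable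
    then show ?thesis
      unfolding \<I>_measurable_shift[OF H(1)] a_def by (simp add: field_shift_def mult.commute)
  qed
  have "(\<integral>x. H x * local_variance \<phi> M x \<partial>P)
      = (\<integral>x. H x * (\<phi> (x 0) * \<phi> (x 0)) + 2 * (\<Sum>v\<in>near M. H x * (\<phi> (x 0) * \<phi> (x v))) \<partial>P)"
    by (simp add: local_variance_def power2_eq_square distrib_left sum_distrib_left mult.left_commute)
  also have "\<dots> = a 0 + 2 * (\<Sum>v\<in>near M. a v)" unfolding a_def using i by simp
  also have "\<dots> = (\<Sum>k\<in>sup_ball M. a k)"
  proof -
    have fn: "finite (near M :: 'm lattice set)" by (rule finite_near)
    have d0: "0 \<notin> near M \<union> uminus ` near M" using lex_less_irrefl by (auto simp: near_def)
    have d1: "near M \<inter> uminus ` near M = {}"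
      by (auto simp: near_def lex_less_uminus_iff dest: lex_less_asym)
    have "(\<Sum>k\<in>sup_ball M. a k) = a 0 + ((\<Sum>v\<in>near M. a v) + (\<Sum>v\<in>uminus ` near M. a v))"
      unfolding sup_ball_eq
      by (subst sum.insert[OF _ d0]) (use fn sum.union_disjoint[OF fn _ d1, of a] in auto)
    also have "(\<Sum>v\<in>uminus ` near M. a v) = (\<Sum>v\<in>near M. a v)"
      by (subst sum.reindex) (auto simp: sym)
    finally show ?thesis by simp
  qed
  finally show ?thesis by (simp add: a_def)
qed

lemma local_variance_integrable: "admissible \<phi> \<Longrightarrow> integrable P (local_variance \<phi> M)"
  unfolding local_variance_def[abs_def] power2_eq_square
  by (intro Bochner_Integration.integrable_add integrable_mult_right Bochner_Integration.integrable_sum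
      integrable_admissible_mult)

text \<open>
  After testing with an invariant \<open>H\<close> both sides are sums of covariances, which are compared one by one.
  The bound does not depend on \<open>M\<close>, so the truncation level can be chosen before \<open>M\<close>.
\<close>

lemma truncated_local_variance_close:
  "(\<integral>x. \<bar>real_cond_exp P \<I> (local_variance (truncated n) M) x - (\<Sum>k\<in>sup_ball M. cond_cov k x)\<bar> \<partial>P)
    \<le> infsum (truncation_defect n) UNIV"
proof -
  note i = integrable_admissible_mult[OF admissible_ident]
  note it = integrable_admissible_mult[OF truncated_admissible]
  have [measurable]: "truncated n \<in> borel_measurable borel"
    by (rule admissible_measurable[OF truncated_admissible])
  define S where "S x = (\<Sum>k\<in>sup_ball M. x 0 * x k)" for x :: "'m lattice \<Rightarrow> real"
  have Si: "integrable P S" unfolding S_def[abs_def] using i by simp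
  note Li = local_variance_integrable[OF truncated_admissible, of n M]
  have "AE x in P. real_cond_exp P \<I> (\<lambda>x. local_variance (truncated n) M x - S x) x
      = real_cond_exp P \<I> (local_variance (truncated n) M) x - real_cond_exp P \<I> S x"
    by (rule real_cond_exp_diff[OF Li Si])
  moreover have "AE x in P. real_cond_exp P \<I> S x = (\<Sum>k\<in>sup_ball M. cond_cov k x)"
    unfolding S_def[abs_def] invariant_covariance_def by (rule real_cond_exp_sum) (rule i)
  ultimately have ae: "AE x in P.
      \<bar>real_cond_exp P \<I> (local_variance (truncated n) M) x - (\<Sum>k\<in>sup_ball M. cond_cov k x)\<bar>
      = \<bar>real_cond_exp P \<I> (\<lambda>x. local_variance (truncated n) M x - S x) x\<bar>"
    by eventually_elim simp
  have [measurable]: "cond_cov k \<in> borel_measurable borel" for k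
    by (rule measurable_\<I>_borel[OF cond_cov_measurable])
  have cm [measurable]: "real_cond_exp P \<I> f \<in> borel_measurable borel" for f
    by (rule measurable_\<I>_borel) measurable
  have "(\<integral>x. \<bar>real_cond_exp P \<I> (local_variance (truncated n) M) x - (\<Sum>k\<in>sup_ball M. cond_cov k x)\<bar> \<partial>P)
    = (\<integral>x. \<bar>real_cond_exp P \<I> (\<lambda>x. local_variance (truncated n) M x - S x) x\<bar> \<partial>P)"
    by (rule integral_cong_AE[OF _ _ ae]) measurable
  also have "\<dots> \<le> infsum (truncation_defect n) UNIV"
  proof (rule real_cond_exp_L1_le)
    show "integrable P (\<lambda>x. local_variance (truncated n) M x - S x)" using Li Si by simp
    fix H :: "_ \<Rightarrow> real" assume H: "H \<in> borel_measurable \<I>" "\<And>x. \<bar>H x\<bar> \<le> 1"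
    have [measurable]: "H \<in> borel_measurable borel" using H by (intro measurable_\<I>_borel)
    have Hi: "integrable P (\<lambda>x. H x * f x)" if "integrable P f" for f :: "_ \<Rightarrow> real"
      by (rule Bochner_Integration.integrable_bound[OF that])
         (use H that in \<open>auto simp: abs_mult intro!: mult_left_le_one_le\<close>)
    have "(\<integral>x. H x * (local_variance (truncated n) M x - S x) \<partial>P)
        = (\<integral>x. H x * local_variance (truncated n) M x \<partial>P) - (\<integral>x. H x * S x \<partial>P)"
      using Hi[OF Li] Hi[OF Si] by (simp add: right_diff_distrib)
    also have "(\<integral>x. H x * S x \<partial>P) = (\<Sum>k\<in>sup_ball M. \<integral>x. H x * (x 0 * x k) \<partial>P)"
      unfolding S_def sum_distrib_left using Hi[OF i] by simp
    also have "(\<integral>x. H x * local_variance (truncated n) M x \<partial>P) - \<dots>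
        = (\<Sum>k\<in>sup_ball M. (\<integral>x. H x * (truncated n (x 0) * truncated n (x k)) \<partial>P) - (\<integral>x. H x * (x 0 * x k) \<partial>P))"
      unfolding integral_mult_local_variance[OF truncated_admissible H] by (rule sum_subtractf[symmetric])
    finally have "\<bar>\<integral>x. H x * (local_variance (truncated n) M x - S x) \<partial>P\<bar>
       \<le> (\<Sum>k\<in>sup_ball M. \<bar>(\<integral>x. H x * (truncated n (x 0) * truncated n (x k)) \<partial>P) - (\<integral>x. H x * (x 0 * x k) \<partial>P)\<bar>)"
      by (simp add: sum_abs)
    also have "\<dots> \<le> (\<Sum>k\<in>sup_ball M. truncation_defect n k)"
    proof (rule sum_mono)
      fix k
      have 1: "\<bar>(\<integral>x. H x * (truncated n (x 0) * truncated n (x k)) \<partial>P) - (\<integral>x. H x * (x 0 * x k) \<partial>P)\<bar> \<le> 2 * cov_bound k"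
        using covariance_le_cov_bound[OF truncated_admissible H, of n k] covariance_le_cov_bound[OF admissible_ident H, of k]
        by linarith
      have "(\<integral>x. H x * (truncated n (x 0) * truncated n (x k)) \<partial>P) - (\<integral>x. H x * (x 0 * x k) \<partial>P)
          = (\<integral>x. H x * (truncated n (x 0) * truncated n (x k) - x 0 * x k) \<partial>P)"
        using Hi[OF it, of n 0 k] Hi[OF i, of 0 k] by (simp add: right_diff_distrib)
      also have "\<bar>\<dots>\<bar> \<le> (\<integral>x. \<bar>H x * (truncated n (x 0) * truncated n (x k) - x 0 * x k)\<bar> \<partial>P)"
        by (rule integral_abs_bound)
      also have "\<dots> \<le> (\<integral>x. \<bar>truncated n (x 0) * truncated n (x k) - x 0 * x k\<bar> \<partial>P)"
        using H(2) it[of n 0 k] i[of 0 k]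
        by (intro integral_mono integrable_abs Hi Bochner_Integration.integrable_diff)
           (auto simp: abs_mult intro!: mult_left_le_one_le)
      finally show "\<bar>(\<integral>x. H x * (truncated n (x 0) * truncated n (x k)) \<partial>P) - (\<integral>x. H x * (x 0 * x k) \<partial>P)\<bar>
          \<le> truncation_defect n k" using 1 unfolding truncation_defect_def by simp
    qed
    also have "\<dots> \<le> infsum (truncation_defect n) UNIV"
      by (intro finite_sum_le_infsum truncation_defect_summable finite_sup_ball) (auto simp: truncation_defect_nonneg)
    finally show "\<bar>\<integral>x. H x * (local_variance (truncated n) M x - S x) \<partial>P\<bar> \<le> infsum (truncation_defect n) UNIV" .
  qed
  finally show ?thesis .
qed

lemma truncated_V_tendsto:
  "(\<lambda>n. \<integral>x. \<bar>max 0 (V x) - min (max 0 (V x)) (real n)\<bar> \<partial>P) \<longlonglongrightarrow> 0"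
proof -
  have [measurable]: "V \<in> borel_measurable borel" by (rule measurable_\<I>_borel[OF V_measurable])
  have "(\<lambda>n. \<integral>x. \<bar>max 0 (V x) - min (max 0 (V x)) (real n)\<bar> \<partial>P) \<longlonglongrightarrow> (\<integral>x. 0 \<partial>P)"
  proof (rule integral_dominated_convergence[where w = "\<lambda>x. \<bar>V x\<bar>"])
    show "AE x in P. (\<lambda>n. \<bar>max 0 (V x) - min (max 0 (V x)) (real n)\<bar>) \<longlonglongrightarrow> 0"
    proof (intro AE_I2 tendsto_eventually)
      fix x
      obtain N :: nat where "max 0 (V x) \<le> real N" using real_arch_simple by blast
      then have "\<bar>max 0 (V x) - min (max 0 (V x)) (real n)\<bar> = 0" if "n \<ge> N" for n
        using that by (simp add: min_def)
      then show "\<forall>\<^sub>F n in sequentially. \<bar>max 0 (V x) - min (max 0 (V x)) (real n)\<bar> = 0"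
        by (auto simp: eventually_sequentially)
    qed
    show "AE x in P. norm \<bar>max 0 (V x) - min (max 0 (V x)) (real n)\<bar> \<le> \<bar>V x\<bar>" for n
      by (intro AE_I2) (auto simp: max_def min_def)
  qed (use V_integrable in auto)
  then show ?thesis by simp
qed

text \<open>
  The parameters are chosen in this order: the cut-off \<open>b\<close> of the variance, the truncation level \<open>T\<close>,
  the range \<open>M\<close>, and finally \<open>n\<close>. The remainder of the truncation contributes little because its second
  moment is small relative to \<open>card (D n)\<close>, uniformly in \<open>n\<close>.
\<close>

theorem characteristic_function_convergence:
  fixes D :: "nat \<Rightarrow> 'm lattice set"
  assumes fol: "folner D" and inf: "filterlim (\<lambda>n. card (D n)) at_top sequentially"
  shows "(\<lambda>n. \<integral>x. iexp (u / sqrt (real (card (D n))) * (\<Sum>j\<in>D n. x j)) \<partial>P)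
    \<longlonglongrightarrow> (\<integral>x. of_real (exp (- (u\<^sup>2 * V x / 2))) \<partial>P)"
proof (rule LIMSEQ_I)
  fix e :: real assume e: "0 < e"
  have [measurable]: "V \<in> borel_measurable borel" by (rule measurable_\<I>_borel[OF V_measurable])
  have Vpos: "AE x in P. 0 \<le> V x" by (rule V_nonneg[OF fol])
  define W where "W x = max 0 (V x)" for x
  have [measurable]: "W \<in> borel_measurable borel" unfolding W_def[abs_def] by measurable
  have W0: "0 \<le> W x" for x by (simp add: W_def)
  have WV: "AE x in P. W x = V x" using Vpos by eventually_elim (simp add: W_def)
  have Wi: "integrable P W" unfolding W_def[abs_def] using V_integrable by simp
  \<comment> \<open>every choice below makes one error at most \<open>d\<close>; this value lets them add up to less than \<open>e\<close>\<close>
  define d where "d = e / (\<bar>u\<bar> + 3 * u\<^sup>2 + 2)"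
  have den: "0 < \<bar>u\<bar> + 3 * u\<^sup>2 + 2" by (simp add: add_nonneg_pos)
  have d: "0 < d" using e den by (simp add: d_def)
  have dsum: "\<bar>u\<bar> * d + 3 * u\<^sup>2 * d + d < e"
  proof -
    have "\<bar>u\<bar> * d + 3 * u\<^sup>2 * d + d < (\<bar>u\<bar> + 3 * u\<^sup>2 + 2) * d" using d by (simp add: algebra_simps)
    also have "\<dots> = e" using den by (simp add: d_def)
    finally show ?thesis .
  qed
  have "\<forall>\<^sub>F n in sequentially. (\<integral>x. \<bar>W x - min (W x) (real n)\<bar> \<partial>P) < d"
    using order_tendstoD(2)[OF truncated_V_tendsto d] by (simp add: W_def)
  then obtain b where b: "(\<integral>x. \<bar>W x - min (W x) (real b)\<bar> \<partial>P) < d"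
    by (auto simp: eventually_sequentially)
  define \<eta> where "\<eta> x = min (W x) (real b)" for x
  have WI: "W \<in> borel_measurable \<I>" unfolding W_def[abs_def] by measurable
  have \<eta>: "\<eta> \<in> borel_measurable \<I>" "\<And>x. 0 \<le> \<eta> x" "\<And>x. \<eta> x \<le> real b"
    unfolding \<eta>_def[abs_def] using WI W0 by auto
  have [measurable]: "\<eta> \<in> borel_measurable borel" using \<eta> by (intro measurable_\<I>_borel)
  have \<eta>i: "integrable P \<eta>" by (rule integrable_bounded[of _ "real b"]) (use \<eta> in auto)
  have "\<forall>\<^sub>F n in sequentially. infsum (truncation_defect n) UNIV < d \<and>
      infsum (\<lambda>k. \<bar>\<integral>x. remainder n (x 0) * remainder n (x k) \<partial>P\<bar>) UNIV < d\<^sup>2"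
    using d by (intro eventually_conj order_tendstoD(2)[OF truncation_defect_tendsto]
        order_tendstoD(2)[OF remainder_covariance_tendsto]) auto
  then obtain T where T: "infsum (truncation_defect T) UNIV < d"
      "infsum (\<lambda>k. \<bar>\<integral>x. remainder T (x 0) * remainder T (x k) \<partial>P\<bar>) UNIV < d\<^sup>2"
    by (auto simp: eventually_sequentially)
  have "(\<lambda>M. 2 * real T * infsum rate (- sup_ball M)) \<longlonglongrightarrow> 2 * real T * 0"
    by (intro tendsto_intros infsum_outside_tendsto_0 rate_summable eventually_in_sup_ball)
  then have "\<forall>\<^sub>F M in sequentially. 2 * real T * infsum rate (- sup_ball M) < d"
    using d by (intro order_tendstoD) auto
  moreover have "\<forall>\<^sub>F M in sequentially. (\<integral>x. \<bar>(\<Sum>k\<in>sup_ball M. cond_cov k x) - V x\<bar> \<partial>P) < d"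
    using d by (intro order_tendstoD(2)[OF cond_cov_partial_sums])
  ultimately have "\<forall>\<^sub>F M in sequentially. 2 * real T * infsum rate (- sup_ball M) < d \<and>
      (\<integral>x. \<bar>(\<Sum>k\<in>sup_ball M. cond_cov k x) - V x\<bar> \<partial>P) < d \<and> h0 \<le> M"
    using eventually_ge_at_top[of h0] by eventually_elim simp
  then obtain M where M: "2 * real T * infsum rate (- sup_ball M) < d"
      "(\<integral>x. \<bar>(\<Sum>k\<in>sup_ball M. cond_cov k x) - V x\<bar> \<partial>P) < d" "h0 \<le> M"
    by (auto simp: eventually_sequentially)
  have ball: "{v :: 'm lattice. int M < sup_norm v} = - sup_ball M" by (auto simp: sup_ball_def)
  define ce where "ce = real_cond_exp P \<I> (local_variance (truncated T) M)"
  have cei: "integrable P ce"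
    unfolding ce_def by (rule real_cond_exp_int[OF local_variance_integrable[OF truncated_admissible]])
  have psi: "integrable P (\<lambda>x. \<Sum>k\<in>sup_ball M. cond_cov k x)" using cond_cov_integrable by simp
  have ce\<eta>: "(\<integral>x. \<bar>ce x - \<eta> x\<bar> \<partial>P) \<le> 3 * d"
  proof -
    have "(\<integral>x. \<bar>ce x - \<eta> x\<bar> \<partial>P) \<le> (\<integral>x. \<bar>ce x - (\<Sum>k\<in>sup_ball M. cond_cov k x)\<bar>
        + \<bar>(\<Sum>k\<in>sup_ball M. cond_cov k x) - V x\<bar> + \<bar>W x - \<eta> x\<bar> \<partial>P)"
    proof (rule integral_mono_AE)
      show "AE x in P. \<bar>ce x - \<eta> x\<bar> \<le> \<bar>ce x - (\<Sum>k\<in>sup_ball M. cond_cov k x)\<bar>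
        + \<bar>(\<Sum>k\<in>sup_ball M. cond_cov k x) - V x\<bar> + \<bar>W x - \<eta> x\<bar>"
        using WV by eventually_elim linarith
    qed (use cei psi V_integrable Wi \<eta>i in auto)
    also have "\<dots> = (\<integral>x. \<bar>ce x - (\<Sum>k\<in>sup_ball M. cond_cov k x)\<bar> \<partial>P)
        + (\<integral>x. \<bar>(\<Sum>k\<in>sup_ball M. cond_cov k x) - V x\<bar> \<partial>P) + (\<integral>x. \<bar>W x - \<eta> x\<bar> \<partial>P)"
      using cei psi V_integrable Wi \<eta>i by simp
    finally show ?thesis
      using truncated_local_variance_close[of T M] T(1) M(2) b unfolding ce_def \<eta>_def by linarith
  qed
  define E\<eta> where "E\<eta> = (\<integral>x. complex_of_real (exp (- (u\<^sup>2 * \<eta> x / 2))) \<partial>P)"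
  have lim: "cmod (E\<eta> - (\<integral>x. of_real (exp (- (u\<^sup>2 * V x / 2))) \<partial>P)) \<le> u\<^sup>2 / 2 * d"
  proof -
    have iE: "integrable P (\<lambda>x. complex_of_real (exp (- (u\<^sup>2 * g x / 2))))"
      if "g \<in> borel_measurable borel" "\<And>x. 0 \<le> g x" for g :: "_ \<Rightarrow> real"
      using that by (intro integrable_bounded[of _ 1]) (auto simp del: of_real_exp)
    have "(\<integral>x. complex_of_real (exp (- (u\<^sup>2 * V x / 2))) \<partial>P) = (\<integral>x. of_real (exp (- (u\<^sup>2 * W x / 2))) \<partial>P)"
    proof (rule integral_cong_AE)
      show "AE x in P. complex_of_real (exp (- (u\<^sup>2 * V x / 2))) = of_real (exp (- (u\<^sup>2 * W x / 2)))"
        using WV by eventually_elim simp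
    qed measurable
    then have "E\<eta> - (\<integral>x. of_real (exp (- (u\<^sup>2 * V x / 2))) \<partial>P)
        = (\<integral>x. of_real (exp (- (u\<^sup>2 * \<eta> x / 2))) - of_real (exp (- (u\<^sup>2 * W x / 2))) \<partial>P)"
      unfolding E\<eta>_def using iE[of \<eta>] iE[of W] \<eta>(2) W0 by simp
    also have "cmod \<dots> \<le> (\<integral>x. cmod (of_real (exp (- (u\<^sup>2 * \<eta> x / 2))) - of_real (exp (- (u\<^sup>2 * W x / 2)))) \<partial>P)"
      by (rule integral_norm_bound)
    also have "\<dots> \<le> (\<integral>x. u\<^sup>2 / 2 * \<bar>W x - \<eta> x\<bar> \<partial>P)"
    proof (rule integral_mono)
      show "integrable P (\<lambda>x. cmod (of_real (exp (- (u\<^sup>2 * \<eta> x / 2))) - of_real (exp (- (u\<^sup>2 * W x / 2)))))"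
        using iE[of \<eta>] iE[of W] \<eta>(2) W0 by (intro integrable_norm Bochner_Integration.integrable_diff) auto
      show "integrable P (\<lambda>x. u\<^sup>2 / 2 * \<bar>W x - \<eta> x\<bar>)" using Wi \<eta>i by simp
      fix x
      have "\<bar>exp (- (u\<^sup>2 * \<eta> x / 2)) - exp (- (u\<^sup>2 * W x / 2))\<bar> \<le> \<bar>u\<^sup>2 * \<eta> x / 2 - u\<^sup>2 * W x / 2\<bar>"
        using \<eta>(2) W0 by (intro exp_minus_diff_le) auto
      also have "u\<^sup>2 * \<eta> x / 2 - u\<^sup>2 * W x / 2 = u\<^sup>2 / 2 * (\<eta> x - W x)" by (simp add: algebra_simps diff_divide_distrib)
      also have "\<bar>\<dots>\<bar> = u\<^sup>2 / 2 * \<bar>W x - \<eta> x\<bar>" unfolding abs_mult by (simp add: abs_minus_commute)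
      finally show "cmod (of_real (exp (- (u\<^sup>2 * \<eta> x / 2))) - of_real (exp (- (u\<^sup>2 * W x / 2)))) \<le> u\<^sup>2 / 2 * \<bar>W x - \<eta> x\<bar>"
        unfolding of_real_diff[symmetric] norm_of_real .
    qed
    also have "\<dots> = u\<^sup>2 / 2 * (\<integral>x. \<bar>W x - \<eta> x\<bar> \<partial>P)" by simp
    also have "\<dots> \<le> u\<^sup>2 / 2 * d" using b unfolding \<eta>_def by (intro mult_left_mono) auto
    finally show ?thesis .
  qed
  have rem: "cmod ((\<integral>x. iexp (u / sqrt (real (card A)) * (\<Sum>j\<in>A. x j)) \<partial>P)
      - (\<integral>x. iexp (u / sqrt (real (card A)) * (\<Sum>j\<in>A. truncated T (x j))) \<partial>P)) \<le> \<bar>u\<bar> * d"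
    if A: "finite A" "0 < card A" for A
  proof -
    define s where "s = u / sqrt (real (card A))"
    define N where "N = real (card A)"
    have N: "0 < N" using A by (simp add: N_def)
    have [measurable]: "truncated T \<in> borel_measurable borel" "remainder T \<in> borel_measurable borel"
      by (auto intro: admissible_measurable truncated_admissible remainder_admissible)
    define g where "g x = (\<Sum>j\<in>A. remainder T (x j))" for x :: "'m lattice \<Rightarrow> real"
    have \<kappa>: "(\<lambda>k. \<bar>\<integral>x. remainder T (x 0) * remainder T (x k) \<partial>P\<bar>) summable_on UNIV"
      by (rule summable_on_comparison_test[OF cov_bound_summable])
         (use covariance_le_cov_bound[OF remainder_admissible, of "\<lambda>_. 1"] in auto)
    note m2 = second_moment_sum_le[OF remainder_admissible A(1) \<kappa> order_refl]
    have gi: "integrable P g"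
      unfolding g_def[abs_def] using remainder_admissible[of T] integrable_lipschitz_coordinate
      by (auto simp: admissible_def)
    have "(\<integral>x. (g x)\<^sup>2 \<partial>P) \<le> N * d\<^sup>2"
      using m2(2) T(2) N unfolding g_def N_def[symmetric]
      by (meson less_imp_le mult_left_mono order_trans)
    also have "\<dots> = (sqrt N * d)\<^sup>2" using N by (simp add: power_mult_distrib)
    finally have gd: "(\<integral>x. \<bar>g x\<bar> \<partial>P) \<le> sqrt N * d"
      using m2(1)[folded g_def] gi N d by (intro expectation_abs_le_if_square_le) simp_all
    have "cmod ((\<integral>x. iexp (s * (\<Sum>j\<in>A. x j)) \<partial>P) - (\<integral>x. iexp (s * (\<Sum>j\<in>A. truncated T (x j))) \<partial>P))
      = cmod (\<integral>x. iexp (s * (\<Sum>j\<in>A. x j)) - iexp (s * (\<Sum>j\<in>A. truncated T (x j))) \<partial>P)"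
      by (subst Bochner_Integration.integral_diff) (auto intro!: integrable_bounded[of _ 1])
    also have "\<dots> \<le> (\<integral>x. cmod (iexp (s * (\<Sum>j\<in>A. x j)) - iexp (s * (\<Sum>j\<in>A. truncated T (x j)))) \<partial>P)"
      by (rule integral_norm_bound)
    also have "\<dots> \<le> (\<integral>x. \<bar>s\<bar> * \<bar>g x\<bar> \<partial>P)"
    proof (rule integral_mono)
      show "integrable P (\<lambda>x. cmod (iexp (s * (\<Sum>j\<in>A. x j)) - iexp (s * (\<Sum>j\<in>A. truncated T (x j)))))"
        by (intro integrable_norm Bochner_Integration.integrable_diff integrable_bounded[of _ 1]) auto
      show "integrable P (\<lambda>x. \<bar>s\<bar> * \<bar>g x\<bar>)" using gi by simp
      fix x :: "'m lattice \<Rightarrow> real"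
      have "cmod (iexp (s * (\<Sum>j\<in>A. x j)) - iexp (s * (\<Sum>j\<in>A. truncated T (x j))))
          \<le> \<bar>s * (\<Sum>j\<in>A. x j) - s * (\<Sum>j\<in>A. truncated T (x j))\<bar>" by (rule iexp_diff_le)
      also have "s * (\<Sum>j\<in>A. x j) - s * (\<Sum>j\<in>A. truncated T (x j)) = s * g x"
        by (simp add: g_def remainder_def sum_subtractf right_diff_distrib)
      finally show "cmod (iexp (s * (\<Sum>j\<in>A. x j)) - iexp (s * (\<Sum>j\<in>A. truncated T (x j)))) \<le> \<bar>s\<bar> * \<bar>g x\<bar>"
        by (simp only: abs_mult)
    qed
    also have "\<dots> = \<bar>s\<bar> * (\<integral>x. \<bar>g x\<bar> \<partial>P)" by simp
    also have "\<dots> \<le> \<bar>s\<bar> * (sqrt N * d)" by (intro mult_left_mono gd) simp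
    also have "\<dots> = \<bar>u\<bar> * d" using N by (simp add: s_def N_def[symmetric] abs_divide)
    finally show ?thesis unfolding s_def .
  qed
  have "\<forall>\<^sub>F n in sequentially.
    cmod ((\<integral>x. iexp (u / sqrt (real (card (D n))) * (\<Sum>j\<in>D n. truncated T (x j))) \<partial>P) - E\<eta>)
    \<le> u\<^sup>2 * (2 * real T) * infsum rate {v. int M < sup_norm v} + u\<^sup>2 / 2 * (\<integral>x. \<bar>ce x - \<eta> x\<bar> \<partial>P) + d"
    unfolding E\<eta>_def ce_def
    by (rule bounded_comparison[OF fol inf truncated_admissible truncated_bounded \<eta> M(3) d])
  then have "\<forall>\<^sub>F n in sequentially. cmod ((\<integral>x. iexp (u / sqrt (real (card (D n))) * (\<Sum>j\<in>D n. x j)) \<partial>P)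
      - (\<integral>x. of_real (exp (- (u\<^sup>2 * V x / 2))) \<partial>P)) < e"
    using folner_eventually_pos[OF fol]
  proof eventually_elim
    case (elim n)
    define a where "a = (\<integral>x. iexp (u / sqrt (real (card (D n))) * (\<Sum>j\<in>D n. x j)) \<partial>P)"
    define t where "t = (\<integral>x. iexp (u / sqrt (real (card (D n))) * (\<Sum>j\<in>D n. truncated T (x j))) \<partial>P)"
    define L where "L = (\<integral>x. complex_of_real (exp (- (u\<^sup>2 * V x / 2))) \<partial>P)"
    have 1: "cmod (a - t) \<le> \<bar>u\<bar> * d" unfolding a_def t_def by (rule rem[OF folner_finite[OF fol] elim(2)])
    have "u\<^sup>2 * (2 * real T) * infsum rate {v. int M < sup_norm v} \<le> u\<^sup>2 * d"
      unfolding ball using mult_left_mono[OF less_imp_le[OF M(1)], of "u\<^sup>2"] by (simp add: mult.assoc)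
    moreover have "u\<^sup>2 / 2 * (\<integral>x. \<bar>ce x - \<eta> x\<bar> \<partial>P) \<le> u\<^sup>2 / 2 * (3 * d)"
      by (intro mult_left_mono ce\<eta>) simp
    ultimately have 2: "cmod (t - E\<eta>) \<le> u\<^sup>2 * d + u\<^sup>2 / 2 * (3 * d) + d"
      using elim(1) unfolding t_def by linarith
    have 3: "cmod (E\<eta> - L) \<le> u\<^sup>2 / 2 * d" unfolding L_def by (rule lim)
    have "cmod (a - L) \<le> cmod (a - t) + (cmod (t - E\<eta>) + cmod (E\<eta> - L))"
      using norm_triangle_ineq[of "a - t" "t - L"] norm_triangle_ineq[of "t - E\<eta>" "E\<eta> - L"] by simp
    also have "\<dots> \<le> \<bar>u\<bar> * d + (u\<^sup>2 * d + u\<^sup>2 / 2 * (3 * d) + d + u\<^sup>2 / 2 * d)"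
      using 1 2 3 by (intro add_mono)
    also have "\<dots> = \<bar>u\<bar> * d + 3 * u\<^sup>2 * d + d" by (simp add: algebra_simps)
    also have "\<dots> < e" by (rule dsum)
    finally show ?case by (simp add: a_def L_def)
  qed
  then show "\<exists>no. \<forall>n\<ge>no. norm ((\<integral>x. iexp (u / sqrt (real (card (D n))) * (\<Sum>j\<in>D n. x j)) \<partial>P)
      - (\<integral>x. of_real (exp (- (u\<^sup>2 * V x / 2))) \<partial>P)) < e"
    unfolding eventually_sequentially .
qed

end

section \<open>From the law to the random field\<close>

lemma field_measurable:
  fixes X :: "'m::finite lattice \<Rightarrow> 'a \<Rightarrow> real"
  assumes "\<And>t. X t \<in> borel_measurable M"
  shows "(\<lambda>\<omega> t. X t \<omega>) \<in> borel_measurable M"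
  by (rule measurable_coordinatewise_then_product) (rule assms)

lemma cov_distr:
  assumes "T \<in> measurable M N" "f \<in> borel_measurable N" "g \<in> borel_measurable N"
  shows "cov (distr M N T) f g = cov M (\<lambda>\<omega>. f (T \<omega>)) (\<lambda>\<omega>. g (T \<omega>))"
  using assms unfolding cov_def by (simp add: integral_distr)

text \<open>
  The coefficients are suprema of covariances, which are determined by the law of the field.
\<close>

lemma theta_lex_law:
  fixes X :: "'m::{finite,linorder} lattice \<Rightarrow> 'a \<Rightarrow> real"
  assumes X: "\<And>t. X t \<in> borel_measurable M"
  shows "theta_lex (distr M borel (\<lambda>\<omega> t. X t \<omega>)) (\<lambda>t x. x t) h = theta_lex M X h"
proof -
  define P where "P = distr M borel (\<lambda>\<omega> t. X t \<omega>)"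
  have eq: "cov P (\<lambda>x. F (\<lambda>i\<in>{..<u}. x (\<gamma> i))) (\<lambda>x. G (x j))
      = cov M (\<lambda>\<omega>. F (\<lambda>i\<in>{..<u}. X (\<gamma> i) \<omega>)) (\<lambda>\<omega>. G (X j \<omega>))"
    if F: "F \<in> bounded_borel u" and G: "G \<in> bounded_lipschitz" for F G u and \<gamma> :: "nat \<Rightarrow> 'm lattice" and j
    unfolding P_def
  proof (rule cov_distr[OF field_measurable[OF X]])
    have Fm: "F \<in> borel_measurable (tuple_space u)" using F by (simp add: bounded_borel_def)
    have "(\<lambda>x. \<lambda>i\<in>{..<u}. x (\<gamma> i)) \<in> borel \<rightarrow>\<^sub>M tuple_space u"
      by (rule measurable_restrict) (rule measurable_coordinate_real)
    then show "(\<lambda>x. F (\<lambda>i\<in>{..<u}. x (\<gamma> i))) \<in> borel_measurable borel"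
      using Fm by (rule measurable_compose)
    obtain L where "L-lipschitz_on UNIV G" using G by (auto simp: bounded_lipschitz_def)
    then have "G \<in> borel_measurable borel"
      by (intro borel_measurable_continuous_onI lipschitz_on_continuous_on)
    then show "(\<lambda>x. G (x j)) \<in> borel_measurable borel"
      by (rule measurable_compose[OF measurable_coordinate_real])
  qed
  have "theta_lex_tuple P (\<lambda>t x. x t) u h = theta_lex_tuple M X u h" for u
    unfolding theta_lex_tuple_def
    by (rule arg_cong[of _ _ Sup], intro Collect_cong ex_cong1, rule rev_conj_cong[OF refl])
       (simp only: eq)
  then show ?thesis by (simp add: theta_lex_def P_def)
qed

text \<open>
  Stationarity concerns finitely many coordinates at a time; cylinder boxes over finite sets of
  coordinates determine a law on the product space.
\<close>

lemma stationary_law_of_field: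
  fixes X :: "'m::{finite,linorder} lattice \<Rightarrow> 'a \<Rightarrow> real"
  assumes M: "prob_space M" and X: "\<And>t. X t \<in> borel_measurable M" and stat: "strictly_stationary M X"
  shows "stationary_law (distr M borel (\<lambda>\<omega> t. X t \<omega>))"
proof -
  interpret M: prob_space M by (rule M)
  define P where "P = distr M borel (\<lambda>\<omega> t. X t \<omega>)"
  note Xm = field_measurable[OF X]
  have sP [measurable_cong]: "sets P = sets borel" by (simp add: P_def)
  interpret P: prob_space P unfolding P_def by (rule M.prob_space_distr[OF Xm])
  have "distr P P (field_shift k) = P" for k
  proof (rule measure_eqI_PiM_infinite[where I = UNIV and M = "\<lambda>_. borel"])
    show "sets (distr P P (field_shift k)) = sets (Pi\<^sub>M UNIV (\<lambda>_. borel))"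
      "sets P = sets (Pi\<^sub>M UNIV (\<lambda>_. borel))" by (simp_all add: sP sets_PiM_equal_borel)
    show "finite_measure (distr P P (field_shift k))"
      by (rule finite_measure.finite_measure_distr[OF P.finite_measure_axioms]) measurable
    fix A :: "'m lattice \<Rightarrow> real set" and J :: "'m lattice set"
    assume J: "finite J" "J \<subseteq> UNIV" and A: "\<And>i. i \<in> J \<Longrightarrow> A i \<in> sets borel"
    define B where "B = prod_emb UNIV (\<lambda>_. borel) J (Pi\<^sub>E J A)"
    have B_eq: "B = {x. \<forall>i\<in>J. x i \<in> A i}"
      by (auto simp: B_def prod_emb_def restrict_def PiE_def Pi_def extensional_def)
    have Bs: "B \<in> sets borel"
      unfolding B_def sets_PiM_equal_borel[symmetric] using J A by (intro sets_PiM_I_finite sets_PiM_I) auto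
    have box: "Pi\<^sub>E J A \<in> sets (\<Pi>\<^sub>M i\<in>J. borel)" using J A by (intro sets_PiM_I_finite) auto
    have rm: "(\<lambda>\<omega>. \<lambda>i\<in>J. X (i + l) \<omega>) \<in> M \<rightarrow>\<^sub>M (\<Pi>\<^sub>M i\<in>J. borel)" for l
      by (rule measurable_restrict) (rule X)
    have em: "emeasure M {\<omega> \<in> space M. \<forall>i\<in>J. X (i + l) \<omega> \<in> A i}
        = emeasure (distr M (\<Pi>\<^sub>M i\<in>J. borel) (\<lambda>\<omega>. \<lambda>i\<in>J. X (i + l) \<omega>)) (Pi\<^sub>E J A)" for l
      unfolding emeasure_distr[OF rm box]
      by (rule arg_cong[where f = "emeasure M"]) (auto simp: PiE_def Pi_def extensional_def restrict_def)
    have "emeasure (distr P P (field_shift k)) B = emeasure P (field_shift k -` B \<inter> space P)"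
      using Bs by (intro emeasure_distr) (auto simp: sP)
    also have "\<dots> = emeasure M ((\<lambda>\<omega> t. X t \<omega>) -` (field_shift k -` B \<inter> space P) \<inter> space M)"
    proof -
      have "field_shift k -` B \<inter> space P \<in> sets P"
        using Bs by (intro measurable_sets[of _ P P]) (auto simp: sP)
      then show ?thesis unfolding P_def using Xm by (intro emeasure_distr) auto
    qed
    also have "\<dots> = emeasure M {\<omega> \<in> space M. \<forall>i\<in>J. X (i + k) \<omega> \<in> A i}"
      by (rule arg_cong[where f = "emeasure M"]) (auto simp: B_eq field_shift_def P_def)
    also have "\<dots> = emeasure M {\<omega> \<in> space M. \<forall>i\<in>J. X (i + 0) \<omega> \<in> A i}"
      unfolding em using stat J(1) by (simp add: strictly_stationary_def)
    also have "\<dots> = emeasure M ((\<lambda>\<omega> t. X t \<omega>) -` B \<inter> space M)"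
      by (rule arg_cong[where f = "emeasure M"]) (auto simp: B_eq)
    also have "\<dots> = emeasure P B" unfolding P_def using Xm Bs by (intro emeasure_distr[symmetric])
    finally show "emeasure (distr P P (field_shift k)) (prod_emb UNIV (\<lambda>_. borel) J (Pi\<^sub>E J A))
        = emeasure P (prod_emb UNIV (\<lambda>_. borel) J (Pi\<^sub>E J A))" unfolding B_def .
  qed
  then show ?thesis unfolding P_def[symmetric] by unfold_locales (rule sP)
qed

lemma invariant_subalgebra:
  fixes X :: "'m::finite lattice \<Rightarrow> 'a \<Rightarrow> real"
  assumes M: "prob_space M" and X: "\<And>t. X t \<in> borel_measurable M"
  shows "finite_measure_subalgebra M (invariant_algebra M X)"
proof -
  interpret prob_space M by (rule M)
  have "{\<omega> \<in> space M. (\<lambda>t. X t \<omega>) \<in> B} \<in> sets M" if "B \<in> sets borel" for B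
    using measurable_sets[OF field_measurable[OF X] that] by (simp add: vimage_def Int_def conj_commute)
  then have "subalgebra M (invariant_algebra M X)"
    unfolding subalgebra_def sets_invariant_algebra
    by (auto simp: invariant_events_def invariant_algebra_def space_measure_of_conv)
  then show ?thesis by unfold_locales
qed

text \<open>
  The invariant events of the field are the preimages of the invariant sets of configurations, so
  conditional expectations can be computed on the space of configurations.
\<close>

lemma real_cond_exp_law:
  fixes X :: "'m::{finite,linorder} lattice \<Rightarrow> 'a \<Rightarrow> real"
  assumes M: "prob_space M" and X: "\<And>t. X t \<in> borel_measurable M" and stat: "strictly_stationary M X"
    and f: "integrable (distr M borel (\<lambda>\<omega> t. X t \<omega>)) f"
  shows "AE \<omega> in M. real_cond_exp M (invariant_algebra M X) (\<lambda>\<omega>. f (\<lambda>t. X t \<omega>)) \<omega>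
    = real_cond_exp (distr M borel (\<lambda>\<omega> t. X t \<omega>))
        (invariant_algebra (distr M borel (\<lambda>\<omega> t. X t \<omega>)) (\<lambda>t x. x t)) f (\<lambda>t. X t \<omega>)"
proof -
  define P where "P = distr M borel (\<lambda>\<omega> t. X t \<omega>)"
  interpret M: finite_measure_subalgebra M "invariant_algebra M X" by (rule invariant_subalgebra[OF M X])
  interpret P: stationary_law P unfolding P_def by (rule stationary_law_of_field[OF M X stat])
  note Xm = field_measurable[OF X]
  have fP: "integrable P f" using f by (simp add: P_def)
  have fm: "f \<in> borel_measurable borel" using fP P.measurable_P by blast
  define g where "g = real_cond_exp P P.\<I> f"
  have gI: "g \<in> borel_measurable P.\<I>" unfolding g_def by measurable
  have gm: "g \<in> borel_measurable borel" by (rule P.measurable_\<I>_borel[OF gI])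
  have gi: "integrable P g" unfolding g_def by (rule P.real_cond_exp_int[OF fP])
  have "AE \<omega> in M. real_cond_exp M (invariant_algebra M X) (\<lambda>\<omega>. f (\<lambda>t. X t \<omega>)) \<omega> = g (\<lambda>t. X t \<omega>)"
  proof (rule M.real_cond_exp_charact)
    fix A assume "A \<in> sets (invariant_algebra M X)"
    then obtain B where B: "B \<in> sets borel" "\<forall>k. field_shift k -` B = B" "A = {\<omega> \<in> space M. (\<lambda>t. X t \<omega>) \<in> B}"
      unfolding sets_invariant_algebra invariant_events_def by blast
    have BI: "B \<in> sets P.\<I>" using B by (simp add: P.sets_\<I>)
    have tr: "(\<integral>\<omega>\<in>A. q (\<lambda>t. X t \<omega>) \<partial>M) = (\<integral>x\<in>B. q x \<partial>P)" if "q \<in> borel_measurable borel" for q :: "_ \<Rightarrow> real"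
    proof -
      have "(\<integral>x\<in>B. q x \<partial>P) = (\<integral>\<omega>. indicator B (\<lambda>t. X t \<omega>) *\<^sub>R q (\<lambda>t. X t \<omega>) \<partial>M)"
        unfolding set_lebesgue_integral_def P_def using Xm B(1) that by (intro integral_distr) auto
      also have "\<dots> = (\<integral>\<omega>\<in>A. q (\<lambda>t. X t \<omega>) \<partial>M)"
        unfolding set_lebesgue_integral_def B(3)
        by (intro Bochner_Integration.integral_cong) (auto simp: indicator_def)
      finally show ?thesis ..
    qed
    show "(\<integral>\<omega>\<in>A. f (\<lambda>t. X t \<omega>) \<partial>M) = (\<integral>\<omega>\<in>A. g (\<lambda>t. X t \<omega>) \<partial>M)"
      unfolding tr[OF fm] tr[OF gm] unfolding g_def by (rule P.real_cond_exp_intA[OF fP BI])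
  next
    show "integrable M (\<lambda>\<omega>. f (\<lambda>t. X t \<omega>))" using fP Xm unfolding P_def by (rule integrable_distr[rotated])
    show "integrable M (\<lambda>\<omega>. g (\<lambda>t. X t \<omega>))" using gi Xm unfolding P_def by (rule integrable_distr[rotated])
    show "(\<lambda>\<omega>. g (\<lambda>t. X t \<omega>)) \<in> borel_measurable (invariant_algebra M X)"
    proof (rule measurableI)
      fix S :: "real set" assume S: "S \<in> sets borel"
      have "g -` S \<in> sets P.\<I>" using measurable_sets[OF gI S] by simp
      then have B: "g -` S \<in> sets borel" "\<forall>k. field_shift k -` (g -` S) = g -` S"
        by (auto simp: P.sets_\<I>)
      have "(\<lambda>\<omega>. g (\<lambda>t. X t \<omega>)) -` S \<inter> space M = {\<omega> \<in> space M. (\<lambda>t. X t \<omega>) \<in> g -` S}" by auto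
      moreover have "space (invariant_algebra M X) = space M"
        by (simp add: invariant_algebra_def space_measure_of_conv)
      ultimately show "(\<lambda>\<omega>. g (\<lambda>t. X t \<omega>)) -` S \<inter> space (invariant_algebra M X) \<in> sets (invariant_algebra M X)"
        unfolding sets_invariant_algebra invariant_events_def using B by auto
    qed simp
  qed
  then show ?thesis by (simp add: g_def P_def)
qed

text \<open>
  For fixed \<open>\<omega>\<close> the product is normal with variance \<open>V \<omega>\<close>, by Fubini's theorem.
\<close>

lemma char_normal_mixture:
  assumes M: "prob_space M" and Vm [measurable]: "V \<in> borel_measurable M" and pos: "AE \<omega> in M. 0 \<le> V \<omega>"
  shows "char (distr (std_normal_distribution \<Otimes>\<^sub>M M) borel (\<lambda>(\<epsilon>, \<omega>). \<epsilon> * sqrt (V \<omega>))) u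
    = (\<integral>\<omega>. of_real (exp (- (u\<^sup>2 * V \<omega> / 2))) \<partial>M)"
proof -
  interpret M: prob_space M by (rule M)
  interpret N: prob_space std_normal_distribution by (rule prob_space_normal_density) simp
  interpret pair_prob_space std_normal_distribution M ..
  have Nb: "sets std_normal_distribution = sets borel" by simp
  have m [measurable]: "(\<lambda>(\<epsilon>, \<omega>). \<epsilon> * sqrt (V \<omega>)) \<in> borel_measurable (std_normal_distribution \<Otimes>\<^sub>M M)"
    by measurable
  have "char (distr (std_normal_distribution \<Otimes>\<^sub>M M) borel (\<lambda>(\<epsilon>, \<omega>). \<epsilon> * sqrt (V \<omega>))) u
      = (\<integral>p. iexp (u * (case p of (\<epsilon>, \<omega>) \<Rightarrow> \<epsilon> * sqrt (V \<omega>))) \<partial>(std_normal_distribution \<Otimes>\<^sub>M M))"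
    unfolding char_def by (rule integral_distr[OF m]) measurable
  also have "\<dots> = (\<integral>p. (case p of (\<epsilon>, \<omega>) \<Rightarrow> iexp (u * (\<epsilon> * sqrt (V \<omega>)))) \<partial>(std_normal_distribution \<Otimes>\<^sub>M M))"
    by (intro Bochner_Integration.integral_cong) auto
  also have "\<dots> = (\<integral>\<omega>. (\<integral>\<epsilon>. iexp (u * (\<epsilon> * sqrt (V \<omega>))) \<partial>std_normal_distribution) \<partial>M)"
  proof (rule integral_snd[symmetric])
    show "integrable (std_normal_distribution \<Otimes>\<^sub>M M) (\<lambda>(\<epsilon>, \<omega>). iexp (u * (\<epsilon> * sqrt (V \<omega>))))"
      by (rule P.integrable_const_bound[of _ 1]) (auto split: prod.split)
  qed
  also have "\<dots> = (\<integral>\<omega>. of_real (exp (- (u\<^sup>2 * V \<omega> / 2))) \<partial>M)"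
  proof (rule integral_cong_AE)
    have inner: "(\<integral>\<epsilon>. iexp (u * (\<epsilon> * sqrt (V \<omega>))) \<partial>std_normal_distribution)
        = of_real (exp (- (u * sqrt (V \<omega>))\<^sup>2 / 2))" for \<omega>
    proof -
      have "u * (\<epsilon> * sqrt (V \<omega>)) = u * sqrt (V \<omega>) * \<epsilon>" for \<epsilon> by (simp add: ac_simps)
      then show ?thesis
        using fun_cong[OF char_std_normal_distribution, of "u * sqrt (V \<omega>)"]
        unfolding char_def by (simp only:)
    qed
    show "AE \<omega> in M. (\<integral>\<epsilon>. iexp (u * (\<epsilon> * sqrt (V \<omega>))) \<partial>std_normal_distribution)
        = of_real (exp (- (u\<^sup>2 * V \<omega> / 2)))"
      using pos
    proof eventually_elim
      case (elim \<omega>)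
      have e: "- (u * sqrt (V \<omega>))\<^sup>2 / 2 = - (u\<^sup>2 * V \<omega> / 2)"
        using elim by (simp add: power_mult_distrib)
      show ?case unfolding inner e ..
    qed
    show "(\<lambda>\<omega>. \<integral>\<epsilon>. iexp (u * (\<epsilon> * sqrt (V \<omega>))) \<partial>std_normal_distribution) \<in> borel_measurable M"
      unfolding inner by measurable
  qed measurable
  finally show ?thesis .
qed

theorem theorem2p9:
  fixes M :: "'a measure"
    and X :: "('m::{finite,linorder}) lattice \<Rightarrow> 'a \<Rightarrow> real"
    and D :: "nat \<Rightarrow> 'm lattice set"
    and \<alpha> \<delta> :: real
  assumes "prob_space M"
    and "\<And>t. X t \<in> borel_measurable M"
    and "strictly_stationary M X"
    and "\<And>t. integral\<^sup>L M (X t) = 0"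
    and "\<delta> > 0"
    and "\<And>t. integrable M (\<lambda>\<omega>. \<bar>X t \<omega>\<bar> powr (2 + \<delta>))"
    and "\<exists>C::real. \<forall>\<^sub>F h in sequentially. theta_lex M X h \<le> ennreal (C * real h powr (- \<alpha>))"
    and "\<alpha> > real CARD('m) * (1 + 1 / \<delta>)"
    and "\<And>n. finite (D n)"
    and "filterlim (\<lambda>n. card (D n)) at_top sequentially"
    and "(\<lambda>n. real (card (lattice_boundary (D n))) / real (card (D n))) \<longlonglongrightarrow> 0"
  shows "(AE \<omega> in M. (\<lambda>k. invariant_covariance M X k \<omega>) summable_on UNIV \<and>
                     asymptotic_variance M X \<omega> \<ge> 0) \<and>
         weak_conv_m
           (\<lambda>n. distr M borel (\<lambda>\<omega>. (\<Sum>j\<in>D n. X j \<omega>) / sqrt (real (card (D n)))))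
           (distr (std_normal_distribution \<Otimes>\<^sub>M M) borel
              (\<lambda>(\<epsilon>, \<omega>). \<epsilon> * sqrt (asymptotic_variance M X \<omega>)))"
proof -
  note M = assms(1) and X = assms(2) and stat = assms(3)
  interpret M: prob_space M by (rule M)
  define P where "P = distr M borel (\<lambda>\<omega> t. X t \<omega>)"
  note Xm = field_measurable[OF X]
  obtain C0 h1 where C0: "\<And>h. h \<ge> h1 \<Longrightarrow> theta_lex M X h \<le> ennreal (C0 * real h powr - \<alpha>)"
    using assms(7) unfolding eventually_sequentially by blast
  define C where "C = max 0 C0"
  define h0 where "h0 = max 1 h1"
  interpret P: theta_law P C \<alpha> \<delta> h0
  proof (intro theta_law.intro theta_law_axioms.intro)
    show "stationary_law P" unfolding P_def by (rule stationary_law_of_field[OF M X stat])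
    show "theta_lex P (\<lambda>t x. x t) h \<le> ennreal (C * real h powr - \<alpha>)" if "h0 \<le> h" for h
    proof -
      have "theta_lex P (\<lambda>t x. x t) h \<le> ennreal (C0 * real h powr - \<alpha>)"
        unfolding P_def theta_lex_law[OF X] using that by (intro C0) (simp add: h0_def)
      also have "\<dots> \<le> ennreal (C * real h powr - \<alpha>)"
        by (intro ennreal_leI mult_right_mono) (auto simp: C_def)
      finally show ?thesis .
    qed
    show "integrable P (\<lambda>x. \<bar>x 0\<bar> powr (2 + \<delta>))"
      unfolding P_def using assms(6)[of 0] by (subst integrable_distr_eq[OF Xm]) auto
    show "(\<integral>x. x 0 \<partial>P) = 0"
      unfolding P_def using assms(4)[of 0] by (subst integral_distr[OF Xm]) auto
  qed (use assms in \<open>auto simp: C_def h0_def\<close>)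
  have fol: "folner D" by (rule folner_if_boundary_negligible[OF assms(9-11)])
  have ic: "AE \<omega> in M. invariant_covariance M X k \<omega> = P.cond_cov k (\<lambda>t. X t \<omega>)" for k
    using real_cond_exp_law[OF M X stat, of "\<lambda>x. x 0 * x k"]
      P.integrable_admissible_mult[OF P.admissible_ident, of 0 k]
    unfolding invariant_covariance_def P_def[symmetric] by simp
  have ic_all: "AE \<omega> in M. \<forall>k. invariant_covariance M X k \<omega> = P.cond_cov k (\<lambda>t. X t \<omega>)"
    unfolding AE_all_countable using ic by blast
  have summ: "AE \<omega> in M. (\<lambda>k. P.cond_cov k (\<lambda>t. X t \<omega>)) summable_on UNIV"
  proof (rule AE_distrD[OF Xm])
    show "AE x in distr M borel (\<lambda>\<omega> t. X t \<omega>). (\<lambda>k. P.cond_cov k x) summable_on UNIV"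
      unfolding P_def[symmetric] by (rule P.cond_cov_summable)
  qed
  have Vpos: "AE \<omega> in M. 0 \<le> P.V (\<lambda>t. X t \<omega>)"
  proof (rule AE_distrD[OF Xm])
    show "AE x in distr M borel (\<lambda>\<omega> t. X t \<omega>). 0 \<le> P.V x"
      unfolding P_def[symmetric] by (rule P.V_nonneg[OF fol])
  qed
  have Veq: "AE \<omega> in M. asymptotic_variance M X \<omega> = P.V (\<lambda>t. X t \<omega>)"
    using ic_all by eventually_elim (simp add: asymptotic_variance_def)
  have pos: "AE \<omega> in M. 0 \<le> asymptotic_variance M X \<omega>"
    using Veq Vpos by eventually_elim simp
  have part1: "AE \<omega> in M. (\<lambda>k. invariant_covariance M X k \<omega>) summable_on UNIV \<and> asymptotic_variance M X \<omega> \<ge> 0"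
    using ic_all summ pos by eventually_elim simp
  have Vm: "asymptotic_variance M X \<in> borel_measurable M"
    unfolding asymptotic_variance_def[abs_def]
    by (rule infsum_measurable) (auto simp: invariant_covariance_def)
  have PVm: "P.V \<in> borel_measurable borel" by (rule P.measurable_\<I>_borel[OF P.V_measurable])
  have "weak_conv_m
           (\<lambda>n. distr M borel (\<lambda>\<omega>. (\<Sum>j\<in>D n. X j \<omega>) / sqrt (real (card (D n)))))
           (distr (std_normal_distribution \<Otimes>\<^sub>M M) borel
              (\<lambda>(\<epsilon>, \<omega>). \<epsilon> * sqrt (asymptotic_variance M X \<omega>)))"
  proof (rule levy_continuity)
    have Sm: "(\<lambda>\<omega>. (\<Sum>j\<in>D n. X j \<omega>) / sqrt (real (card (D n)))) \<in> borel_measurable M" for n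
      using X by (intro borel_measurable_divide borel_measurable_sum) auto
    show "real_distribution (distr M borel (\<lambda>\<omega>. (\<Sum>j\<in>D n. X j \<omega>) / sqrt (real (card (D n)))))" for n
      by (rule M.real_distribution_distr[OF Sm])
    interpret N: prob_space std_normal_distribution by (rule prob_space_normal_density) simp
    interpret NM: pair_prob_space std_normal_distribution M ..
    show "real_distribution (distr (std_normal_distribution \<Otimes>\<^sub>M M) borel
              (\<lambda>(\<epsilon>, \<omega>). \<epsilon> * sqrt (asymptotic_variance M X \<omega>)))"
      by (rule NM.P.real_distribution_distr) (use Vm in measurable)
    fix u
    have "char (distr M borel (\<lambda>\<omega>. (\<Sum>j\<in>D n. X j \<omega>) / sqrt (real (card (D n))))) u
        = (\<integral>x. iexp (u / sqrt (real (card (D n))) * (\<Sum>j\<in>D n. x j)) \<partial>P)" for n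
    proof -
      have "char (distr M borel (\<lambda>\<omega>. (\<Sum>j\<in>D n. X j \<omega>) / sqrt (real (card (D n))))) u
          = (\<integral>\<omega>. iexp (u * ((\<Sum>j\<in>D n. X j \<omega>) / sqrt (real (card (D n))))) \<partial>M)"
        unfolding char_def by (rule integral_distr[OF Sm]) measurable
      also have "\<dots> = (\<integral>\<omega>. iexp (u / sqrt (real (card (D n))) * (\<Sum>j\<in>D n. X j \<omega>)) \<partial>M)"
        by simp
      also have "\<dots> = (\<integral>x. iexp (u / sqrt (real (card (D n))) * (\<Sum>j\<in>D n. x j)) \<partial>P)"
        unfolding P_def by (rule integral_distr[OF Xm, symmetric]) measurable
      finally show ?thesis .
    qed
    moreover have "char (distr (std_normal_distribution \<Otimes>\<^sub>M M) borel
              (\<lambda>(\<epsilon>, \<omega>). \<epsilon> * sqrt (asymptotic_variance M X \<omega>))) u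
        = (\<integral>x. of_real (exp (- (u\<^sup>2 * P.V x / 2))) \<partial>P)"
    proof -
      have "(\<integral>x. complex_of_real (exp (- (u\<^sup>2 * P.V x / 2))) \<partial>P)
          = (\<integral>\<omega>. of_real (exp (- (u\<^sup>2 * P.V (\<lambda>t. X t \<omega>) / 2))) \<partial>M)"
      proof -
        have "(\<lambda>x. complex_of_real (exp (- (u\<^sup>2 * P.V x / 2)))) \<in> borel_measurable borel"
          using PVm by measurable
        from integral_distr[OF Xm this] show ?thesis by (simp only: P_def)
      qed
      also have "\<dots> = (\<integral>\<omega>. of_real (exp (- (u\<^sup>2 * asymptotic_variance M X \<omega> / 2))) \<partial>M)"
      proof (rule integral_cong_AE)
        show "AE \<omega> in M. complex_of_real (exp (- (u\<^sup>2 * P.V (\<lambda>t. X t \<omega>) / 2)))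
            = of_real (exp (- (u\<^sup>2 * asymptotic_variance M X \<omega> / 2)))"
          using Veq by eventually_elim simp
        have [measurable]: "(\<lambda>\<omega>. P.V (\<lambda>t. X t \<omega>)) \<in> borel_measurable M"
          by (rule measurable_compose[OF Xm PVm])
        show "(\<lambda>\<omega>. complex_of_real (exp (- (u\<^sup>2 * P.V (\<lambda>t. X t \<omega>) / 2)))) \<in> borel_measurable M" by measurable
        show "(\<lambda>\<omega>. complex_of_real (exp (- (u\<^sup>2 * asymptotic_variance M X \<omega> / 2)))) \<in> borel_measurable M"
          using Vm by measurable
      qed
      also have "\<dots> = char (distr (std_normal_distribution \<Otimes>\<^sub>M M) borel
              (\<lambda>(\<epsilon>, \<omega>). \<epsilon> * sqrt (asymptotic_variance M X \<omega>))) u"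
        by (rule char_normal_mixture[OF M Vm pos, symmetric])
      finally show ?thesis ..
    qed
    ultimately show "(\<lambda>n. char (distr M borel (\<lambda>\<omega>. (\<Sum>j\<in>D n. X j \<omega>) / sqrt (real (card (D n))))) u)
        \<longlonglongrightarrow> char (distr (std_normal_distribution \<Otimes>\<^sub>M M) borel
              (\<lambda>(\<epsilon>, \<omega>). \<epsilon> * sqrt (asymptotic_variance M X \<omega>))) u"
      using P.characteristic_function_convergence[OF fol assms(10), of u] by simp
  qed
  with part1 show ?thesis by blast
qed

end
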